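(* Let $Q$ be a $B_{n-1}$-orbit on $\mathcal{B}_n$ with $\mathcal{S}h(Q)=(w,u^* )$ and let $\sigma\in W$ be the $n$-cycle $\sigma=(n,n-1,\dots,1)$. Then $$\dim Q=\frac{\ell(w)+\ell(u^* )+|u^*\sigma w^{-1}|-n}{2},$$ where $|u^*\sigma w^{-1}|$ denotes the order of the element $u^*\sigma w^{-1}$ in the group $W$, $\ell(w)$ is the length of $w$ with respect to the standard simple reflections $S$, and $\ell(u^* )$ is the length of $u^*$ with respect to the set of simple reflections $S^*$.
   Context: Let $n\ge 2$, $G=GL(n,\mathbb{C})$, and let $\mathcal{B}_n$ be the variety of full flags in $\mathbb{C}^n$ with its natural $G$-action. Let $e_1,\dots,e_n$ be the standard basis; $(v_1\subset v_2\subset\dots\subset v_n)$ denotes the full flag whose $i$-th subspace is $\mathrm{span}\{v_1,\dots,v_i\}$. Embed $GL(n-1,\mathbb{C})$ in $G$ in the top left corner, $x\mapsto \mathrm{diag}(x,1)$, and let $B_{n-1}$ be the upper triangular Borel subgroup of $GL(n-1,\mathbb{C})$, viewed as a subgroup of $G$. It acts on $\mathcal{B}_n$ with finitely many orbits. Put $\mathcal{E}_+=(e_1\subset e_2\subset\dots\subset e_n)$ and $\mathcal{E}^*=(e_n\subset e_1\subset e_2\subset\dots\subset e_{n-1})$, with stabilizers $B$ (the upper triangular matrices) and $B^*$ in $G$, respectively. The Weyl group $W=\mathcal{S}_n$ acts by $w(e_i)=e_{w(i)}$, and hence acts on the flags spanned by permutations of the standard basis. For a $B_{n-1}$-orbit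 $Q$, $\mathcal{S}h(Q):=(w,u^* )\in W\times W$, where $w,u^*$ are the unique elements with $B\cdot Q=B\cdot w(\mathcal{E}_+)$ and $B^*\cdot Q=B^*\cdot u^*(\mathcal{E}^* )$. Here $S=\{(1,2),(2,3),\dots,(n-1,n)\}$ and $S^*=\{s_1^*,\dots,s_{n-1}^*\}$ with $s_1^*=(1,n)$ and $s_i^*=(i-1,i)$ for $i=2,\dots,n-1$. The cycle $\sigma$ satisfies $\sigma(i)=i-1$ for $i\ge2$ and $\sigma(1)=n$; permutations are composed as functions (right to left). *)

theory Defs
  imports "HOL-Analysis.Analysis" "HOL-Algebra.Bij" "HOL-Algebra.Multiplicative_Group"
    "HOL-Combinatorics.Transposition"
begin

text \<open>The index set \<open>{1 < 2 < ... < n}\<close> is an arbitrary finite well-ordered type \<open>'n\<close> with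
  \<open>n = CARD('n)\<close>; so \<open>Min UNIV\<close> plays the role of \<open>1\<close> and \<open>Max UNIV\<close> that of \<open>n\<close>.\<close>

section \<open>Krull dimension\<close>

definition irreducible_in :: "'a topology \<Rightarrow> 'a set \<Rightarrow> bool" where
  "irreducible_in X Z \<longleftrightarrow> Z \<noteq> {} \<and> Z \<subseteq> topspace X \<and>
     (\<forall>A B. closedin X A \<longrightarrow> closedin X B \<longrightarrow> Z \<subseteq> A \<union> B \<longrightarrow> Z \<subseteq> A \<or> Z \<subseteq> B)"

text \<open>Supremum of the lengths \<open>k\<close> of chains \<open>Z 0 \<subset> ... \<subset> Z k\<close> of irreducible closed sets.
  As a supremum in \<open>enat\<close>, it is \<open>0\<close> for the empty space.\<close>

definition krull_dim :: "'a topology \<Rightarrow> enat" where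
  "krull_dim X = Sup {enat k |k. \<exists>Z :: nat \<Rightarrow> 'a set.
     (\<forall>i\<le>k. closedin X (Z i) \<and> irreducible_in X (Z i)) \<and> (\<forall>i<k. Z i \<subset> Z (Suc i))}"


section \<open>Zariski topology\<close>

inductive_set poly_funs :: "(complex^'n^'m \<Rightarrow> complex) set" where
  const: "(\<lambda>_. c) \<in> poly_funs"
| entry: "(\<lambda>A. A $ i $ j) \<in> poly_funs"
| add: "f \<in> poly_funs \<Longrightarrow> g \<in> poly_funs \<Longrightarrow> (\<lambda>A. f A + g A) \<in> poly_funs"
| mult: "f \<in> poly_funs \<Longrightarrow> g \<in> poly_funs \<Longrightarrow> (\<lambda>A. f A * g A) \<in> poly_funs"

text \<open>The Zariski topology on the affine space of matrices: open sets are the complements of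
  common zero sets of polynomials in the entries.\<close>

definition zariski :: "(complex^'n^'m) topology" where
  "zariski = topology (\<lambda>U. \<exists>P \<subseteq> poly_funs. U = - {A. \<forall>f\<in>P. f A = 0})"

lemma istopology_zariski:
  "istopology (\<lambda>U :: (complex^'n^'m) set. \<exists>P \<subseteq> poly_funs. U = - {A. \<forall>f\<in>P. f A = 0})"
proof -
  have *: "(\<exists>P \<subseteq> poly_funs. U = - {A. \<forall>f\<in>P. f A = 0}) \<longleftrightarrow>
      (\<exists>P \<subseteq> poly_funs. \<forall>A. A \<in> U \<longleftrightarrow> (\<exists>f\<in>P. f A \<noteq> 0))" for U :: "(complex^'n^'m) set"
    by (simp add: Set.set_eq_iff)
  show ?thesis
    unfolding * istopology_def
  proof (intro conjI allI impI)
    fix U V :: "(complex^'n^'m) set"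
    assume "\<exists>P \<subseteq> poly_funs. \<forall>A. A \<in> U \<longleftrightarrow> (\<exists>f\<in>P. f A \<noteq> 0)"
    then obtain P where P: "P \<subseteq> poly_funs" "\<And>A. A \<in> U \<longleftrightarrow> (\<exists>f\<in>P. f A \<noteq> 0)" by metis
    assume "\<exists>P \<subseteq> poly_funs. \<forall>A. A \<in> V \<longleftrightarrow> (\<exists>f\<in>P. f A \<noteq> 0)"
    then obtain R where R: "R \<subseteq> poly_funs" "\<And>A. A \<in> V \<longleftrightarrow> (\<exists>f\<in>R. f A \<noteq> 0)" by metis
    let ?T = "(\<lambda>(f, g) A. f A * g A) ` (P \<times> R)"
    have "?T \<subseteq> poly_funs" using P(1) R(1) by (auto intro!: poly_funs.mult)
    moreover have "A \<in> U \<inter> V \<longleftrightarrow> (\<exists>h\<in>?T. h A \<noteq> 0)" for A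
      by (simp add: P(2) R(2))
    ultimately show "\<exists>P \<subseteq> poly_funs. \<forall>A. A \<in> U \<inter> V \<longleftrightarrow> (\<exists>f\<in>P. f A \<noteq> 0)" by blast
  next
    fix K :: "(complex^'n^'m) set set"
    assume "\<forall>U\<in>K. \<exists>P \<subseteq> poly_funs. \<forall>A. A \<in> U \<longleftrightarrow> (\<exists>f\<in>P. f A \<noteq> 0)"
    then obtain p where p: "\<And>U. U \<in> K \<Longrightarrow> p U \<subseteq> poly_funs"
        "\<And>U A. U \<in> K \<Longrightarrow> A \<in> U \<longleftrightarrow> (\<exists>f\<in>p U. f A \<noteq> 0)" by metis
    have "\<Union>(p ` K) \<subseteq> poly_funs" using p(1) by blast
    moreover have "A \<in> \<Union>K \<longleftrightarrow> (\<exists>f\<in>\<Union>(p ` K). f A \<noteq> 0)" for A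
      by (simp add: p(2))
    ultimately show "\<exists>P \<subseteq> poly_funs. \<forall>A. A \<in> \<Union>K \<longleftrightarrow> (\<exists>f\<in>P. f A \<noteq> 0)" by blast
  qed
qed

lemma openin_zariski: "openin zariski U \<longleftrightarrow> (\<exists>P \<subseteq> poly_funs. U = - {A. \<forall>f\<in>P. f A = 0})"
  unfolding zariski_def by (simp add: topology_inverse'[OF istopology_zariski])


section \<open>Flags and the flag variety\<close>

type_synonym 'n cvec = "(complex, 'n) vec"
type_synonym 'n cmat = "((complex, 'n) vec, 'n) vec"
type_synonym 'n flag = "'n \<Rightarrow> 'n cvec set"

definition GL :: "'n::finite cmat set" where
  "GL = {g. invertible g}"

text \<open>A full flag is given by its subspaces \<open>F i\<close>; \<open>card {..i}\<close> is the position of \<open>i\<close> in the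
  well-order, so \<open>F i\<close> is the \<open>i\<close>-th subspace (the zero subspace is omitted).\<close>

definition flags :: "'n::{finite,wellorder} flag set" where
  "flags = {F. (\<forall>i. vec.subspace (F i) \<and> vec.dim (F i) = card {..i}) \<and> mono F}"

definition span_flag :: "('n::{finite,wellorder} \<Rightarrow> 'n cvec) \<Rightarrow> 'n flag" where
  "span_flag v i = vec.span (v ` {..i})"

definition act :: "'n::finite cmat \<Rightarrow> 'n flag \<Rightarrow> 'n flag" where
  "act g F i = (\<lambda>x. g *v x) ` F i"

definition sweep ::
  "'n::finite cmat set \<Rightarrow> 'n flag set \<Rightarrow> 'n flag set" where
  "sweep H X = {act g F |g F. g \<in> H \<and> F \<in> X}"

definition stabilizer :: "'n::finite flag \<Rightarrow> 'n cmat set" where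
  "stabilizer F = {g \<in> GL. act g F = F}"

definition std :: "'n::finite \<Rightarrow> 'n cvec" where
  "std i = axis i 1"

definition E_plus :: "'n::{finite,wellorder} flag" where
  "E_plus = span_flag std"

text \<open>The flag variety \<open>G/B\<close>: a set of flags is Zariski open iff its preimage under the orbit map
  \<open>g \<mapsto> g \<cdot> E_plus\<close> is Zariski open in \<open>GL\<close>.\<close>

definition flag_variety :: "'n::{finite,wellorder} flag topology" where
  "flag_variety = topology (\<lambda>U. U \<subseteq> flags \<and>
     openin (subtopology zariski GL) {g \<in> GL. act g E_plus \<in> U})"

lemma istopology_flag_variety:
  "istopology (\<lambda>U :: 'n::{finite,wellorder} flag set. U \<subseteq> flags \<and>
     openin (subtopology zariski GL) {g \<in> GL. act g E_plus \<in> U})"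
  unfolding istopology_def
proof (intro conjI allI impI; (elim conjE)?)
  fix U V :: "'n flag set"
  assume "openin (subtopology zariski GL) {g \<in> GL. act g E_plus \<in> U}"
    "openin (subtopology zariski GL) {g \<in> GL. act g E_plus \<in> V}"
  then have "openin (subtopology zariski GL)
      ({g \<in> GL. act g E_plus \<in> U} \<inter> {g \<in> GL. act g E_plus \<in> V})"
    by (rule openin_Int)
  also have "{g \<in> GL. act g E_plus \<in> U} \<inter> {g \<in> GL. act g E_plus \<in> V} =
      {g \<in> GL. act g E_plus \<in> U \<inter> V}" by blast
  finally show "openin (subtopology zariski GL) {g \<in> GL. act g E_plus \<in> U \<inter> V}" .
next
  fix K :: "'n flag set set"
  assume "\<forall>U\<in>K. U \<subseteq> flags \<and> openin (subtopology zariski GL) {g \<in> GL. act g E_plus \<in> U}"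
  then have "openin (subtopology zariski GL) (\<Union>U\<in>K. {g \<in> GL. act g E_plus \<in> U})"
    by (intro openin_Union) auto
  also have "(\<Union>U\<in>K. {g \<in> GL. act g E_plus \<in> U}) = {g \<in> GL. act g E_plus \<in> \<Union>K}" by blast
  finally show "openin (subtopology zariski GL) {g \<in> GL. act g E_plus \<in> \<Union>K}" .
qed auto

lemma openin_flag_variety:
  "openin flag_variety U \<longleftrightarrow>
     U \<subseteq> flags \<and> openin (subtopology zariski GL) {g \<in> GL. act g E_plus \<in> U}"
  unfolding flag_variety_def by (simp add: topology_inverse'[OF istopology_flag_variety])


section \<open>The Weyl group\<close>

text \<open>\<open>W\<close> is the group of all bijections of \<open>'n\<close>; multiplication is composition of functions.\<close>

abbreviation W :: "('n \<Rightarrow> 'n) monoid" where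
  "W \<equiv> BijGroup UNIV"

text \<open>The cycle \<open>1 \<mapsto> n\<close>, \<open>i \<mapsto> i - 1\<close>.\<close>

definition sigma :: "'n::{finite,wellorder} \<Rightarrow> 'n" where
  "sigma i = (if i = Min UNIV then Max UNIV else Max {..<i})"

definition adjacent :: "'n::{finite,wellorder} \<Rightarrow> 'n \<Rightarrow> bool" where
  "adjacent i j \<longleftrightarrow> i < j \<and> \<not> (\<exists>k. i < k \<and> k < j)"

definition S :: "('n::{finite,wellorder} \<Rightarrow> 'n) set" where
  "S = {Transposition.transpose i j |i j. adjacent i j}"

definition S_star :: "('n::{finite,wellorder} \<Rightarrow> 'n) set" where
  "S_star = insert (Transposition.transpose (Min UNIV) (Max UNIV))
     {Transposition.transpose i j |i j. adjacent i j \<and> j \<noteq> Max UNIV}"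

definition word_length :: "('n \<Rightarrow> 'n) set \<Rightarrow> ('n \<Rightarrow> 'n) \<Rightarrow> nat" where
  "word_length T w = (LEAST k. \<exists>ts. length ts = k \<and> set ts \<subseteq> T \<and> foldr (\<circ>) ts id = w)"

text \<open>The linear map with \<open>e_i \<mapsto> e_{w i}\<close>.\<close>

definition perm_mat :: "('n::finite \<Rightarrow> 'n) \<Rightarrow> 'n cmat" where
  "perm_mat w = (\<chi> i j. if i = w j then 1 else 0)"


section \<open>Orbits and shapes\<close>

text \<open>The upper triangular matrices of \<open>GL(n-1)\<close>, embedded by \<open>x \<mapsto> diag(x,1)\<close>.\<close>

definition B_pred :: "'n::{finite,wellorder} cmat set" where
  "B_pred = {g \<in> GL. (\<forall>i j. j < i \<longrightarrow> g $ i $ j = 0) \<and>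
     g $ Max UNIV $ Max UNIV = 1 \<and>
     (\<forall>i. i \<noteq> Max UNIV \<longrightarrow> g $ i $ Max UNIV = 0 \<and> g $ Max UNIV $ i = 0)}"

definition B_pred_orbits :: "'n::{finite,wellorder} flag set set" where
  "B_pred_orbits = {sweep B_pred {F} |F. F \<in> flags}"

text \<open>Since \<open>sigma\<close> lists \<open>n, 1, ..., n - 1\<close>, this is the flag
  \<open>e_n \<subset> e_1 \<subset> ... \<subset> e_{n-1}\<close>.\<close>

definition E_star :: "'n::{finite,wellorder} flag" where
  "E_star = span_flag (\<lambda>i. std (sigma i))"

definition Sh :: "'n::{finite,wellorder} flag set \<Rightarrow> ('n \<Rightarrow> 'n) \<times> ('n \<Rightarrow> 'n)" where
  "Sh Q =
    (THE w. w \<in> carrier W \<and>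
       sweep (stabilizer E_plus) Q = sweep (stabilizer E_plus) {act (perm_mat w) E_plus},
     THE u. u \<in> carrier W \<and>
       sweep (stabilizer E_star) Q = sweep (stabilizer E_star) {act (perm_mat u) E_star})"

end

theory Submission
  imports Defs "HOL-Library.Function_Algebras" "HOL-Computational_Algebra.Polynomial"
begin

text \<open>Write \<open>n\<close> for the largest index, and \<open>H\<close> for \<open>B_pred\<close>. The group \<open>H\<close> consists of the
invertible upper triangular matrices that fix \<open>e_n\<close>. Hence an \<open>H\<close>-orbit of flags amounts to a
\<open>GL\<close>-orbit of triples: the flag \<open>E_plus\<close>, a second flag, and a line that is not contained in the
hyperplane of \<open>E_plus\<close>. The Bruhat decomposition moves the second flag to \<open>w E_plus\<close>, and the
matrices that are triangular with respect to both flags then move the line to the span of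
\<open>v = \<Sum>i\<in>\<Delta>. e_i\<close>, where \<open>n \<in> \<Delta>\<close> and \<open>pos = inverse of w\<close> decreases on \<open>\<Delta>\<close> (\<open>orbit_normal_form\<close>).
So orbits are encoded by pairs \<open>(w, \<Delta>)\<close>. Let \<open>cone\<close> be the set of the indices that lie below some
element of \<open>\<Delta>\<close> both in the usual order and in the order of positions; these are the coordinates
that occur in the orbit of \<open>v\<close> under the matrices triangular with respect to both flags.

Dimension. After a change of basis the orbit consists of the flags \<open>h w E_plus\<close>, where \<open>h\<close> is upper
triangular and fixes \<open>v\<close>. Modulo the stabilizer of \<open>w E_plus\<close>, such an \<open>h\<close> can be normalized to a
matrix that depends affinely on free entries (\<open>fixing_to_slice\<close>). These sit at the inversions of
\<open>pos\<close>, except one inversion in each row outside \<open>cone\<close>, whose entry is determined by the condition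
that \<open>v\<close> is fixed. The number of free entries is \<open>\<ell>(w) - (n - |cone|)\<close>, and it is the Krull
dimension (\<open>krull_dim_orbit\<close>). For the upper bound, a chain of irreducible closed sets in the orbit
is pulled back to \<open>GL\<close> and prolonged by a chain in a coset of the Borel group; polynomials that
separate consecutive members of such a chain are algebraically independent, whereas a set that is
parametrized polynomially by \<open>D\<close> parameters carries at most \<open>D\<close> algebraically independent functions
(\<open>prime_chain_length_le\<close>). For the lower bound, the free entries are switched on one at a time, in
an order in which each new step leaves a closed set of flags cut out by the vanishing of one
coordinate on one of the subspaces (\<open>orbit_chain_exists\<close>).

Shape. Let \<open>rho\<close> be the cyclic shift of \<open>\<Delta>\<close> to the next larger element. Replacing \<open>e_i\<close>, \<open>i \<in> \<Delta>\<close>, by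
the sum of the \<open>e_j\<close> with \<open>i \<le> j \<in> \<Delta>\<close> yields a basis adapted both to \<open>w E_plus\<close> and to the translate
of \<open>E_star\<close> that begins with \<open>v\<close>, and in it the relative position of the two flags can be read off:
\<open>u = rho^-1 w sigma^-1\<close> (\<open>Sh_orbit\<close>). Hence \<open>u sigma w^-1 = rho^-1\<close> permutes \<open>\<Delta>\<close> cyclically and
has order \<open>|\<Delta>|\<close>. Both lengths are numbers of inversions, those of \<open>u\<close> being counted with \<open>n\<close> moved in
front of the other indices and \<open>\<Delta>\<close> shifted by \<open>rho\<close>. This change of the order affects, for each
\<open>j \<notin> \<Delta>\<close>, just the pair of \<open>j\<close> and the next larger element of \<open>\<Delta>\<close>: an inversion is gained if \<open>j \<in> cone\<close> and lost otherwise
(\<open>card_moved_inversions\<close>). So \<open>\<ell>(u) = \<ell>(w) + 2 |cone| - n - |\<Delta>|\<close>, and the formula follows.\<close>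

section \<open>Polynomial functions on matrices\<close>

lemma poly_funs_sum: "(\<And>i. i \<in> I \<Longrightarrow> f i \<in> poly_funs) \<Longrightarrow> (\<lambda>A. \<Sum>i\<in>I. f i A) \<in> poly_funs"
proof (induction I rule: infinite_finite_induct)
  case (insert x F)
  then show ?case using poly_funs.add[of "f x" "\<lambda>A. \<Sum>i\<in>F. f i A"] by simp
qed (auto intro: poly_funs.const)

lemma poly_funs_prod: "(\<And>i. i \<in> I \<Longrightarrow> f i \<in> poly_funs) \<Longrightarrow> (\<lambda>A. \<Prod>i\<in>I. f i A) \<in> poly_funs"
proof (induction I rule: infinite_finite_induct)
  case (insert x F)
  then show ?case using poly_funs.mult[of "f x" "\<lambda>A. \<Prod>i\<in>F. f i A"] by simp
qed (auto intro: poly_funs.const)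

lemma poly_funs_power: "f \<in> poly_funs \<Longrightarrow> (\<lambda>A. f A ^ k) \<in> poly_funs"
  using poly_funs_prod[of "{..<k}" "\<lambda>_. f"] by simp

lemma poly_funs_det: "(det :: complex^'n^'n \<Rightarrow> complex) \<in> poly_funs"
proof -
  have "(\<lambda>A::complex^'n^'n. \<Sum>p\<in>{p. p permutes UNIV}. of_int (sign p) * (\<Prod>i\<in>UNIV. A $ i $ p i)) \<in> poly_funs"
    by (intro poly_funs_sum poly_funs.mult poly_funs_prod poly_funs.const poly_funs.entry)
  then show ?thesis by (simp add: det_def[abs_def])
qed

lemma poly_funs_mult_left:
  assumes "f \<in> poly_funs" shows "(\<lambda>A::complex^'n^'n. f ((M::complex^'n^'n) ** A)) \<in> poly_funs"
  using assms
proof induction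
  case (entry i j)
  show ?case unfolding matrix_matrix_mult_def
    by (simp, intro poly_funs_sum poly_funs.mult poly_funs.const poly_funs.entry)
qed (auto intro: poly_funs.intros)

lemma poly_funs_mult_right:
  assumes "f \<in> poly_funs" shows "(\<lambda>A::complex^'n^'n. f (A ** (M::complex^'n^'n))) \<in> poly_funs"
  using assms
proof induction
  case (entry i j)
  show ?case unfolding matrix_matrix_mult_def
    by (simp, intro poly_funs_sum poly_funs.mult poly_funs.const poly_funs.entry)
qed (auto intro: poly_funs.intros)

text \<open>The affine line through two matrices. Restricting polynomials to lines reduces statements about
irreducibility to the fact that \<open>complex poly\<close> is an integral domain.\<close>

definition line :: "complex^'n^'m \<Rightarrow> complex^'n^'m \<Rightarrow> complex \<Rightarrow> complex^'n^'m" where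
  "line A B s = (\<chi> i j. A $ i $ j + s * (B $ i $ j - A $ i $ j))"

lemma line_0 [simp]: "line A B 0 = A" and line_1 [simp]: "line A B 1 = B"
  by (simp_all add: line_def vec_eq_iff)

lemma poly_funs_line:
  assumes "f \<in> poly_funs"
  shows "\<exists>p. \<forall>s. f (line A B s) = poly p s"
  using assms
proof induction
  case (const c)
  show ?case by (rule exI[of _ "[:c:]"]) simp
next
  case (entry i j)
  show ?case by (rule exI[of _ "[:A $ i $ j, B $ i $ j - A $ i $ j:]"]) (simp add: line_def)
next
  case (add f g)
  then show ?case by (metis poly_add)
next
  case (mult f g)
  then show ?case by (metis poly_mult)
qed

text \<open>The polynomials that vanish on \<open>X\<close> satisfy the condition of a prime ideal. This is irreducibility
of \<open>X\<close> in the Zariski topology, in the form needed for arguments with polynomials; the empty set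
also satisfies it.\<close>

definition prime_on :: "(complex^'n^'m) set \<Rightarrow> bool" where
  "prime_on X \<longleftrightarrow> (\<forall>f\<in>poly_funs. \<forall>g\<in>poly_funs. (\<forall>x\<in>X. f x * g x = 0) \<longrightarrow>
     (\<forall>x\<in>X. f x = 0) \<or> (\<forall>x\<in>X. g x = 0))"

lemma prime_onD:
  "prime_on X \<Longrightarrow> f \<in> poly_funs \<Longrightarrow> g \<in> poly_funs \<Longrightarrow> (\<And>x. x \<in> X \<Longrightarrow> f x * g x = 0) \<Longrightarrow>
    (\<forall>x\<in>X. f x = 0) \<or> (\<forall>x\<in>X. g x = 0)"
  unfolding prime_on_def by blast

definition line_closed :: "(complex^'n^'m) set \<Rightarrow> bool" where
  "line_closed L \<longleftrightarrow> (\<forall>A\<in>L. \<forall>B\<in>L. \<forall>s. line A B s \<in> L)"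

lemma GL_det: "g \<in> GL \<longleftrightarrow> det g \<noteq> 0"
  by (simp add: GL_def invertible_det_nz)

text \<open>Two polynomials that are nonzero at points \<open>A\<close> and \<open>B\<close>, respectively, restrict to nonzero
polynomials in one variable on the line through \<open>A\<close> and \<open>B\<close>. So does the determinant, and the
product of the three is nonzero at some point of the line, which is then invertible.\<close>

lemma prime_on_line_closed:
  fixes L :: "'n::finite cmat set"
  assumes "line_closed L"
  shows "prime_on (L \<inter> GL)"
  unfolding prime_on_def
proof (intro ballI impI, rule ccontr)
  fix f g :: "'n cmat \<Rightarrow> complex"
  assume fg: "f \<in> poly_funs" "g \<in> poly_funs" and z: "\<forall>x\<in>L \<inter> GL. f x * g x = 0"
    and "\<not> ((\<forall>x\<in>L \<inter> GL. f x = 0) \<or> (\<forall>x\<in>L \<inter> GL. g x = 0))"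
  then obtain A B where A: "A \<in> L" "det A \<noteq> 0" "f A \<noteq> 0" and B: "B \<in> L" "det B \<noteq> 0" "g B \<noteq> 0"
    by (auto simp: GL_det)
  obtain p q r where p: "\<And>s. f (line A B s) = poly p s" and q: "\<And>s. g (line A B s) = poly q s"
    and r: "\<And>s. det (line A B s) = poly r s"
    using poly_funs_line[OF fg(1)] poly_funs_line[OF fg(2)] poly_funs_line[OF poly_funs_det] by metis
  have "poly (p * q * r) s = 0" for s
  proof (cases "det (line A B s) = 0")
    case True then show ?thesis using r by simp
  next
    case False
    then have "line A B s \<in> L \<inter> GL" using assms A B by (auto simp: line_closed_def GL_det)
    then show ?thesis using z p q by (metis mult_zero_left poly_mult)
  qed
  then have "p * q * r = 0" using poly_all_0_iff_0 by blast
  moreover have "p \<noteq> 0" using p[of 0] A by auto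
  moreover have "q \<noteq> 0" using q[of 1] B by auto
  moreover have "r \<noteq> 0" using r[of 0] A by auto
  ultimately show False by simp
qed


section \<open>Algebraic independence along a chain\<close>

text \<open>If \<open>f i\<close> separates \<open>X i\<close> from \<open>X (Suc i)\<close>, then the monomials in the \<open>f i\<close> are linearly independent
on the last set. Induction on \<open>K\<close>: order a relation by powers of the last function \<open>f K\<close>. Its lowest
power can be cancelled, because the last set is prime; restricted to \<open>X K\<close>, where \<open>f K\<close> vanishes,
the relation then reduces to one among the earlier functions.\<close>

lemma chain_algebraically_independent:
  fixes X :: "nat \<Rightarrow> (complex^'n^'m) set" and f :: "nat \<Rightarrow> complex^'n^'m \<Rightarrow> complex"
  assumes ne: "X 0 \<noteq> {}"
    and prime: "\<And>i. i \<le> K \<Longrightarrow> prime_on (X i)"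
    and f: "\<And>i. i < K \<Longrightarrow> f i \<in> poly_funs"
    and van: "\<And>i x. i < K \<Longrightarrow> x \<in> X i \<Longrightarrow> f i x = 0"
    and nz: "\<And>i. i < K \<Longrightarrow> \<exists>x\<in>X (Suc i). f i x \<noteq> 0"
    and sub: "\<And>i. i < K \<Longrightarrow> X i \<subseteq> X (Suc i)"
    and zero: "\<And>x. x \<in> X K \<Longrightarrow> (\<Sum>\<alpha>\<in>PiE {..<K} (\<lambda>_. {..m}). c \<alpha> * (\<Prod>i<K. f i x ^ \<alpha> i)) = 0"
  shows "\<forall>\<alpha>\<in>PiE {..<K} (\<lambda>_. {..m::nat}). c \<alpha> = 0"
  using prime f van nz sub zero
proof (induction K arbitrary: c)
  case 0
  obtain x where "x \<in> X 0" using ne by blast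
  from "0.prems"(6)[OF this] show ?case by simp
next
  case (Suc K)
  define A where "A = PiE {..<K} (\<lambda>_. {..m})"
  define G where "G j x = (\<Sum>\<alpha>\<in>A. c (\<alpha>(K := j)) * (\<Prod>i<K. f i x ^ \<alpha> i))" for j x
  have A': "PiE {..<Suc K} (\<lambda>_. {..m}) = (\<lambda>(j, \<alpha>). \<alpha>(K := j)) ` ({..m} \<times> A)"
    unfolding A_def lessThan_Suc by (rule PiE_insert_eq)
  have inj: "inj_on (\<lambda>(j, \<alpha>). \<alpha>(K := j)) ({..m} \<times> A)"
    using inj_combinator[of K "{..<K}" "\<lambda>_. {..m}"] unfolding A_def by simp
  have restr: "(\<Prod>i<K. f i x ^ (\<alpha>(K := j)) i) = (\<Prod>i<K. f i x ^ \<alpha> i)" for \<alpha> j x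
    by (rule prod.cong) auto
  have zero: "(\<Sum>j\<le>m. f K x ^ j * G j x) = 0" if "x \<in> X (Suc K)" for x
  proof -
    have "(\<Sum>\<alpha>\<in>PiE {..<Suc K} (\<lambda>_. {..m}). c \<alpha> * (\<Prod>i<Suc K. f i x ^ \<alpha> i))
        = (\<Sum>(j, \<alpha>)\<in>{..m} \<times> A. c (\<alpha>(K := j)) * (\<Prod>i<Suc K. f i x ^ (\<alpha>(K := j)) i))"
      unfolding A' by (subst sum.reindex[OF inj]) (simp add: case_prod_unfold)
    also have "\<dots> = (\<Sum>j\<le>m. \<Sum>\<alpha>\<in>A. c (\<alpha>(K := j)) * (\<Prod>i<Suc K. f i x ^ (\<alpha>(K := j)) i))"
      by (rule sum.cartesian_product[symmetric])
    also have "\<dots> = (\<Sum>j\<le>m. f K x ^ j * G j x)"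
      unfolding G_def sum_distrib_left
      by (intro sum.cong refl) (simp add: restr mult_ac del: fun_upd_apply, simp)
    finally show ?thesis using Suc.prems(6)[OF that] by simp
  qed
  have G: "G j \<in> poly_funs" for j
    unfolding G_def[abs_def] using Suc.prems(2)
    by (intro poly_funs_sum poly_funs.mult poly_funs_prod poly_funs.const poly_funs_power) auto
  have IH: "\<forall>\<alpha>\<in>A. c (\<alpha>(K := j)) = 0" if "\<And>x. x \<in> X K \<Longrightarrow> G j x = 0" for j
    unfolding A_def
    by (rule Suc.IH[of "\<lambda>\<alpha>. c (\<alpha>(K := j))"]) (use Suc.prems(1-5) that in \<open>auto simp: G_def A_def\<close>)
  have "\<forall>\<alpha>\<in>A. c (\<alpha>(K := j)) = 0" if "j \<le> m" for j
    using that
  proof (induction j rule: less_induct)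
    case (less j)
    have G0: "G i x = 0" if "i < j" for i x
    proof -
      have "\<forall>\<alpha>\<in>A. c (\<alpha>(K := i)) = 0" using less.IH[OF that] that less.prems by linarith
      then have "c (\<alpha>(K := i)) * (\<Prod>i<K. f i x ^ \<alpha> i) = 0" if "\<alpha> \<in> A" for \<alpha>
        using that by (metis mult_zero_left)
      then show ?thesis unfolding G_def by (intro sum.neutral ballI)
    qed
    \<comment> \<open>The relation divided by its lowest power \<open>f K x ^ j\<close>.\<close>
    define R where "R x = (\<Sum>i\<in>{j..m}. f K x ^ (i - j) * G i x)" for x
    have "f K x ^ j * R x = 0" if "x \<in> X (Suc K)" for x
    proof -
      have "0 = (\<Sum>i\<le>m. f K x ^ i * G i x)" using zero[OF that] by simp
      also have "\<dots> = (\<Sum>i\<in>{j..m}. f K x ^ i * G i x)"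
        by (rule sum.mono_neutral_right) (auto simp: G0)
      also have "\<dots> = f K x ^ j * R x"
        unfolding R_def sum_distrib_left
        by (rule sum.cong) (auto simp: power_add[symmetric] mult.assoc[symmetric])
      finally show ?thesis by simp
    qed
    moreover have "(\<lambda>x. f K x ^ j) \<in> poly_funs" using Suc.prems(2)[of K] poly_funs_power by blast
    moreover have "R \<in> poly_funs"
      unfolding R_def[abs_def] using Suc.prems(2)[of K] G
      by (intro poly_funs_sum poly_funs.mult poly_funs_power) auto
    ultimately have "(\<forall>x\<in>X (Suc K). f K x ^ j = 0) \<or> (\<forall>x\<in>X (Suc K). R x = 0)"
      by (intro prime_onD[OF Suc.prems(1)[of "Suc K"]]) auto
    then have R0: "\<forall>x\<in>X (Suc K). R x = 0" using Suc.prems(4)[of K] by auto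
    have "G j x = 0" if x: "x \<in> X K" for x
    proof -
      have "R x = (\<Sum>i\<in>{j..m}. if i = j then G j x else 0)"
        unfolding R_def using Suc.prems(3)[of K x] x by (intro sum.cong) auto
      also have "\<dots> = G j x" using less.prems by simp
      finally show ?thesis using R0 x Suc.prems(5)[of K] by auto
    qed
    then show ?case by (rule IH)
  qed
  then show ?case unfolding A' by auto
qed

text \<open>The space of complex functions, in which the relations between monomials are linear dependences.\<close>

abbreviation (input) fscale :: "complex \<Rightarrow> ('a \<Rightarrow> complex) \<Rightarrow> 'a \<Rightarrow> complex" where
  "fscale c f \<equiv> (\<lambda>x. c * f x)"

global_interpretation function_space: vector_space fscale
  by unfold_locales (auto simp: fun_eq_iff algebra_simps)

lemma sum_fun_eval: "(\<Sum>i\<in>I. f i) x = (\<Sum>i\<in>I. f i x :: complex)"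
  by (induction I rule: infinite_finite_induct) auto

text \<open>A family larger than a spanning set is linearly dependent, in coefficient form; the family may
have repetitions.\<close>

lemma dependent_family:
  fixes F :: "'b \<Rightarrow> 'a \<Rightarrow> complex"
  assumes "finite T" "finite A" "card T < card A" "\<And>\<alpha>. \<alpha> \<in> A \<Longrightarrow> F \<alpha> \<in> function_space.span T"
  shows "\<exists>c. (\<exists>\<alpha>\<in>A. c \<alpha> \<noteq> 0) \<and> (\<forall>x. (\<Sum>\<alpha>\<in>A. c \<alpha> * F \<alpha> x) = 0)"
proof (cases "inj_on F A")
  case False
  then obtain a b where ab: "a \<in> A" "b \<in> A" "a \<noteq> b" "F a = F b" by (auto simp: inj_on_def)
  let ?c = "\<lambda>\<alpha>. if \<alpha> = a then 1 else if \<alpha> = b then -1 else (0::complex)"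
  have "(\<Sum>\<alpha>\<in>A. ?c \<alpha> * F \<alpha> x) = 0" for x
  proof -
    have "(\<Sum>\<alpha>\<in>A. ?c \<alpha> * F \<alpha> x) = (\<Sum>\<alpha>\<in>{a, b}. ?c \<alpha> * F \<alpha> x)"
      by (rule sum.mono_neutral_right) (use assms ab in auto)
    also have "\<dots> = 0" using ab by simp
    finally show ?thesis .
  qed
  then show ?thesis using ab by (intro exI[of _ ?c]) auto
next
  case True
  have "function_space.dependent (F ` A)"
    using function_space.independent_span_bound[OF assms(1), of "F ` A"] assms card_image[OF True] by fastforce
  then obtain u v where u: "v \<in> F ` A" "u v \<noteq> 0" "(\<Sum>g\<in>F ` A. fscale (u g) g) = 0"
    using function_space.dependent_finite[of "F ` A"] assms(2) by auto
  have "(\<Sum>\<alpha>\<in>A. u (F \<alpha>) * F \<alpha> x) = 0" for x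
  proof -
    have "(\<Sum>\<alpha>\<in>A. u (F \<alpha>) * F \<alpha> x) = (\<Sum>g\<in>F ` A. fscale (u g) g) x"
      by (simp add: sum.reindex[OF True] sum_fun_eval)
    then show ?thesis using u(3) by simp
  qed
  then show ?thesis using u by (intro exI[of _ "\<lambda>\<alpha>. u (F \<alpha>)"]) auto
qed

text \<open>The degree is bounded in each variable separately, so that the monomials are indexed by functions
into \<open>{..e}\<close> and counted by a power.\<close>

definition monomials :: "'v set \<Rightarrow> nat \<Rightarrow> (('v \<Rightarrow> complex) \<Rightarrow> complex) set" where
  "monomials V e = (\<lambda>\<beta> \<theta>. \<Prod>v\<in>V. \<theta> v ^ \<beta> v) ` (V \<rightarrow>\<^sub>E {..e})"

lemma finite_monomials: "finite V \<Longrightarrow> finite (monomials V e)"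
  by (simp add: monomials_def finite_PiE)

lemma card_monomials_le: "finite V \<Longrightarrow> card (monomials V e) \<le> (e + 1) ^ card V"
  unfolding monomials_def
  by (rule order_trans[OF card_image_le]) (simp_all add: finite_PiE card_PiE)

lemma monomialI:
  assumes "\<And>v. v \<in> V \<Longrightarrow> \<beta> v \<le> e"
  shows "(\<lambda>\<theta>. \<Prod>v\<in>V. \<theta> v ^ \<beta> v) \<in> monomials V e"
proof -
  have "(\<lambda>\<theta>. \<Prod>v\<in>V. \<theta> v ^ \<beta> v) = (\<lambda>\<theta>. \<Prod>v\<in>V. \<theta> v ^ restrict \<beta> V v :: complex)"
    by (auto intro!: prod.cong)
  moreover have "restrict \<beta> V \<in> V \<rightarrow>\<^sub>E {..e}" using assms by auto
  ultimately show ?thesis unfolding monomials_def by blast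
qed

lemma span_monomials_mono: "e \<le> e' \<Longrightarrow> f \<in> function_space.span (monomials V e) \<Longrightarrow> f \<in> function_space.span (monomials V e')"
proof -
  assume "e \<le> e'" "f \<in> function_space.span (monomials V e)"
  moreover have "monomials V e \<subseteq> monomials V e'" if "e \<le> e'"
    unfolding monomials_def using that by (intro image_mono PiE_mono) auto
  ultimately show ?thesis using function_space.span_mono by blast
qed

lemma span_monomials_const: "(\<lambda>_. c) \<in> function_space.span (monomials V e)"
proof -
  have "(\<lambda>_. 1) \<in> monomials V e" using monomialI[of V "\<lambda>_. 0" e] by simp
  from function_space.span_scale[OF function_space.span_base[OF this], of c] show ?thesis by simp
qed

lemma span_monomials_var:
  assumes "finite V" "v \<in> V" shows "(\<lambda>\<theta>. \<theta> v) \<in> function_space.span (monomials V 1)"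
proof -
  have "(\<lambda>\<theta>. \<Prod>u\<in>V. \<theta> u ^ (if u = v then 1 else 0)) \<in> monomials V 1"
    by (rule monomialI) auto
  moreover have "(\<lambda>\<theta>::'a \<Rightarrow> complex. \<Prod>u\<in>V. \<theta> u ^ (if u = v then 1 else 0)) = (\<lambda>\<theta>. \<theta> v)"
  proof
    fix \<theta> :: "'a \<Rightarrow> complex"
    have "(\<Prod>u\<in>V. \<theta> u ^ (if u = v then 1 else 0)) = (\<Prod>u\<in>V. if u = v then \<theta> u else 1)"
      by (rule prod.cong) auto
    then show "(\<Prod>u\<in>V. \<theta> u ^ (if u = v then 1 else 0)) = \<theta> v" using assms by (simp add: prod.delta)
  qed
  ultimately show ?thesis using function_space.span_base by fastforce
qed

lemma span_monomials_add:
  "f \<in> function_space.span (monomials V e) \<Longrightarrow> g \<in> function_space.span (monomials V e) \<Longrightarrow>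
   (\<lambda>\<theta>. f \<theta> + g \<theta>) \<in> function_space.span (monomials V e)"
  using function_space.span_add[of f _ g] by (simp add: plus_fun_def)

lemma span_monomials_diff:
  "f \<in> function_space.span (monomials V e) \<Longrightarrow> g \<in> function_space.span (monomials V e) \<Longrightarrow>
   (\<lambda>\<theta>. f \<theta> - g \<theta>) \<in> function_space.span (monomials V e)"
  using function_space.span_diff[of f _ g] by (simp add: fun_diff_def)

lemma span_monomials_sum:
  "(\<And>i. i \<in> I \<Longrightarrow> f i \<in> function_space.span (monomials V e)) \<Longrightarrow> (\<lambda>\<theta>. \<Sum>i\<in>I. f i \<theta>) \<in> function_space.span (monomials V e)"
  using function_space.span_sum[of I f "monomials V e"] ext[of "\<Sum>i\<in>I. f i" "\<lambda>\<theta>. \<Sum>i\<in>I. f i \<theta>", OF sum_fun_eval]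
  by simp

lemma span_monomials_mult:
  assumes "f \<in> function_space.span (monomials V e)" "g \<in> function_space.span (monomials V e')"
  shows "(\<lambda>\<theta>. f \<theta> * g \<theta>) \<in> function_space.span (monomials V (e + e'))"
proof -
  have base: "(\<lambda>\<theta>. f \<theta> * g \<theta>) \<in> function_space.span (monomials V (e + e'))"
    if fg: "f \<in> monomials V e" "g \<in> monomials V e'" for f g
  proof -
    obtain \<beta> where \<beta>: "f = (\<lambda>\<theta>. \<Prod>v\<in>V. \<theta> v ^ \<beta> v)" "\<beta> \<in> V \<rightarrow>\<^sub>E {..e}"
      using fg(1) unfolding monomials_def by (rule imageE)
    obtain \<gamma> where \<gamma>: "g = (\<lambda>\<theta>. \<Prod>v\<in>V. \<theta> v ^ \<gamma> v)" "\<gamma> \<in> V \<rightarrow>\<^sub>E {..e'}"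
      using fg(2) unfolding monomials_def by (rule imageE)
    have "(\<lambda>\<theta>. f \<theta> * g \<theta>) = (\<lambda>\<theta>. \<Prod>v\<in>V. \<theta> v ^ (\<beta> v + \<gamma> v))"
      by (simp add: \<beta> \<gamma> power_add prod.distrib)
    moreover have "(\<lambda>\<theta>. \<Prod>v\<in>V. \<theta> v ^ (\<beta> v + \<gamma> v)) \<in> monomials V (e + e')"
      using \<beta>(2) \<gamma>(2) by (intro monomialI add_mono) (auto simp: PiE_def Pi_def)
    ultimately show ?thesis using function_space.span_base by fastforce
  qed
  have left: "(\<lambda>\<theta>. f \<theta> * g \<theta>) \<in> function_space.span (monomials V (e + e'))" if g: "g \<in> monomials V e'" for g
    using assms(1)
  proof (induction rule: function_space.span_induct_alt)
    case base
    show ?case using function_space.span_zero by (simp add: zero_fun_def)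
  next
    case (step c x y)
    have "(\<lambda>\<theta>. (fscale c x + y) \<theta> * g \<theta>) = fscale c (\<lambda>\<theta>. x \<theta> * g \<theta>) + (\<lambda>\<theta>. y \<theta> * g \<theta>)"
      by (simp add: fun_eq_iff algebra_simps)
    then show ?case by (simp only:) (rule function_space.span_add[OF function_space.span_scale[OF base[OF step(1) g]] step(2)])
  qed
  show ?thesis
    using assms(2)
  proof (induction rule: function_space.span_induct_alt)
    case base
    show ?case using function_space.span_zero by (simp add: zero_fun_def)
  next
    case (step c x y)
    have "(\<lambda>\<theta>. f \<theta> * (fscale c x + y) \<theta>) = fscale c (\<lambda>\<theta>. f \<theta> * x \<theta>) + (\<lambda>\<theta>. f \<theta> * y \<theta>)"
      by (simp add: fun_eq_iff algebra_simps)
    then show ?case by (simp only:) (rule function_space.span_add[OF function_space.span_scale[OF left[OF step(1)]] step(2)])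
  qed
qed

lemma span_monomials_prod:
  "(\<And>i. i \<in> I \<Longrightarrow> f i \<in> function_space.span (monomials V (e i))) \<Longrightarrow>
   (\<lambda>\<theta>. \<Prod>i\<in>I. f i \<theta>) \<in> function_space.span (monomials V (\<Sum>i\<in>I. e i))"
proof (induction I rule: infinite_finite_induct)
  case (insert x F)
  then show ?case using span_monomials_mult[of "f x" V "e x" "\<lambda>\<theta>. \<Prod>i\<in>F. f i \<theta>" "\<Sum>i\<in>F. e i"] by simp
qed (auto intro: span_monomials_const)

lemma span_monomials_power:
  "f \<in> function_space.span (monomials V e) \<Longrightarrow> (\<lambda>\<theta>. f \<theta> ^ k) \<in> function_space.span (monomials V (k * e))"
  using span_monomials_prod[of "{..<k}" "\<lambda>_. f" V "\<lambda>_. e"] by simp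

lemma poly_funs_parametrized:
  assumes "\<And>i j. (\<lambda>\<theta>. \<psi> \<theta> $ i $ j) \<in> function_space.span (monomials V e)" "f \<in> poly_funs"
  shows "\<exists>e'. (\<lambda>\<theta>. f (\<psi> \<theta>)) \<in> function_space.span (monomials V e')"
  using assms(2)
proof induction
  case (add f g)
  then obtain a b where "(\<lambda>\<theta>. f (\<psi> \<theta>)) \<in> function_space.span (monomials V a)"
    "(\<lambda>\<theta>. g (\<psi> \<theta>)) \<in> function_space.span (monomials V b)" by blast
  then have "(\<lambda>\<theta>. f (\<psi> \<theta>) + g (\<psi> \<theta>)) \<in> function_space.span (monomials V (max a b))"
    by (intro span_monomials_add) (auto intro: span_monomials_mono[of a "max a b"] span_monomials_mono[of b "max a b"])
  then show ?case by blast
qed (use assms(1) span_monomials_const span_monomials_mult in blast)+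

text \<open>Let \<open>c\<close> be the sum of the degrees of the separating functions in the parameters. The \<open>(m + 1) ^ K\<close>
monomials of degree at most \<open>m\<close> in the separating functions are linearly independent, and they lie
in a space of dimension at most \<open>(m * c + 1) ^ card V\<close>. For large \<open>m\<close> this forces \<open>K \<le> card V\<close>.\<close>

lemma prime_chain_length_le:
  fixes X :: "nat \<Rightarrow> (complex^'n^'m) set" and \<psi> :: "('v \<Rightarrow> complex) \<Rightarrow> complex^'n^'m"
  assumes ne: "X 0 \<noteq> {}"
    and prime: "\<And>i. i \<le> K \<Longrightarrow> prime_on (X i)"
    and sub: "\<And>i. i < K \<Longrightarrow> X i \<subseteq> X (Suc i)"
    and sep: "\<And>i. i < K \<Longrightarrow> \<exists>f\<in>poly_funs. (\<forall>x\<in>X i. f x = 0) \<and> (\<exists>x\<in>X (Suc i). f x \<noteq> 0)"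
    and V: "finite V" and \<psi>: "\<And>i j. (\<lambda>\<theta>. \<psi> \<theta> $ i $ j) \<in> function_space.span (monomials V e)"
    and cover: "X K \<subseteq> range \<psi>"
  shows "K \<le> card V"
proof (rule ccontr)
  assume "\<not> K \<le> card V"
  obtain f where f: "\<And>i. i < K \<Longrightarrow> f i \<in> poly_funs"
    and van: "\<And>i x. i < K \<Longrightarrow> x \<in> X i \<Longrightarrow> f i x = 0" and nz: "\<And>i. i < K \<Longrightarrow> \<exists>x\<in>X (Suc i). f i x \<noteq> 0"
    using sep by metis
  obtain d where d: "\<And>i. i < K \<Longrightarrow> (\<lambda>\<theta>. f i (\<psi> \<theta>)) \<in> function_space.span (monomials V (d i))"
    using poly_funs_parametrized[OF \<psi> f] by metis
  define c where "c = (\<Sum>i<K. d i)"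
  \<comment> \<open>Otherwise the monomials in the \<open>f i\<close> would outnumber a spanning set.\<close>
  have bound: "(m + 1) ^ K \<le> (m * c + 1) ^ card V" for m
  proof (rule ccontr)
    assume "\<not> (m + 1) ^ K \<le> (m * c + 1) ^ card V"
    define A where "A = ({..<K} \<rightarrow>\<^sub>E {..m})"
    have A: "finite A" "card A = (m + 1) ^ K" by (simp_all add: A_def finite_PiE card_PiE)
    have "(\<lambda>\<theta>. \<Prod>i<K. f i (\<psi> \<theta>) ^ \<alpha> i) \<in> function_space.span (monomials V (m * c))" if "\<alpha> \<in> A" for \<alpha>
    proof (rule span_monomials_mono)
      show "(\<lambda>\<theta>. \<Prod>i<K. f i (\<psi> \<theta>) ^ \<alpha> i) \<in> function_space.span (monomials V (\<Sum>i<K. \<alpha> i * d i))"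
        by (rule span_monomials_prod, rule span_monomials_power) (use d in auto)
      show "(\<Sum>i<K. \<alpha> i * d i) \<le> m * c"
        unfolding c_def sum_distrib_left using that
        by (intro sum_mono mult_right_mono) (auto simp: A_def PiE_def Pi_def)
    qed
    moreover have "card (monomials V (m * c)) < card A"
      using \<open>\<not> (m + 1) ^ K \<le> (m * c + 1) ^ card V\<close> card_monomials_le[OF V, of "m * c"] A by simp
    ultimately obtain b where b: "\<exists>\<alpha>\<in>A. b \<alpha> \<noteq> 0"
      "\<And>\<theta>. (\<Sum>\<alpha>\<in>A. b \<alpha> * (\<Prod>i<K. f i (\<psi> \<theta>) ^ \<alpha> i)) = 0"
      using dependent_family[OF finite_monomials[OF V] A(1), of "m * c" "\<lambda>\<alpha> \<theta>. \<Prod>i<K. f i (\<psi> \<theta>) ^ \<alpha> i"]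
      by blast
    have "(\<Sum>\<alpha>\<in>A. b \<alpha> * (\<Prod>i<K. f i x ^ \<alpha> i)) = 0" if "x \<in> X K" for x
      using that cover b(2) by auto
    from chain_algebraically_independent[where X = X and K = K and f = f and m = m and c = b, OF ne prime f van nz sub this[unfolded A_def]] b(1)
    show False unfolding A_def by blast
  qed
  \<comment> \<open>Large enough for \<open>(m + 1) ^ (card V + 1)\<close> to exceed \<open>((c + 1) * (m + 1)) ^ card V\<close>.\<close>
  define m where "m = (c + 1) ^ card V"
  have "(m + 1) ^ (card V + 1) \<le> (m + 1) ^ K"
    using \<open>\<not> K \<le> card V\<close> by (intro power_increasing) auto
  also have "\<dots> \<le> (m * c + 1) ^ card V" by (rule bound)
  also have "\<dots> \<le> ((c + 1) * (m + 1)) ^ card V" by (intro power_mono) (auto simp: algebra_simps)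
  also have "\<dots> = m * (m + 1) ^ card V"
    by (subst power_mult_distrib) (simp only: m_def)
  finally have "m + 1 \<le> m" by simp
  then show False by simp
qed


section \<open>Krull dimension\<close>

text \<open>It suffices to have a chain of irreducible sets, not necessarily closed in \<open>Q\<close>: taking closures
in \<open>Q\<close> preserves irreducibility, and the separating closed sets keep the closures distinct.\<close>

lemma krull_dim_ge_chain:
  assumes irr: "\<And>i. i \<le> d \<Longrightarrow> irreducible_in X (Z i)"
    and sub: "\<And>i. i < d \<Longrightarrow> Z i \<subseteq> Z (Suc i)" and Q: "\<And>i. i \<le> d \<Longrightarrow> Z i \<subseteq> Q"
    and sep: "\<And>i. i < d \<Longrightarrow> \<exists>C. closedin X C \<and> Z i \<subseteq> C \<and> \<not> Z (Suc i) \<subseteq> C"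
  shows "enat d \<le> krull_dim (subtopology X Q)"
proof -
  let ?Y = "subtopology X Q"
  define c where "c i = ?Y closure_of (Z i)" for i
  have ZY: "Z i \<subseteq> topspace ?Y" if "i \<le> d" for i
    using irr[OF that] Q[OF that] by (auto simp: irreducible_in_def)
  have Zc: "Z i \<subseteq> c i" if "i \<le> d" for i
    unfolding c_def by (rule closure_of_subset[OF ZY[OF that]])
  have closed: "closedin ?Y (c i)" for i unfolding c_def by simp
  have min: "c i \<subseteq> A" if "Z i \<subseteq> A" "closedin ?Y A" for i A
    unfolding c_def using that by (rule closure_of_minimal)
  have "irreducible_in ?Y (c i)" if i: "i \<le> d" for i
    unfolding irreducible_in_def
  proof (intro conjI allI impI)
    show "c i \<noteq> {}" using Zc[OF i] irr[OF i] by (auto simp: irreducible_in_def)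
    show "c i \<subseteq> topspace ?Y" using closedin_subset[OF closed] .
    fix A B assume AB: "closedin ?Y A" "closedin ?Y B" "c i \<subseteq> A \<union> B"
    obtain A' B' where A': "closedin X A'" "A = A' \<inter> Q" and B': "closedin X B'" "B = B' \<inter> Q"
      using AB by (auto simp: closedin_subtopology)
    have "Z i \<subseteq> A' \<union> B'" using Zc[OF i] AB(3) A' B' by blast
    then have "Z i \<subseteq> A' \<or> Z i \<subseteq> B'" using irr[OF i] A' B' unfolding irreducible_in_def by blast
    then have "Z i \<subseteq> A \<or> Z i \<subseteq> B" using Q[OF i] A' B' by blast
    then show "c i \<subseteq> A \<or> c i \<subseteq> B" using min AB by blast
  qed
  moreover have "c i \<subset> c (Suc i)" if i: "i < d" for i
  proof -
    obtain C where C: "closedin X C" "Z i \<subseteq> C" "\<not> Z (Suc i) \<subseteq> C" using sep[OF i] by blast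
    have "closedin ?Y (C \<inter> Q)" using C(1) closedin_subtopology by blast
    then have "c i \<subseteq> C \<inter> Q" using C(2) Q[of i] i by (intro min) auto
    moreover have "c i \<subseteq> c (Suc i)" using sub[OF i] Zc[of "Suc i"] i by (intro min closed) auto
    moreover have "\<not> c (Suc i) \<subseteq> C" using C(3) Zc[of "Suc i"] i by auto
    ultimately show ?thesis by blast
  qed
  ultimately show ?thesis
    unfolding krull_dim_def using closed by (intro Sup_upper) blast
qed


section \<open>Flags and the Bruhat decomposition\<close>

lemma mult_std_nth [simp]: "(A *v std j) $ i = A $ i $ j"
  by (simp add: matrix_vector_mult_def std_def axis_def if_distrib cong: if_cong)

lemma std_nth: "std j $ i = (if i = j then 1 else 0)"
  by (auto simp: std_def axis_def)

lemma perm_mat_std [simp]: "perm_mat w *v std j = std (w j)"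
  by (simp add: vec_eq_iff perm_mat_def std_nth)

lemma matrix_eq_std: "A = B \<longleftrightarrow> (\<forall>j. A *v std j = B *v std j)"
  by (auto simp: vec_eq_iff dest: spec)

lemma span_std: "vec.span (std ` A) = {x :: 'n::finite cvec. \<forall>k. k \<notin> A \<longrightarrow> x $ k = 0}"
proof
  have "vec.subspace {x :: 'n cvec. \<forall>k. k \<notin> A \<longrightarrow> x $ k = 0}"
    by (auto simp: vec.subspace_def)
  moreover have "std ` A \<subseteq> {x. \<forall>k. k \<notin> A \<longrightarrow> x $ k = 0}" by (auto simp: std_nth)
  ultimately show "vec.span (std ` A) \<subseteq> {x :: 'n cvec. \<forall>k. k \<notin> A \<longrightarrow> x $ k = 0}"
    by (rule vec.span_minimal[rotated])
  show "{x :: 'n cvec. \<forall>k. k \<notin> A \<longrightarrow> x $ k = 0} \<subseteq> vec.span (std ` A)"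
  proof safe
    fix x :: "'n cvec" assume x: "\<forall>k. k \<notin> A \<longrightarrow> x $ k = 0"
    have "x = (\<Sum>k\<in>UNIV. x $ k *s std k)" unfolding std_def by (simp add: basis_expansion)
    also have "\<dots> \<in> vec.span (std ` A)"
    proof (rule vec.span_sum)
      fix k
      show "x $ k *s std k \<in> vec.span (std ` A)"
      proof (cases "k \<in> A")
        case True then show ?thesis by (intro vec.span_scale vec.span_base imageI)
      next
        case False
        then have "x $ k *s std k = 0" using x by (simp add: vec_eq_iff)
        then show ?thesis by (simp only: vec.span_zero)
      qed
    qed
    finally show "x \<in> vec.span (std ` A)" .
  qed
qed

lemma act_mult: "act (A ** B) F = act A (act B F)"
  by (simp add: act_def fun_eq_iff image_image matrix_vector_mul_assoc)

lemma act_one [simp]: "act (mat 1) F = F"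
  by (simp add: act_def fun_eq_iff)

lemma act_span_flag: "act g (span_flag v) = span_flag (\<lambda>i. g *v v i)"
proof
  fix i
  have "(*v) g ` vec.span (v ` {..i}) = vec.span ((*v) g ` v ` {..i})"
    by (rule vec.span_image[symmetric])
  then show "act g (span_flag v) i = span_flag (\<lambda>i. g *v v i) i"
    by (simp add: act_def span_flag_def image_image)
qed

lemma act_perm_E_plus: "act (perm_mat w) E_plus = span_flag (\<lambda>i. std (w i))"
  by (simp add: E_plus_def act_span_flag)

lemma act_E_plus: "act g E_plus = span_flag (\<lambda>i. g *v std i)"
  by (simp add: E_plus_def act_span_flag)

lemma GL_mult: "A \<in> GL \<Longrightarrow> B \<in> GL \<Longrightarrow> A ** B \<in> GL"
  by (simp add: GL_def invertible_mult)

lemma GL_inverse: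
  assumes "g \<in> GL" obtains h where "h \<in> GL" "g ** h = mat 1" "h ** g = mat 1"
  using assms unfolding GL_def invertible_def by blast

abbreviation perm_inv :: "('a \<Rightarrow> 'a) \<Rightarrow> 'a \<Rightarrow> 'a" where
  "perm_inv w \<equiv> inv_into UNIV w"

lemma perm_inv_comp: "bij w \<Longrightarrow> w \<circ> perm_inv w = id" "bij w \<Longrightarrow> perm_inv w \<circ> w = id"
  by (simp_all add: fun_eq_iff bij_is_inj bij_is_surj surj_f_inv_f)

lemma perm_mat_comp: "perm_mat (w \<circ> u) = perm_mat w ** perm_mat u"
  by (subst matrix_eq_std) (simp add: matrix_vector_mul_assoc[symmetric])

lemma perm_mat_id [simp]: "perm_mat id = mat 1"
  by (subst matrix_eq_std) simp

lemma perm_mat_GL: "bij w \<Longrightarrow> perm_mat w \<in> GL"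
  unfolding GL_def invertible_def
  by (auto intro!: exI[of _ "perm_mat (perm_inv w)"] simp: perm_mat_comp[symmetric] perm_inv_comp)

lemma dim_act:
  assumes "g \<in> GL" shows "vec.dim (act g F i) = vec.dim (F i)"
proof -
  have "inj ((*v) g)"
  proof (rule injI)
    fix x y assume xy: "g *v x = g *v y"
    obtain h where "h ** g = mat 1" using GL_inverse[OF assms] by metis
    then show "x = y" using arg_cong[OF xy, of "(*v) h"] by (simp add: matrix_vector_mul_assoc)
  qed
  then show ?thesis unfolding act_def
    by (intro vec.dim_image_eq matrix_vector_mul_linear_gen) (rule inj_on_subset, auto)
qed

lemma flags_act: "F \<in> flags \<Longrightarrow> g \<in> GL \<Longrightarrow> act g F \<in> flags"
  unfolding flags_def by (auto simp: dim_act) (auto simp: act_def mono_def vec.subspace_image intro!: imageI)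

lemma E_plus_flags: "(E_plus :: 'n::{finite,wellorder} flag) \<in> flags"
proof -
  have "vec.dim (E_plus i :: 'n cvec set) = card {..i}" for i :: 'n
    unfolding E_plus_def span_flag_def span_std dim_substandard_cart ..
  moreover have "mono (E_plus :: 'n flag)"
    by (auto simp: mono_def E_plus_def span_flag_def intro!: vec.span_mono image_mono)
  ultimately show ?thesis by (simp add: flags_def E_plus_def span_flag_def)
qed

lemma act_E_plus_flags: "g \<in> GL \<Longrightarrow> act g E_plus \<in> flags"
  by (intro flags_act E_plus_flags)

lemma flags_eqI:
  assumes "F \<in> flags" "G \<in> flags" "\<And>i. F i \<subseteq> G i" shows "F = G"
  using assms by (intro ext vec.subspace_dim_equal) (auto simp: flags_def)

definition Borel :: "'n::{finite,wellorder} cmat set" where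
  "Borel = {g. (\<forall>i j. j < i \<longrightarrow> g $ i $ j = 0) \<and> (\<forall>i. g $ i $ i \<noteq> 0)}"

lemma Borel_iff: "g \<in> Borel \<longleftrightarrow> g \<in> GL \<and> (\<forall>i j. j < i \<longrightarrow> g $ i $ j = 0)"
  unfolding Borel_def GL_det by (auto simp: det_upperdiagonal)

lemma upper_E_plus:
  assumes "\<And>i j. j < i \<Longrightarrow> g $ i $ j = 0"
  shows "act g E_plus i \<subseteq> E_plus i"
proof -
  have "(g *v x) $ k = 0" if "\<forall>k. i < k \<longrightarrow> x $ k = 0" "i < k" for x k
    unfolding matrix_vector_mult_def using that assms[of _ k]
    by (auto intro!: sum.neutral) (metis le_less_linear less_le_trans not_le)
  then show ?thesis by (auto simp: act_def E_plus_def span_flag_def span_std not_le)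
qed

lemma stabilizer_E_plus: "stabilizer E_plus = Borel"
proof safe
  fix g :: "'a cmat" assume g: "g \<in> stabilizer E_plus"
  then have GL: "g \<in> GL" and eq: "act g E_plus = E_plus" by (auto simp: stabilizer_def)
  have "g $ i $ j = 0" if "j < i" for i j
  proof -
    have "g *v std j \<in> act g E_plus j"
      by (auto simp: act_def E_plus_def span_flag_def intro!: vec.span_base)
    then have "(g *v std j) $ i = 0"
      unfolding eq using that by (auto simp: E_plus_def span_flag_def span_std)
    then show ?thesis by simp
  qed
  then show "g \<in> Borel" using GL by (auto simp: Borel_iff)
next
  fix g :: "'a cmat" assume "g \<in> Borel"
  then have g: "g \<in> GL" "\<And>i j. j < i \<Longrightarrow> g $ i $ j = 0" by (auto simp: Borel_iff)
  have "act g E_plus = E_plus"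
    by (rule flags_eqI[OF act_E_plus_flags[OF g(1)] E_plus_flags upper_E_plus[OF g(2)]])
  then show "g \<in> stabilizer E_plus" using g by (simp add: stabilizer_def)
qed

lemma stabilizer_mult: "g \<in> stabilizer F \<Longrightarrow> h \<in> stabilizer F \<Longrightarrow> g ** h \<in> stabilizer F"
  by (simp add: stabilizer_def GL_mult act_mult)

lemma stabilizer_inverse:
  assumes "g \<in> stabilizer F"
  obtains h where "h \<in> stabilizer F" "g ** h = mat 1" "h ** g = mat 1"
proof -
  obtain h where h: "h \<in> GL" "g ** h = mat 1" "h ** g = mat 1"
    using GL_inverse assms by (auto simp: stabilizer_def)
  have "act h F = act h (act g F)" using assms by (simp add: stabilizer_def)
  also have "\<dots> = F" by (simp add: act_mult[symmetric] h)
  finally show ?thesis using h that by (simp add: stabilizer_def)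
qed

text \<open>Flags correspond to cosets of the Borel group.\<close>

lemma act_E_plus_eq_iff:
  assumes "g \<in> GL" "h \<in> GL"
  shows "act g E_plus = act h E_plus \<longleftrightarrow> (\<exists>b\<in>Borel. g = h ** b)"
proof
  assume eq: "act g E_plus = act h E_plus"
  obtain k where k: "k \<in> GL" "h ** k = mat 1" "k ** h = mat 1" using GL_inverse[OF assms(2)] .
  have "act (k ** g) E_plus = E_plus" by (simp add: act_mult eq) (simp add: act_mult[symmetric] k)
  then have "k ** g \<in> Borel"
    using GL_mult[OF k(1) assms(1)] unfolding stabilizer_E_plus[symmetric] stabilizer_def by simp
  moreover have "g = h ** (k ** g)" by (simp add: matrix_mul_assoc k)
  ultimately show "\<exists>b\<in>Borel. g = h ** b" by blast
next
  assume "\<exists>b\<in>Borel. g = h ** b"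
  then obtain b where b: "b \<in> Borel" "g = h ** b" by blast
  then have "act b E_plus = E_plus" unfolding stabilizer_E_plus[symmetric] stabilizer_def by simp
  then show "act g E_plus = act h E_plus" by (simp add: b act_mult)
qed

lemma Borel_mult: "a \<in> Borel \<Longrightarrow> b \<in> Borel \<Longrightarrow> a ** b \<in> Borel"
  using stabilizer_mult[of a E_plus b] by (simp add: stabilizer_E_plus)

lemma Borel_act: "b \<in> Borel \<Longrightarrow> act b E_plus = E_plus"
  unfolding stabilizer_E_plus[symmetric] stabilizer_def by simp

lemma inj_decreasing_imp_id:
  fixes p :: "'n::wellorder \<Rightarrow> 'n"
  assumes "inj p" "\<And>j. p j \<le> j"
  shows "p j = j"
proof (induction j rule: less_induct)
  case (less j)
  show ?case
  proof (rule ccontr)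
    assume "p j \<noteq> j"
    then have "p j < j" using assms(2)[of j] by simp
    then have "p (p j) = p j" by (rule less)
    then show False using \<open>inj p\<close> \<open>p j \<noteq> j\<close> by (simp add: inj_eq)
  qed
qed

text \<open>Comparing the entries of the equation in row \<open>w j\<close> and column \<open>j\<close> shows that
\<open>p = inverse of w' after w\<close> satisfies \<open>p j \<le> j\<close> for all \<open>j\<close>.\<close>

lemma bruhat_unique:
  assumes w: "bij w" and w': "bij w'" and b: "b \<in> Borel" and b': "b' \<in> Borel"
    and eq: "b ** perm_mat w = perm_mat w' ** b'"
  shows "w = (w' :: 'n::{finite,wellorder} \<Rightarrow> 'n)"
proof -
  define p where "p = perm_inv w' \<circ> w"
  have "p j \<le> j" for j
  proof -
    have "(b ** perm_mat w *v std j) $ w j = b $ w j $ w j"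
      by (simp only: matrix_vector_mul_assoc[symmetric] perm_mat_std mult_std_nth)
    moreover have "(perm_mat w' ** b' *v std j) $ w j = b' $ p j $ j"
    proof -
      have "(w j = w' i) = (i = p j)" for i
        using bij_inv_eq_iff[OF w', of i "w j"] by (auto simp: p_def bij_is_surj[OF w'] surj_f_inv_f bij_is_inj[OF w'])
      then show ?thesis
        by (simp add: matrix_matrix_mult_def perm_mat_def if_distrib[where f = "\<lambda>x. x * _"] cong: if_cong)
    qed
    ultimately have "b' $ p j $ j \<noteq> 0" using b eq by (auto simp: Borel_def)
    then show ?thesis using b' by (auto simp: Borel_def not_less[symmetric])
  qed
  moreover have "inj p" unfolding p_def using w w' by (simp add: bij_is_inj bij_imp_bij_inv inj_compose)
  ultimately have "p j = j" for j using inj_decreasing_imp_id by blast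
  then have "w' (p j) = w' j" for j by simp
  then show ?thesis using w' by (simp add: p_def fun_eq_iff bij_is_surj surj_f_inv_f)
qed

lemma flags_new_vector:
  assumes F: "F \<in> flags"
  shows "\<exists>x\<in>F j. x \<noteq> 0 \<and> (\<forall>i<j. x \<notin> F i)"
proof (cases "{..<j} = {}")
  case True
  have "vec.dim (F j) \<noteq> 0" using F by (auto simp: flags_def)
  then show ?thesis using True by auto
next
  case False
  define p where "p = Max {..<j}"
  have p: "p < j" "\<And>i. i < j \<Longrightarrow> i \<le> p" unfolding p_def using False Max_in[of "{..<j}"] by auto
  have "card {..p} < card {..j}" using p by (intro psubset_card_mono) auto
  then have "\<not> F j \<subseteq> F p" using F vec.dim_subset[of "F j" "F p"] by (fastforce simp: flags_def)
  then obtain x where x: "x \<in> F j" "x \<notin> F p" by blast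
  moreover have "x \<notin> F i" if "i < j" for i
    using p(2)[OF that] F x(2) by (auto simp: flags_def mono_def)
  moreover have "x \<noteq> 0" using x(2) F by (auto simp: flags_def vec.subspace_0)
  ultimately show ?thesis by blast
qed

text \<open>For each \<open>j\<close> choose a vector of the \<open>j\<close>-th subspace, outside the preceding ones, whose last nonzero
coordinate \<open>w j\<close> is as early as possible. If \<open>w i = w j\<close> with \<open>i < j\<close>, then a multiple of the
\<open>i\<close>-th vector could be subtracted from the \<open>j\<close>-th one to make that coordinate earlier. So \<open>w\<close> is a
permutation, and the chosen vectors, sorted by \<open>w\<close>, are the columns of an upper triangular matrix.\<close>

lemma bruhat_exists:
  assumes F: "F \<in> (flags :: 'n::{finite,wellorder} flag set)"
  obtains b w where "b \<in> Borel" "bij w" "F = act (b ** perm_mat w) E_plus"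
proof -
  define P where "P j k \<longleftrightarrow> (\<exists>x\<in>F j. x \<noteq> 0 \<and> (\<forall>i<j. x \<notin> F i) \<and> (\<forall>l>k. x $ l = 0) \<and> x $ k \<noteq> 0)" for j k
  have lead: "\<exists>k. (\<forall>l>k. x $ l = 0) \<and> x $ k \<noteq> 0" if "x \<noteq> 0" for x :: "'n cvec"
  proof -
    have "{k. x $ k \<noteq> 0} \<noteq> {}" using that by (auto simp: vec_eq_iff)
    then have "x $ Max {k. x $ k \<noteq> 0} \<noteq> 0" using Max_in[of "{k. x $ k \<noteq> 0}"] by simp
    moreover have "x $ l = 0" if "l > Max {k. x $ k \<noteq> 0}" for l
      using that Max_ge[of "{k. x $ k \<noteq> 0}" l] by (auto simp: not_le[symmetric])
    ultimately show ?thesis by blast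
  qed
  have ex: "\<exists>k. P j k" for j
  proof -
    obtain x where x: "x \<in> F j" "x \<noteq> 0" "\<forall>i<j. x \<notin> F i" using flags_new_vector[OF F] by metis
    obtain k where "\<forall>l>k. x $ l = 0" "x $ k \<noteq> 0" using lead[OF x(2)] by blast
    then show ?thesis unfolding P_def using x by (intro exI[of _ k] bexI[of _ x] conjI)
  qed
  define w where "w j = (LEAST k. P j k)" for j
  have "P j (w j)" for j unfolding w_def using LeastI_ex[OF ex] .
  then have "\<forall>j. \<exists>x. x \<in> F j \<and> (\<forall>i<j. x \<notin> F i) \<and> (\<forall>l>w j. x $ l = 0) \<and> x $ w j \<noteq> 0"
    unfolding P_def by blast
  from choice[OF this] obtain x where x: "\<And>j. x j \<in> F j" "\<And>i j. i < j \<Longrightarrow> x j \<notin> F i"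
    "\<And>j l. w j < l \<Longrightarrow> x j $ l = 0" "\<And>j. x j $ w j \<noteq> 0" by blast
  have sub: "\<And>i. vec.subspace (F i)" and mono: "\<And>i j. i \<le> j \<Longrightarrow> F i \<subseteq> F j"
    using F by (auto simp: flags_def mono_def)
  have "w i \<noteq> w j" if ij: "i < j" for i j
  proof
    assume eq: "w i = w j"
    define c where "c = x j $ w j / x i $ w j"
    define y where "y = x j - c *s x i"
    have "x i \<in> F j" using x(1)[of i] mono[OF less_imp_le[OF ij]] by blast
    then have y1: "y \<in> F j" unfolding y_def using x(1)[of j] sub
      by (intro vec.subspace_diff vec.subspace_scale)
    have y2: "y \<notin> F i'" if "i' < j" for i'
    proof
      assume y: "y \<in> F i'"
      have "c *s x i + y \<in> F (max i i')"
        using y x(1)[of i] mono[of i "max i i'"] mono[of i' "max i i'"] sub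
        by (intro vec.subspace_add vec.subspace_scale) (meson max.cobounded1 max.cobounded2 subsetD)+
      then have "x j \<in> F (max i i')" by (simp add: y_def)
      then show False using x(2) ij that by auto
    qed
    have y0: "y \<noteq> 0" using y2[OF ij] vec.subspace_0[OF sub] by auto
    have y3: "y $ l = 0" if "w j \<le> l" for l
      using that x(3)[of j l] x(3)[of i l] x(4)[of i] eq by (cases "l = w j") (auto simp: y_def c_def)
    obtain k where k: "\<forall>l>k. y $ l = 0" "y $ k \<noteq> 0" using lead[OF y0] by blast
    have "P j k" unfolding P_def using y0 y1 y2 k by auto
    moreover have "k < w j" using y3 k(2) not_le by blast
    ultimately show False unfolding w_def using not_less_Least by blast
  qed
  then have "inj w" by (rule linorder_injI)
  then have w: "bij w" by (simp add: bij_def finite_UNIV_inj_surj)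
  define b :: "'n cmat" where "b = (\<chi> r c. x (perm_inv w c) $ r)"
  have winv: "w (perm_inv w c) = c" for c using w by (simp add: bij_is_surj surj_f_inv_f)
  have b: "b \<in> Borel"
  proof -
    have "x (perm_inv w c) $ r = 0" if "c < r" for c r
      by (rule x(3)) (simp only: winv that)
    moreover have "x (perm_inv w c) $ c \<noteq> 0" for c
      using x(4)[of "perm_inv w c"] by (simp only: winv not_False_eq_True)
    ultimately show ?thesis by (simp add: Borel_def b_def)
  qed
  have eq: "act (b ** perm_mat w) E_plus = span_flag x"
  proof -
    have "b *v std (w j) = x j" for j
      using w by (simp add: vec_eq_iff b_def bij_is_inj)
    then show ?thesis by (simp only: act_E_plus matrix_vector_mul_assoc[symmetric] perm_mat_std)
  qed
  have sub: "span_flag x i \<subseteq> F i" for i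
    unfolding span_flag_def
  proof (rule vec.span_minimal[OF image_subsetI sub])
    fix j assume "j \<in> {..i}"
    then show "x j \<in> F i" using x(1)[of j] mono[of j i] by blast
  qed
  have "b \<in> GL" using b by (simp add: Borel_iff)
  then have "act (b ** perm_mat w) E_plus \<in> flags"
    by (intro act_E_plus_flags GL_mult perm_mat_GL w)
  then have "span_flag x = F" unfolding eq by (rule flags_eqI[OF _ F sub])
  then show ?thesis by (intro that[OF b w]) (simp only: eq)
qed

lemma flags_eq_GL_orbit:
  assumes "F \<in> flags" obtains g where "g \<in> GL" "F = act g E_plus"
proof -
  obtain b w where b: "b \<in> Borel" and w: "bij w" and F: "F = act (b ** perm_mat w) E_plus"
    by (rule bruhat_exists[OF assms])
  have "b \<in> GL" using b by (simp only: Borel_iff)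
  from GL_mult[OF this perm_mat_GL[OF w]] show ?thesis by (rule that[OF _ F])
qed


section \<open>Irreducible sets of flags and prime sets of matrices\<close>

lemma topspace_flag_variety: "topspace flag_variety = (flags :: 'n::{finite,wellorder} flag set)"
proof -
    have "openin flag_variety (flags :: 'n flag set)"
    proof -
      have "{g \<in> GL. act g (E_plus :: 'n flag) \<in> flags} = GL" using act_E_plus_flags by auto
      moreover have "openin (subtopology zariski GL) (GL :: 'n cmat set)"
        unfolding openin_subtopology openin_zariski
        by (rule exI[of _ UNIV]) (auto intro!: exI[of _ "{\<lambda>_. 1}"] poly_funs.const)
      ultimately show ?thesis unfolding openin_flag_variety by simp
  qed
    moreover have "topspace flag_variety \<subseteq> (flags :: 'n flag set)"
      using openin_topspace[of "flag_variety :: 'n flag topology"] unfolding openin_flag_variety by blast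
    ultimately show ?thesis using openin_subset by blast
qed
lemma closedin_flag_variety:
  "closedin flag_variety (C :: 'n::{finite,wellorder} flag set) \<longleftrightarrow>
    C \<subseteq> flags \<and> (\<exists>P \<subseteq> poly_funs. \<forall>g\<in>GL. act g E_plus \<in> C \<longleftrightarrow> (\<forall>f\<in>P. f g = 0))"
proof -
  have "openin flag_variety (flags - C) \<longleftrightarrow>
    (\<exists>P \<subseteq> poly_funs. \<forall>g\<in>GL. act g E_plus \<in> C \<longleftrightarrow> (\<forall>f\<in>P. f g = 0))"
  proof -
    have "openin flag_variety (flags - C) \<longleftrightarrow>
        (\<exists>P \<subseteq> poly_funs. {g \<in> GL. act g E_plus \<in> flags - C} = - {A. \<forall>f\<in>P. f A = 0} \<inter> GL)"
      unfolding openin_flag_variety openin_subtopology openin_zariski by auto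
    also have "\<dots> \<longleftrightarrow> (\<exists>P \<subseteq> poly_funs. \<forall>g\<in>GL. act g E_plus \<in> C \<longleftrightarrow> (\<forall>f\<in>P. f g = 0))"
    proof -
      have "{g \<in> GL. act g E_plus \<in> flags - C} = - {A. \<forall>f\<in>P. f A = 0} \<inter> GL \<longleftrightarrow>
         (\<forall>g\<in>GL. act g E_plus \<in> C \<longleftrightarrow> (\<forall>f\<in>P. f g = 0))"
        for P :: "('n cmat \<Rightarrow> complex) set"
        using act_E_plus_flags by (auto simp: set_eq_iff)
      then show ?thesis by (simp only:)
    qed
    finally show ?thesis .
  qed
  then show ?thesis unfolding closedin_def topspace_flag_variety by blast
qed

lemma closed_flags_polynomials:
  fixes C :: "'a::{finite,wellorder} flag set"
  assumes "closedin flag_variety C"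
  obtains P where "P \<subseteq> poly_funs" "\<forall>g\<in>GL. act g E_plus \<in> C \<longleftrightarrow> (\<forall>f\<in>P. f g = 0)"
  using assms unfolding closedin_flag_variety by blast

lemma irreducible_in_flag_variety:
  fixes X :: "'a::{finite,wellorder} cmat set"
  assumes "prime_on X" "X \<subseteq> GL" "X \<noteq> {}"
  shows "irreducible_in flag_variety ((\<lambda>g. act g E_plus) ` X)"
  unfolding irreducible_in_def
proof (intro conjI allI impI)
  show "(\<lambda>g. act g E_plus) ` X \<noteq> {}" using assms by simp
  show "(\<lambda>g. act g E_plus) ` X \<subseteq> topspace flag_variety"
    using assms(2) act_E_plus_flags unfolding topspace_flag_variety by blast
  fix A B :: "'a flag set"
  assume A: "closedin flag_variety A" and B: "closedin flag_variety B"
    and AB: "(\<lambda>g. act g E_plus) ` X \<subseteq> A \<union> B"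
  obtain P :: "('a cmat \<Rightarrow> complex) set" where P: "P \<subseteq> poly_funs" "\<forall>g\<in>GL. act g E_plus \<in> A \<longleftrightarrow> (\<forall>f\<in>P. f g = 0)"
    by (rule closed_flags_polynomials[OF A])
  obtain R :: "('a cmat \<Rightarrow> complex) set" where R: "R \<subseteq> poly_funs" "\<forall>g\<in>GL. act g E_plus \<in> B \<longleftrightarrow> (\<forall>f\<in>R. f g = 0)"
    by (rule closed_flags_polynomials[OF B])
  show "(\<lambda>g. act g E_plus) ` X \<subseteq> A \<or> (\<lambda>g. act g E_plus) ` X \<subseteq> B"
  proof (rule ccontr)
    assume "\<not> ?thesis"
    then obtain g h where gh: "g \<in> X" "act g E_plus \<notin> A" "h \<in> X" "act h E_plus \<notin> B" by blast
    have GL: "x \<in> GL" if "x \<in> X" for x using that assms(2) by blast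
    obtain f where f: "f \<in> P" "f g \<noteq> 0" using bspec[OF P(2) GL[OF gh(1)]] gh(2) by blast
    obtain f' where f': "f' \<in> R" "f' h \<noteq> 0" using bspec[OF R(2) GL[OF gh(3)]] gh(4) by blast
    have "f x * f' x = 0" if "x \<in> X" for x
    proof -
      have "act x E_plus \<in> A \<or> act x E_plus \<in> B" using AB that by blast
      then show ?thesis using bspec[OF P(2) GL[OF that]] bspec[OF R(2) GL[OF that]] f(1) f'(1) by auto
    qed
    then have "(\<forall>x\<in>X. f x = 0) \<or> (\<forall>x\<in>X. f' x = 0)"
      using f(1) f'(1) P(1) R(1) by (intro prime_onD[OF assms(1)]) auto
    then show False using f f' gh by auto
  qed
qed

lemma Borel_line_closed: "line_closed {g :: 'n::{finite,wellorder} cmat. \<forall>i j. j < i \<longrightarrow> g $ i $ j = 0}"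
  by (simp add: line_closed_def line_def)

lemma Borel_eq: "Borel = {g :: 'n::{finite,wellorder} cmat. \<forall>i j. j < i \<longrightarrow> g $ i $ j = 0} \<inter> GL"
  by (auto simp: Borel_iff)

text \<open>The set \<open>V f\<close> of those flags whose whole \<open>Borel\<close>-coset is annihilated by \<open>f\<close> is closed. As every
coset is itself prime, a product that vanishes on the preimage of \<open>Z\<close> splits over the cosets, so
that \<open>Z\<close> is covered by two such closed sets, and irreducibility of \<open>Z\<close> applies.\<close>

lemma prime_on_preimage:
  fixes Z Q :: "'n::{finite,wellorder} flag set"
  assumes irr: "irreducible_in (subtopology flag_variety Q) Z"
  shows "prime_on {g \<in> GL. act g E_plus \<in> Z}"
  unfolding prime_on_def
proof (intro ballI impI)
  fix f g :: "'n cmat \<Rightarrow> complex"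
  assume f: "f \<in> poly_funs" and g: "g \<in> poly_funs" and z: "\<forall>x\<in>{g \<in> GL. act g E_plus \<in> Z}. f x * g x = 0"
  define V where "V f = {F \<in> flags. \<forall>x\<in>GL. act x E_plus = F \<longrightarrow> f x = 0}" for f :: "'n cmat \<Rightarrow> complex"
  have V: "act x E_plus \<in> V f \<longleftrightarrow> (\<forall>b\<in>Borel. f (x ** b) = 0)" if "x \<in> GL" for x f
  proof
    assume "act x E_plus \<in> V f"
    then show "\<forall>b\<in>Borel. f (x ** b) = 0"
      using that GL_mult[OF that] by (auto simp: V_def Borel_iff act_mult Borel_act)
  next
    assume "\<forall>b\<in>Borel. f (x ** b) = 0"
    then show "act x E_plus \<in> V f"
      using that act_E_plus_flags[OF that] act_E_plus_eq_iff[OF _ that] by (auto simp: V_def)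
  qed
  have closed: "closedin flag_variety (V f)" if "f \<in> poly_funs" for f
    unfolding closedin_flag_variety
  proof (intro conjI exI[of _ "(\<lambda>b x. f (x ** b)) ` Borel"] ballI)
    show "V f \<subseteq> flags" by (auto simp: V_def)
    show "(\<lambda>b x. f (x ** b)) ` Borel \<subseteq> poly_funs" using poly_funs_mult_right[OF that] by blast
  qed (simp add: V)
  have ZQ: "Z \<subseteq> Q" and Zf: "Z \<subseteq> flags"
  proof -
    have "Z \<subseteq> topspace (subtopology flag_variety Q)" using irr by (simp add: irreducible_in_def)
    then show "Z \<subseteq> Q" by auto
    show "Z \<subseteq> flags" using \<open>Z \<subseteq> topspace _\<close> by (auto simp: topspace_flag_variety)
  qed
  have "Z \<subseteq> V f \<union> V g"
  proof
    fix F assume F: "F \<in> Z"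
    then have "F \<in> flags" using Zf by blast
    then obtain x where x: "x \<in> GL" "F = act x E_plus" by (rule flags_eq_GL_orbit)
    have "f (x ** b) * g (x ** b) = 0" if "b \<in> Borel" for b
    proof -
      have "act (x ** b) E_plus = F" using that by (simp add: act_mult x Borel_act)
      moreover have "x ** b \<in> GL" using that x GL_mult by (auto simp: Borel_iff)
      ultimately show ?thesis using z F by auto
    qed
    then have "(\<forall>b\<in>Borel. f (x ** b) = 0) \<or> (\<forall>b\<in>Borel. g (x ** b) = 0)"
      by (intro prime_onD[OF prime_on_line_closed[OF Borel_line_closed, folded Borel_eq]]
          poly_funs_mult_left f g)
    then show "F \<in> V f \<union> V g" using V x by auto
  qed
  then have "Z \<subseteq> (V f \<inter> Q) \<union> (V g \<inter> Q)" using ZQ by blast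
  moreover have "closedin (subtopology flag_variety Q) (V f \<inter> Q)" "closedin (subtopology flag_variety Q) (V g \<inter> Q)"
    using closed f g closedin_subtopology by blast+
  ultimately have "Z \<subseteq> V f \<or> Z \<subseteq> V g" using irr unfolding irreducible_in_def by blast
  then show "(\<forall>x\<in>{g \<in> GL. act g E_plus \<in> Z}. f x = 0) \<or> (\<forall>x\<in>{g \<in> GL. act g E_plus \<in> Z}. g x = 0)"
    unfolding V_def by blast
qed


section \<open>Length and inversions\<close>

abbreviation swap :: "'a \<Rightarrow> 'a \<Rightarrow> 'a \<Rightarrow> 'a" where
  "swap \<equiv> Transposition.transpose"

text \<open>Applied below to the inverse of a permutation. So multiplying the permutation from the left by an
adjacent transposition composes the argument with it from the right.\<close>

definition inversions :: "('n::linorder \<Rightarrow> 'n) \<Rightarrow> ('n \<times> 'n) set" where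
  "inversions p = {(i, j). i < j \<and> p j < p i}"

lemma swap_adjacent_mono:
  assumes "adjacent i j" "a < b" "(a, b) \<noteq> (i, j)"
  shows "swap i j a < swap i j b"
proof -
  have ij: "i < j" "\<And>k. i < k \<Longrightarrow> j \<le> k" "\<And>k. k < j \<Longrightarrow> k \<le> i"
    using assms(1) by (auto simp: adjacent_def not_less[symmetric])
  consider "a = i" | "a = j" | "b = i" "a \<noteq> j" "a \<noteq> i" | "b = j" "a \<noteq> i" "a \<noteq> j"
    | "a \<noteq> i" "a \<noteq> j" "b \<noteq> i" "b \<noteq> j" by blast
  then show ?thesis
  proof cases
    case 1
    then have "j \<le> b" "b \<noteq> j" "b \<noteq> i" using ij(2)[of b] assms(2,3) by auto
    then show ?thesis using 1 by auto
  next
    case 2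
    then have "b \<noteq> i" "b \<noteq> j" "i < b" using ij assms(2) by auto
    then show ?thesis using 2 by auto
  next
    case 3
    then show ?thesis using ij assms(2) by auto
  next
    case 4
    then have "a \<le> i" using ij(3)[of a] assms(2) by auto
    then show ?thesis using 4 by auto
  next
    case 5
    then show ?thesis using assms(2) by auto
  qed
qed

text \<open>An adjacent transposition changes the relative order of one pair only.\<close>

lemma inversions_swap:
  assumes "adjacent i j" "p i < p j"
  shows "inversions (p \<circ> swap i j) = insert (i, j) (map_prod (swap i j) (swap i j) ` inversions p)"
    (is "?L = insert _ (?f ` _)")
proof
  show "?L \<subseteq> insert (i, j) (?f ` inversions p)"
  proof
    fix x assume "x \<in> ?L"
    then obtain a b where x: "x = (a, b)" "a < b" "p (swap i j b) < p (swap i j a)"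
      by (auto simp: inversions_def)
    show "x \<in> insert (i, j) (?f ` inversions p)"
    proof (cases "(a, b) = (i, j)")
      case False
      then have "(swap i j a, swap i j b) \<in> inversions p"
        using swap_adjacent_mono[OF assms(1) x(2)] x by (simp add: inversions_def)
      moreover have "?f (swap i j a, swap i j b) = x" using x by simp
      ultimately show ?thesis by force
    qed (simp add: x)
  qed
  show "insert (i, j) (?f ` inversions p) \<subseteq> ?L"
  proof -
    have "(i, j) \<in> ?L" using assms by (simp add: inversions_def adjacent_def)
    moreover have "?f (a, b) \<in> ?L" if ab: "(a, b) \<in> inversions p" for a b
    proof -
      have "(a, b) \<noteq> (i, j)" using assms ab by (auto simp: inversions_def)
      then show ?thesis
        using ab swap_adjacent_mono[OF assms(1), of a b] by (simp add: inversions_def)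
    qed
    ultimately show ?thesis by force
  qed
qed

lemma card_inversions_swap:
  fixes p :: "'n::{finite,wellorder} \<Rightarrow> 'n"
  assumes "adjacent i j" "p i < p j"
  shows "card (inversions (p \<circ> swap i j)) = Suc (card (inversions p))"
proof -
  have "inj (map_prod (swap i j) (swap i j))" by (intro prod.inj_map) auto
  then have "card (map_prod (swap i j) (swap i j) ` inversions p) = card (inversions p)"
    by (intro card_image) (auto intro: inj_on_subset)
  moreover have "(i, j) \<notin> map_prod (swap i j) (swap i j) ` inversions p"
  proof
    assume "(i, j) \<in> map_prod (swap i j) (swap i j) ` inversions p"
    then obtain a b where ab: "i = swap i j a" "j = swap i j b" "a < b" by (auto simp: inversions_def)
    then have "a = j" "b = i" by (metis transpose_apply_first transpose_apply_second transpose_involutory)+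
    then show False using ab assms(1) by (auto simp: adjacent_def)
  qed
  ultimately show ?thesis by (simp add: inversions_swap[OF assms])
qed

lemma perm_inv_swap_comp: "bij w \<Longrightarrow> perm_inv (swap i j \<circ> w) = perm_inv w \<circ> swap i j"
  using o_inv_distrib[of "swap i j" w] by (simp add: inv_transpose_eq)

lemma adjacent_pred:
  fixes i j :: "'n::{finite,wellorder}"
  assumes "i < j"
  shows "adjacent (Max {..<j}) j" "i \<le> Max {..<j}"
proof -
  have "Max {..<j} \<in> {..<j}" using assms by (intro Max_in) auto
  moreover have m: "k \<le> Max {..<j}" if "k < j" for k using that by (intro Max_ge) auto
  ultimately show "adjacent (Max {..<j}) j"
    unfolding adjacent_def by (auto simp: not_less[symmetric])
  show "i \<le> Max {..<j}" by (rule m[OF assms])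
qed

lemma adjacent_descent:
  fixes p :: "'n::{finite,wellorder} \<Rightarrow> 'n"
  assumes "inversions p \<noteq> {}" "inj p"
  obtains i j where "adjacent i j" "p j < p i"
proof -
  define P where "P j \<longleftrightarrow> (\<exists>i<j. p j < p i)" for j
  have "\<exists>j. P j" using assms(1) by (auto simp: inversions_def P_def)
  then obtain j where j: "P j" "\<And>k. k < j \<Longrightarrow> \<not> P k" by (metis LeastI not_less_Least)
  then obtain i where i: "i < j" "p j < p i" by (auto simp: P_def)
  define m where "m = Max {..<j}"
  have m: "adjacent m j" "i \<le> m" using adjacent_pred[OF i(1)] by (simp_all add: m_def)
  have "p j < p m"
  proof (cases "i = m")
    case False
    then have "i < m" "m < j" using m by (auto simp: adjacent_def)
    then have "p i \<le> p m" using j(2)[of m] not_less unfolding P_def by blast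
    then show ?thesis using i by simp
  qed (use i in simp)
  then show ?thesis using that m by blast
qed

text \<open>A strictly increasing self-map \<open>p\<close> of a well-order satisfies \<open>j \<le> p j\<close>, whence its inverse
satisfies the opposite inequality.\<close>

lemma no_inversions_imp_id:
  fixes w :: "'n::{finite,wellorder} \<Rightarrow> 'n"
  assumes w: "bij w" and "inversions (perm_inv w) = {}"
  shows "w = id"
proof -
  let ?p = "perm_inv w"
  have inj: "inj ?p" by (simp add: bij_imp_bij_inv bij_is_inj w)
  have mono: "?p i < ?p j" if "i < j" for i j
  proof -
    have "\<not> ?p j < ?p i" using assms(2) that by (auto simp: inversions_def)
    moreover have "?p i \<noteq> ?p j" using inj that by (auto dest: injD)
    ultimately show ?thesis by simp
  qed
  have ge: "j \<le> ?p j" for j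
  proof (induction j rule: less_induct)
    case (less j)
    show ?case
    proof (rule ccontr)
      assume "\<not> j \<le> ?p j"
      then have "?p j < j" by simp
      then show False using less[of "?p j"] mono[of "?p j" j] by simp
    qed
  qed
  have "w j \<le> j" for j using ge[of "w j"] w by (simp add: bij_is_inj)
  then show ?thesis using inj_decreasing_imp_id[of w] w by (auto simp: bij_is_inj)
qed

lemma inversions_id: "inversions (\<lambda>x :: 'n::linorder. x) = {}"
  by (auto simp: inversions_def)

lemma foldr_bij_inversions:
  fixes ts :: "('n::{finite,wellorder} \<Rightarrow> 'n) list"
  assumes "set ts \<subseteq> S"
  shows "bij (foldr (\<circ>) ts id) \<and> card (inversions (perm_inv (foldr (\<circ>) ts id))) \<le> length ts"
  using assms
proof (induction ts)
  case Nil
  then show ?case by (simp add: inversions_id id_def bij_id[unfolded id_def])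
next
  case (Cons t ts)
  obtain i j where t: "t = swap i j" "adjacent i j" using Cons.prems by (auto simp: S_def)
  let ?w = "foldr (\<circ>) ts id"
  have "set ts \<subseteq> S" using Cons.prems by simp
  from Cons.IH[OF this] have w: "bij ?w" "card (inversions (perm_inv ?w)) \<le> length ts" by blast+
  have "bij (t \<circ> ?w)" unfolding t using w(1) by (simp add: bij_comp)
  moreover have "card (inversions (perm_inv ?w \<circ> swap i j)) \<le> Suc (card (inversions (perm_inv ?w)))"
  proof (cases "perm_inv ?w i < perm_inv ?w j")
    case True
    then show ?thesis using card_inversions_swap[OF t(2)] by simp
  next
    case False
    moreover have "inj (perm_inv ?w)" using w(1) by (simp add: bij_imp_bij_inv bij_is_inj)
    then have "perm_inv ?w i \<noteq> perm_inv ?w j" using t(2) by (auto simp: adjacent_def dest: injD)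
    ultimately have "(perm_inv ?w \<circ> swap i j) i < (perm_inv ?w \<circ> swap i j) j" by simp
    from card_inversions_swap[OF t(2) this] show ?thesis
      unfolding comp_assoc transpose_comp_involutory comp_id by linarith
  qed
  moreover have "foldr (\<circ>) (t # ts) id = t \<circ> ?w" by simp
  ultimately show ?case
    using w(2) perm_inv_swap_comp[OF w(1), of i j] unfolding t by (simp only: length_Cons simp_thms)
qed

lemma reduced_word_exists:
  fixes w :: "'n::{finite,wellorder} \<Rightarrow> 'n"
  assumes "bij w"
  shows "\<exists>ts. length ts = card (inversions (perm_inv w)) \<and> set ts \<subseteq> S \<and> foldr (\<circ>) ts id = w"
  using assms
proof (induction "card (inversions (perm_inv w))" arbitrary: w)
  case 0
  then have "w = id" using no_inversions_imp_id[of w] by simp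
  then show ?case by (intro exI[of _ "[]"]) (simp add: inversions_id id_def)
next
  case (Suc n)
  have inj: "inj (perm_inv w)" using Suc.prems by (simp add: bij_imp_bij_inv bij_is_inj)
  have "inversions (perm_inv w) \<noteq> {}" using Suc.hyps(2) by auto
  then obtain i j where ij: "adjacent i j" "perm_inv w j < perm_inv w i"
    using adjacent_descent inj by metis
  let ?w = "swap i j \<circ> w"
  have w: "bij ?w" using Suc.prems by (simp add: bij_comp)
  have pw: "perm_inv ?w = perm_inv w \<circ> swap i j" by (rule perm_inv_swap_comp[OF Suc.prems])
  have "perm_inv ?w i < perm_inv ?w j" unfolding pw using ij by simp
  from card_inversions_swap[OF ij(1) this] have c: "card (inversions (perm_inv w)) = Suc (card (inversions (perm_inv ?w)))"
    unfolding pw comp_assoc transpose_comp_involutory comp_id .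
  then obtain ts where ts: "length ts = n" "set ts \<subseteq> S" "foldr (\<circ>) ts id = ?w"
    using Suc.hyps(1)[OF _ w] Suc.hyps(2) by auto
  have "swap i j \<in> S" using ij by (auto simp: S_def)
  moreover have "foldr (\<circ>) (swap i j # ts) id = w" using ts(3) by (simp add: comp_assoc[symmetric])
  ultimately show ?case using ts Suc.hyps(2) by (intro exI[of _ "swap i j # ts"]) simp
qed

lemma word_length_eq_inversions:
  fixes w :: "'n::{finite,wellorder} \<Rightarrow> 'n"
  assumes "bij w"
  shows "word_length S w = card (inversions (perm_inv w))"
  unfolding word_length_def
proof (rule Least_equality)
  fix k assume "\<exists>ts. length ts = k \<and> set ts \<subseteq> S \<and> foldr (\<circ>) ts id = w"
  then obtain ts where "length ts = k" "set ts \<subseteq> S" "foldr (\<circ>) ts id = w" by blast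
  then show "card (inversions (perm_inv w)) \<le> k" using foldr_bij_inversions[of ts] by simp
qed (rule reduced_word_exists[OF assms])

lemma word_length_conjugate:
  assumes p: "bij p"
  shows "word_length ((\<lambda>t. p \<circ> t \<circ> perm_inv p) ` T) w = word_length T (perm_inv p \<circ> w \<circ> p)"
proof -
  let ?c = "\<lambda>t. p \<circ> t \<circ> perm_inv p"
  have canc: "p (perm_inv p x) = x" "perm_inv p (p x) = x" for x
    using p by (simp_all add: bij_is_surj surj_f_inv_f bij_is_inj)
  have fold: "foldr (\<circ>) (map ?c ts) id = ?c (foldr (\<circ>) ts id)" for ts
    by (induction ts) (simp_all add: fun_eq_iff canc)
  have eq: "?c v = w \<longleftrightarrow> v = perm_inv p \<circ> w \<circ> p" for v
    by (auto simp: fun_eq_iff canc) (metis canc)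
  have "(\<exists>ts. length ts = k \<and> set ts \<subseteq> ?c ` T \<and> foldr (\<circ>) ts id = w) \<longleftrightarrow>
      (\<exists>ts. length ts = k \<and> set ts \<subseteq> T \<and> foldr (\<circ>) ts id = perm_inv p \<circ> w \<circ> p)" for k
  proof
    assume "\<exists>ts. length ts = k \<and> set ts \<subseteq> ?c ` T \<and> foldr (\<circ>) ts id = w"
    then obtain ts where ts: "length ts = k" "ts \<in> lists (?c ` T)" "foldr (\<circ>) ts id = w"
      by (auto simp: in_lists_conv_set)
    then obtain us where us: "us \<in> lists T" "ts = map ?c us" by (auto simp: lists_image)
    have "foldr (\<circ>) us id = perm_inv p \<circ> w \<circ> p" using ts(3) unfolding us fold eq .
    then show "\<exists>ts. length ts = k \<and> set ts \<subseteq> T \<and> foldr (\<circ>) ts id = perm_inv p \<circ> w \<circ> p"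
      using us ts(1) by (intro exI[of _ us]) auto
  next
    assume "\<exists>ts. length ts = k \<and> set ts \<subseteq> T \<and> foldr (\<circ>) ts id = perm_inv p \<circ> w \<circ> p"
    then obtain ts where ts: "length ts = k" "set ts \<subseteq> T" "foldr (\<circ>) ts id = perm_inv p \<circ> w \<circ> p" by blast
    have "foldr (\<circ>) (map ?c ts) id = w" unfolding fold eq by (rule ts)
    then show "\<exists>ts. length ts = k \<and> set ts \<subseteq> ?c ` T \<and> foldr (\<circ>) ts id = w"
      using ts by (intro exI[of _ "map ?c ts"]) auto
  qed
  then show ?thesis unfolding word_length_def by (simp only:)
qed

lemma sigma_Min: "sigma (Min UNIV) = Max UNIV"
  by (simp add: sigma_def)

lemma sigma_pred: "i \<noteq> Min UNIV \<Longrightarrow> adjacent (sigma i) (i :: 'n::{finite,wellorder})"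
proof -
  assume i: "i \<noteq> Min UNIV"
  then have "Min UNIV < i" using Min_le[of UNIV i] by (simp add: order_less_le)
  then show ?thesis using i adjacent_pred(1) by (simp add: sigma_def)
qed

text \<open>The order \<open>n, 1, ..., n - 1\<close> in which \<open>sigma\<close> lists the indices.\<close>

definition before :: "'n::{finite,linorder} \<Rightarrow> 'n \<Rightarrow> bool" where
  "before x y \<longleftrightarrow> y \<noteq> Max UNIV \<and> (x = Max UNIV \<or> x < y)"

lemma sigma_before:
  fixes i j :: "'n::{finite,wellorder}"
  assumes "i < j" shows "before (sigma i) (sigma j)"
proof -
  have "Min UNIV \<le> i" by simp
  then have j: "j \<noteq> Min UNIV" using assms by auto
  have "sigma j < j" using sigma_pred[OF j] by (simp add: adjacent_def)
  moreover have "j \<le> Max UNIV" by simp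
  ultimately have jM: "sigma j \<noteq> Max UNIV" by auto
  show ?thesis
  proof (cases "i = Min UNIV")
    case True
    then show ?thesis using jM by (simp add: before_def sigma_Min)
  next
    case False
    have "sigma i < i" using sigma_pred[OF False] by (simp add: adjacent_def)
    moreover have "i \<le> sigma j" using sigma_pred[OF j] assms by (auto simp: adjacent_def not_less[symmetric])
    ultimately have "sigma i < sigma j" by (rule less_le_trans)
    then show ?thesis using jM by (simp add: before_def)
  qed
qed

lemma bij_sigma: "bij (sigma :: 'n::{finite,wellorder} \<Rightarrow> 'n)"
proof -
  have "inj (sigma :: 'n \<Rightarrow> 'n)"
    by (rule linorder_injI) (use sigma_before in \<open>fastforce simp: before_def\<close>)
  then show ?thesis by (simp add: bij_def finite_UNIV_inj_surj)
qed

lemma sigma_before_iff: "before (sigma i) (sigma j) \<longleftrightarrow> i < (j :: 'n::{finite,wellorder})"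
proof
  assume b: "before (sigma i) (sigma j)"
  show "i < j"
  proof (rule ccontr)
    assume "\<not> i < j"
    then consider "i = j" | "j < i" by fastforce
    then show False using b sigma_before[of j i] by cases (auto simp: before_def)
  qed
qed (rule sigma_before)

lemma conjugate_swap: "bij p \<Longrightarrow> p \<circ> swap i j \<circ> perm_inv p = swap (p i) (p j)"
proof
  fix x assume p: "bij p"
  define y where "y = perm_inv p x"
  have x: "x = p y" using p by (simp add: y_def bij_is_surj surj_f_inv_f)
  show "(p \<circ> swap i j \<circ> perm_inv p) x = swap (p i) (p j) x"
    unfolding x using p by (simp add: bij_is_inj Transposition.transpose_def inj_eq)
qed

text \<open>Conjugation by \<open>sigma\<close> turns the reflections of neighbours in the usual order into those of
neighbours in the order \<open>before\<close>.\<close>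

lemma S_star_eq_conjugate:
  assumes "CARD('n) \<ge> 2"
  shows "(S_star :: ('n::{finite,wellorder} \<Rightarrow> 'n) set) = (\<lambda>t. sigma \<circ> t \<circ> perm_inv sigma) ` S"
proof -
  have img: "(\<lambda>t. sigma \<circ> t \<circ> perm_inv sigma) ` S = {swap (sigma i) (sigma j) |i j :: 'n. adjacent i j}"
    unfolding S_def conjugate_swap[OF bij_sigma, symmetric] by blast
  have pred_eq: "sigma j = i" if "adjacent i j" for i j :: 'n
  proof -
    have "i < j" using that by (simp add: adjacent_def)
    moreover have "Min UNIV \<le> i" by simp
    ultimately have "j \<noteq> Min UNIV" by auto
    from sigma_pred[OF this] that show ?thesis unfolding adjacent_def by (metis linorder_neqE)
  qed
  show ?thesis
    unfolding img S_star_def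
  proof (intro equalityI subsetI)
    fix t :: "'n \<Rightarrow> 'n"
    assume "t \<in> insert (swap (Min UNIV) (Max UNIV)) {swap i j |i j. adjacent i j \<and> j \<noteq> Max UNIV}"
    then consider "t = swap (Min UNIV) (Max UNIV)" | i j where "t = swap i j" "adjacent i j" "j \<noteq> Max UNIV"
      by blast
    then show "t \<in> {swap (sigma i) (sigma j) |i j. adjacent i j}"
    proof cases
      case 1
      have "UNIV - {Min UNIV :: 'n} \<noteq> {}"
      proof
        assume "UNIV - {Min UNIV :: 'n} = {}"
        then have "(UNIV :: 'n set) \<subseteq> {Min UNIV}" by blast
        then have "CARD('n) \<le> card {Min UNIV :: 'n}" by (intro card_mono) auto
        then show False using assms by simp
      qed
      define j where "j = Min (UNIV - {Min UNIV :: 'n})"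
      have j: "j \<noteq> Min UNIV" unfolding j_def using Min_in[of "UNIV - {Min UNIV :: 'n}"] \<open>_ \<noteq> {}\<close> by auto
      have "adjacent (Min UNIV) j"
      proof -
        have "Min UNIV < j" using j Min_le[of UNIV j] by (simp add: order_less_le)
        moreover have "j \<le> k" if "Min UNIV < k" for k
          unfolding j_def using that by (intro Min_le) auto
        ultimately show ?thesis unfolding adjacent_def by (auto dest: leD)
      qed
      moreover have "t = swap (sigma (Min UNIV)) (sigma j)"
        unfolding 1 pred_eq[OF calculation] sigma_Min by (rule transpose_commute)
      ultimately show ?thesis by blast
    next
      case 2
      define k where "k = perm_inv sigma j"
      have k: "sigma k = j" by (simp add: k_def bij_is_surj[OF bij_sigma] surj_f_inv_f)
      have "k \<noteq> Min UNIV" using k 2(3) sigma_Min by metis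
      from sigma_pred[OF this] have "adjacent j k" by (simp add: k)
      then show ?thesis using 2 k pred_eq[of i j] by blast
    qed
  next
    fix t :: "'n \<Rightarrow> 'n"
    assume "t \<in> {swap (sigma i) (sigma j) |i j. adjacent i j}"
    then obtain i j where t: "t = swap (sigma i) (sigma j)" "adjacent i j" by blast
    show "t \<in> insert (swap (Min UNIV) (Max UNIV)) {swap i j |i j. adjacent i j \<and> j \<noteq> Max UNIV}"
    proof (cases "i = Min UNIV")
      case True
      then show ?thesis using t pred_eq[OF t(2)] by (simp add: sigma_Min transpose_commute)
    next
      case False
      have "adjacent (sigma i) i" by (rule sigma_pred[OF False])
      moreover have "i \<noteq> Max UNIV"
      proof -
        have "i < j" using t(2) by (simp add: adjacent_def)
        moreover have "j \<le> Max UNIV" by simp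
        ultimately show ?thesis by auto
      qed
      ultimately show ?thesis unfolding t(1) pred_eq[OF t(2)] by blast
    qed
  qed
qed

lemma word_length_S_star:
  fixes u :: "'n::{finite,wellorder} \<Rightarrow> 'n"
  assumes "CARD('n) \<ge> 2" "bij u"
  shows "word_length S_star u = card (inversions (perm_inv (perm_inv sigma \<circ> u \<circ> sigma)))"
  unfolding S_star_eq_conjugate[OF assms(1)] word_length_conjugate[OF bij_sigma]
  by (intro word_length_eq_inversions bij_comp assms(2) bij_sigma bij_imp_bij_inv)


section \<open>The discrete data of an orbit\<close>

text \<open>Encodes an orbit by its normal form: the flag \<open>w E_plus\<close> and the line spanned by the sum of the \<open>e_i\<close> with
\<open>i \<in> \<Delta>\<close>. The last assumption says that no two elements of \<open>\<Delta>\<close> are comparable for the partial order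
in which \<open>i\<close> precedes \<open>j\<close> if \<open>i \<le> j\<close> and \<open>pos i \<le> pos j\<close>.\<close>

locale orbit_data =
  fixes w :: "'n::{finite,wellorder} \<Rightarrow> 'n" and \<Delta> :: "'n set"
  assumes bij_w: "bij w" and Max_in_\<Delta>: "Max UNIV \<in> \<Delta>"
    and antichain: "i \<in> \<Delta> \<Longrightarrow> j \<in> \<Delta> \<Longrightarrow> i < j \<Longrightarrow> perm_inv w j < perm_inv w i"
begin

abbreviation pos :: "'n \<Rightarrow> 'n" where "pos \<equiv> perm_inv w"

lemma pos_w [simp]: "pos (w i) = i" "w (pos i) = i"
  using bij_w by (simp_all add: bij_is_inj bij_is_surj surj_f_inv_f)

lemma inj_pos: "pos i = pos j \<longleftrightarrow> i = j" by (metis pos_w(2))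

lemma Max_ge_UNIV [simp]: "i \<le> Max (UNIV :: 'n set)" by simp

text \<open>The least element of \<open>\<Delta>\<close> above \<open>i\<close>. As \<open>n \<in> \<Delta>\<close>, it is defined unless \<open>i = n\<close>; the value at \<open>n\<close> is
arbitrary.\<close>

definition nxt :: "'n \<Rightarrow> 'n" where
  "nxt i = Min {j \<in> \<Delta>. i < j}"

lemma nxt:
  assumes "i \<noteq> Max UNIV"
  shows "nxt i \<in> \<Delta>" "i < nxt i" "j \<in> \<Delta> \<Longrightarrow> i < j \<Longrightarrow> nxt i \<le> j"
proof -
  have "i < Max UNIV" using assms by (simp add: order_less_le)
  then have "{j \<in> \<Delta>. i < j} \<noteq> {}" using Max_in_\<Delta> by blast
  from Min_in[OF _ this] show "nxt i \<in> \<Delta>" "i < nxt i" by (simp_all add: nxt_def)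
  show "nxt i \<le> j" if "j \<in> \<Delta>" "i < j" unfolding nxt_def using that by (intro Min_le) auto
qed

lemma less_nxt_iff:
  assumes "i \<noteq> Max UNIV" "j \<in> \<Delta>"
  shows "j < nxt i \<longleftrightarrow> j \<le> i"
proof
  assume "j < nxt i"
  then show "j \<le> i" using nxt(3)[OF assms] by (meson leD leI)
next
  assume "j \<le> i"
  also have "i < nxt i" by (rule nxt(2)[OF assms(1)])
  finally show "j < nxt i" .
qed

definition cone :: "'n set" where
  "cone = {i. \<exists>j\<in>\<Delta>. i \<le> j \<and> pos i \<le> pos j}"

lemma \<Delta>_cone: "\<Delta> \<subseteq> cone" by (auto simp: cone_def)

lemma not_\<Delta>_not_Max: "i \<notin> \<Delta> \<Longrightarrow> i \<noteq> Max UNIV" using Max_in_\<Delta> by auto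

text \<open>Since \<open>pos\<close> decreases on \<open>\<Delta>\<close>, among the elements of \<open>\<Delta>\<close> above \<open>i\<close> the next one has the largest
position.\<close>

lemma in_cone_iff_nxt:
  assumes "i \<notin> \<Delta>" shows "i \<in> cone \<longleftrightarrow> pos i < pos (nxt i)"
proof
  have i: "i \<noteq> Max UNIV" by (rule not_\<Delta>_not_Max[OF assms])
  {
    assume "i \<in> cone"
    then obtain j where j: "j \<in> \<Delta>" "i \<le> j" "pos i \<le> pos j" by (auto simp: cone_def)
    then have "i \<noteq> j" using assms by blast
    then have "i < j" "pos i < pos j" using j inj_pos[of i j] by (simp_all add: order_less_le)
    moreover have "pos j \<le> pos (nxt i)"
      using nxt(3)[OF i j(1) \<open>i < j\<close>] antichain[OF nxt(1)[OF i] j(1)]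
      by (cases "nxt i = j") (auto simp: order_less_le)
    ultimately show "pos i < pos (nxt i)" by simp
  next
    assume "pos i < pos (nxt i)"
    then show "i \<in> cone" unfolding cone_def using nxt(1,2)[OF i] by (auto intro!: bexI[of _ "nxt i"])
  }
qed

text \<open>This cyclic shift of \<open>\<Delta>\<close> turns out to be the inverse of \<open>u sigma w^-1\<close>, where \<open>(w, u)\<close> is the shape of
the orbit.\<close>

definition rho :: "'n \<Rightarrow> 'n" where
  "rho x = (if x \<in> \<Delta> then if x = Max UNIV then Min \<Delta> else nxt x else x)"

lemma Min_\<Delta>: "Min \<Delta> \<in> \<Delta>" "j \<in> \<Delta> \<Longrightarrow> Min \<Delta> \<le> j"
  using Max_in_\<Delta> by (auto intro!: Min_in)

lemma rho_\<Delta>: "rho x \<in> \<Delta> \<longleftrightarrow> x \<in> \<Delta>"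
  using nxt(1) Min_\<Delta> by (simp add: rho_def)

text \<open>The image of the order \<open>before\<close> under \<open>rho\<close> (see \<open>before_rho\<close>). An element of \<open>\<Delta>\<close> takes the place
of its predecessor in \<open>\<Delta>\<close>, and the least one takes the place of \<open>n\<close>, in front of everything.
Hence the order within \<open>\<Delta>\<close> and within its complement is the usual one.\<close>

definition moved_less :: "'n \<Rightarrow> 'n \<Rightarrow> bool" where
  "moved_less a b \<longleftrightarrow> (if a \<in> \<Delta> \<and> b \<notin> \<Delta> then \<forall>x\<in>\<Delta>. x < a \<longrightarrow> x < b
     else if a \<notin> \<Delta> \<and> b \<in> \<Delta> then \<exists>x\<in>\<Delta>. x < b \<and> a < x else a < b)"

lemma before_rho: "moved_less (rho x) (rho y) \<longleftrightarrow> before x y"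
proof -
  have Mx: "z < Max UNIV \<longleftrightarrow> z \<noteq> Max UNIV" for z :: 'n by (simp add: order_less_le)
  consider "x \<in> \<Delta>" "y \<in> \<Delta>" | "x \<in> \<Delta>" "y \<notin> \<Delta>" | "x \<notin> \<Delta>" "y \<in> \<Delta>" | "x \<notin> \<Delta>" "y \<notin> \<Delta>" by blast
  then show ?thesis
  proof cases
    case 1
    have less: "nxt x < nxt y \<longleftrightarrow> x < y" if "x \<noteq> Max UNIV" "y \<noteq> Max UNIV"
    proof -
      have "nxt x < nxt y \<longleftrightarrow> nxt x \<le> y" by (rule less_nxt_iff[OF that(2) nxt(1)[OF that(1)]])
      also have "\<dots> \<longleftrightarrow> x < y" using nxt(2,3)[OF that(1)] 1(2) by (meson less_le_trans)
      finally show ?thesis .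
    qed
    have "Min \<Delta> < nxt y" if "y \<noteq> Max UNIV"
      using Min_\<Delta>(2)[OF 1(2)] nxt(2)[OF that] by simp
    moreover have "\<not> nxt x < Min \<Delta>" if "x \<noteq> Max UNIV"
      using Min_\<Delta>(2)[OF nxt(1)[OF that]] by simp
    moreover have "moved_less (rho x) (rho y) \<longleftrightarrow> rho x < rho y" using 1 by (simp add: moved_less_def rho_\<Delta>)
    ultimately show ?thesis using 1 less Mx
      by (cases "x = Max UNIV"; cases "y = Max UNIV") (simp_all add: before_def rho_def)
  next
    case 2
    have "(\<forall>z\<in>\<Delta>. z < nxt x \<longrightarrow> z < y) \<longleftrightarrow> x < y" if "x \<noteq> Max UNIV"
      using less_nxt_iff[OF that] 2 by (auto intro: le_less_trans)
    moreover have "(\<forall>z\<in>\<Delta>. z < Min \<Delta> \<longrightarrow> z < y)" using Min_\<Delta>(2) leD by blast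
    moreover have "moved_less (rho x) (rho y) \<longleftrightarrow> (\<forall>z\<in>\<Delta>. z < rho x \<longrightarrow> z < y)"
      using 2 by (simp add: moved_less_def rho_\<Delta>) (simp add: rho_def)
    ultimately show ?thesis using 2 not_\<Delta>_not_Max[OF 2(2)]
      by (cases "x = Max UNIV") (simp_all add: before_def rho_def)
  next
    case 3
    have "(\<exists>z\<in>\<Delta>. z < nxt y \<and> x < z) \<longleftrightarrow> x < y" if "y \<noteq> Max UNIV"
      using less_nxt_iff[OF that] 3 by (auto intro: less_le_trans)
    moreover have "\<not> (\<exists>z\<in>\<Delta>. z < Min \<Delta> \<and> x < z)" using Min_\<Delta>(2) leD by blast
    moreover have "moved_less (rho x) (rho y) \<longleftrightarrow> (\<exists>z\<in>\<Delta>. z < rho y \<and> x < z)"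
      using 3 by (simp add: moved_less_def rho_\<Delta>) (simp add: rho_def)
    ultimately show ?thesis using 3 not_\<Delta>_not_Max[OF 3(1)]
      by (cases "y = Max UNIV") (simp_all add: before_def rho_def)
  next
    case 4
    then show ?thesis using not_\<Delta>_not_Max by (auto simp: moved_less_def before_def rho_def)
  qed
qed

lemma bij_rho: "bij rho"
proof -
  have "inj rho"
  proof (rule linorder_injI)
    fix x y :: 'n assume "x < y"
    then have "before x y \<or> before y x" by (auto simp: before_def)
    then have "moved_less (rho x) (rho y) \<or> moved_less (rho y) (rho x)" by (simp add: before_rho)
    then show "rho x \<noteq> rho y" by (auto simp: moved_less_def split: if_splits)
  qed
  then show ?thesis by (simp add: bij_def finite_UNIV_inj_surj)
qed

definition moved_inversions :: "('n \<times> 'n) set" where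
  "moved_inversions = {(a, b). moved_less a b \<and> pos b < pos a}"

text \<open>For \<open>j \<notin> \<Delta>\<close>, the relation \<open>moved_less\<close> differs from the usual order on the pair of \<open>j\<close> and \<open>nxt j\<close>
only, which it reverses. Before the reversal this pair is an inversion iff \<open>j \<notin> cone\<close>, after it iff
\<open>j \<in> cone\<close>.\<close>

lemma moved_inversions_eq:
  "moved_inversions = (inversions pos - (\<lambda>j. (j, nxt j)) ` (- cone)) \<union> (\<lambda>j. (nxt j, j)) ` (cone - \<Delta>)"
proof -
  have mixed: "moved_less a j \<longleftrightarrow> a < j \<or> a = nxt j" "moved_less j a \<longleftrightarrow> j < a \<and> a \<noteq> nxt j"
    if "a \<in> \<Delta>" "j \<notin> \<Delta>" for a j
  proof -
    have j: "j \<noteq> Max UNIV" by (rule not_\<Delta>_not_Max[OF that(2)])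
    have ne: "x < j \<longleftrightarrow> x \<le> j" if "x \<in> \<Delta>" for x using that \<open>j \<notin> \<Delta>\<close> by (auto simp: order_less_le)
    have a: "a \<noteq> j" using that by auto
    have *: "(\<forall>x\<in>\<Delta>. x < a \<longrightarrow> x \<le> j) \<longleftrightarrow> a < j \<or> a = nxt j"
    proof
      assume l: "\<forall>x\<in>\<Delta>. x < a \<longrightarrow> x \<le> j"
      show "a < j \<or> a = nxt j"
      proof (rule ccontr)
        assume "\<not> (a < j \<or> a = nxt j)"
        then have "j < a" "a \<noteq> nxt j" using a by auto
        then have "nxt j < a" using nxt(3)[OF j that(1)] by simp
        then have "nxt j \<le> j" using l nxt(1)[OF j] by blast
        then show False using nxt(2)[OF j] by simp
      qed
    next
      assume "a < j \<or> a = nxt j"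
      then show "\<forall>x\<in>\<Delta>. x < a \<longrightarrow> x \<le> j" using less_nxt_iff[OF j] by auto
    qed
    show "moved_less a j \<longleftrightarrow> a < j \<or> a = nxt j" using that * ne by (simp add: moved_less_def)
    have "moved_less j a \<longleftrightarrow> \<not> (\<forall>x\<in>\<Delta>. x < a \<longrightarrow> x \<le> j)"
      using that by (auto simp: moved_less_def not_le)
    also have "\<dots> \<longleftrightarrow> j < a \<and> a \<noteq> nxt j" unfolding * using a by auto
    finally show "moved_less j a \<longleftrightarrow> j < a \<and> a \<noteq> nxt j" .
  qed
  have pure: "moved_less a b \<longleftrightarrow> a < b" if "a \<in> \<Delta> \<longleftrightarrow> b \<in> \<Delta>" for a b
    using that by (auto simp: moved_less_def)
  have "(a, b) \<in> moved_inversions \<longleftrightarrow>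
    (a, b) \<in> (inversions pos - (\<lambda>j. (j, nxt j)) ` (- cone)) \<union> (\<lambda>j. (nxt j, j)) ` (cone - \<Delta>)" for a b
  proof -
    have R: "(a, b) \<in> (inversions pos - (\<lambda>j. (j, nxt j)) ` (- cone)) \<union> (\<lambda>j. (nxt j, j)) ` (cone - \<Delta>)
      \<longleftrightarrow> (a < b \<and> pos b < pos a \<and> \<not> (a \<notin> cone \<and> b = nxt a)) \<or> (b \<in> cone \<and> b \<notin> \<Delta> \<and> a = nxt b)"
      by (auto simp: inversions_def)
    consider "a \<in> \<Delta> \<longleftrightarrow> b \<in> \<Delta>" | "a \<in> \<Delta>" "b \<notin> \<Delta>" | "a \<notin> \<Delta>" "b \<in> \<Delta>" by blast
    then show ?thesis
    proof cases
      case 1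
      have "a \<notin> cone \<Longrightarrow> b \<noteq> nxt a" using 1 \<Delta>_cone nxt(1)[of a] not_\<Delta>_not_Max[of a] by auto
      moreover have "b \<notin> \<Delta> \<Longrightarrow> a \<noteq> nxt b" using 1 nxt(1)[of b] not_\<Delta>_not_Max[of b] by auto
      ultimately show ?thesis unfolding R moved_inversions_def using pure[OF 1] by auto
    next
      case 2
      have "a \<in> cone" using 2 \<Delta>_cone by blast
      then show ?thesis unfolding R moved_inversions_def using mixed(1)[OF 2] in_cone_iff_nxt[OF 2(2)]
          nxt(2)[OF not_\<Delta>_not_Max[OF 2(2)]] 2 by auto
    next
      case 3
      have "b = nxt a \<Longrightarrow> pos b < pos a \<Longrightarrow> a \<notin> cone" using in_cone_iff_nxt[OF 3(1)] by auto
      then show ?thesis unfolding R moved_inversions_def using mixed(2)[OF 3(2,1)] 3 by auto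
    qed
  qed
  then show ?thesis by auto
qed

lemma missing_inversions: "(\<lambda>j. (j, nxt j)) ` (- cone) \<subseteq> inversions pos"
proof
  fix x assume "x \<in> (\<lambda>j. (j, nxt j)) ` (- cone)"
  then obtain j where j: "x = (j, nxt j)" "j \<notin> cone" by auto
  then have "j \<notin> \<Delta>" using \<Delta>_cone by auto
  then have "j < nxt j" "\<not> pos j < pos (nxt j)"
    using j(2) in_cone_iff_nxt[of j] nxt(2)[OF not_\<Delta>_not_Max] by auto
  moreover from this(1) have "j \<noteq> nxt j" by auto
  ultimately
  show "x \<in> inversions pos"
    using inj_pos[of j "nxt j"] by (auto simp: inversions_def j(1) not_less order_less_le)
qed

lemma card_moved_inversions:
  "card moved_inversions + card (- cone) = card (inversions pos) + card (cone - \<Delta>)"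
proof -
  have disj: "(inversions pos - (\<lambda>j. (j, nxt j)) ` (- cone)) \<inter> (\<lambda>j. (nxt j, j)) ` (cone - \<Delta>) = {}"
  proof -
    have "(nxt j, j) \<notin> inversions pos" if "j \<notin> \<Delta>" for j
      using nxt(2)[OF not_\<Delta>_not_Max[OF that]] by (auto simp: inversions_def)
    then show ?thesis by blast
  qed
  have "card ((\<lambda>j. (j, nxt j)) ` (- cone)) = card (- cone)" by (intro card_image inj_onI) simp
  moreover have "card ((\<lambda>j. (nxt j, j)) ` (cone - \<Delta>)) = card (cone - \<Delta>)"
    by (intro card_image inj_onI) simp
  moreover have "card ((\<lambda>j. (j, nxt j)) ` (- cone)) \<le> card (inversions pos)"
    by (intro card_mono missing_inversions) simp
  ultimately show ?thesis
    unfolding moved_inversions_eq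
    by (simp add: card_Un_disjoint[OF _ _ disj] card_Diff_subset[OF _ missing_inversions])
qed

lemma card_inversions_rho: "card (inversions (pos \<circ> rho \<circ> sigma)) = card moved_inversions"
proof (rule bij_betw_same_card[of "map_prod (rho \<circ> sigma) (rho \<circ> sigma)"])
  have bij: "bij (rho \<circ> sigma)" by (intro bij_comp bij_rho bij_sigma)
  show "bij_betw (map_prod (rho \<circ> sigma) (rho \<circ> sigma)) (inversions (pos \<circ> rho \<circ> sigma)) moved_inversions"
    unfolding bij_betw_def
  proof
    show "inj_on (map_prod (rho \<circ> sigma) (rho \<circ> sigma)) (inversions (pos \<circ> rho \<circ> sigma))"
      by (rule inj_on_subset[OF prod.inj_map]) (use bij in \<open>auto simp: bij_is_inj\<close>)
    have less: "moved_less (rho (sigma i)) (rho (sigma j)) \<longleftrightarrow> i < j" for i j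
      by (simp add: before_rho sigma_before_iff)
    show "map_prod (rho \<circ> sigma) (rho \<circ> sigma) ` inversions (pos \<circ> rho \<circ> sigma) = moved_inversions"
    proof (intro equalityI subsetI)
      fix x assume "x \<in> moved_inversions"
      then obtain a b where x: "x = (a, b)" "moved_less a b" "pos b < pos a"
        by (auto simp: moved_inversions_def)
      obtain i j where "a = rho (sigma i)" "b = rho (sigma j)"
        using bij_is_surj[OF bij] by (metis comp_apply surjD)
      then show "x \<in> map_prod (rho \<circ> sigma) (rho \<circ> sigma) ` inversions (pos \<circ> rho \<circ> sigma)"
        using x by (intro image_eqI[of _ _ "(i, j)"]) (auto simp: less inversions_def)
    qed (auto simp: moved_inversions_def inversions_def less)
  qed
qed

text \<open>Enumerate \<open>\<Delta>\<close> increasingly by \<open>e 0, ..., e (k - 1)\<close>; then \<open>rho\<close> adds \<open>1\<close> to the index modulo \<open>k\<close>.\<close>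

lemma rho_pow: "\<And>m. (rho ^^ m) = id \<longleftrightarrow> card \<Delta> dvd m"
proof -
  define e where "e a = sorted_list_of_set \<Delta> ! a" for a
  define k where "k = card \<Delta>"
  have len: "length (sorted_list_of_set \<Delta>) = k" by (simp add: k_def)
  have k0: "0 < k" using Max_in_\<Delta> by (auto simp: k_def card_gt_0_iff)
  have mono: "e a < e b" if "a < b" "b < k" for a b
    unfolding e_def using that strict_sorted_list_of_set[of \<Delta>]
    by (auto simp: len k_def sorted_wrt_iff_nth_less)
  have e\<Delta>: "e a \<in> \<Delta>" if "a < k" for a
    using nth_mem[of a "sorted_list_of_set \<Delta>"] that by (simp add: e_def k_def)
  have surj: "\<exists>a<k. x = e a" if "x \<in> \<Delta>" for x
    using that in_set_conv_nth[of x "sorted_list_of_set \<Delta>"] by (auto simp: e_def k_def)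
  have le: "e a \<le> e b" if "a \<le> b" "b < k" for a b
    using that mono[of a b] by (cases "a = b") auto
  have last: "e (k - 1) = Max UNIV"
  proof -
    obtain a where "a < k" "Max UNIV = e a" using surj[OF Max_in_\<Delta>] by blast
    then have "Max UNIV \<le> e (k - 1)" using le[of a "k - 1"] by simp
    then show ?thesis by (simp add: antisym)
  qed
  have first: "Min \<Delta> = e 0"
  proof (rule Min_eqI)
    fix y assume "y \<in> \<Delta>"
    then show "e 0 \<le> y" using surj le[of 0] by fastforce
  qed (use e\<Delta> k0 in auto)
  have step: "rho (e a) = e ((a + 1) mod k)" if a: "a < k" for a
  proof (cases "a = k - 1")
    case True
    have "rho (Max UNIV) = e 0" using Max_in_\<Delta> by (simp add: rho_def first)
    moreover have "(a + 1) mod k = 0" using True k0 by simp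
    ultimately show ?thesis using True last by simp
  next
    case False
    then have a1: "a + 1 < k" using a by simp
    have "e a < e (k - 1)" using False a by (intro mono) auto
    then have ne: "e a \<noteq> Max UNIV" unfolding last by auto
    have "nxt (e a) = e (a + 1)"
    proof (rule antisym)
      show "nxt (e a) \<le> e (a + 1)" using nxt(3)[OF ne e\<Delta>[OF a1]] mono[of a "a + 1"] a1 by simp
      obtain b where b: "b < k" "nxt (e a) = e b" using surj[OF nxt(1)[OF ne]] by blast
      have "a < b"
      proof (rule ccontr)
        assume "\<not> a < b"
        then have "e b \<le> e a" using le[of b a] a by simp
        then show False using nxt(2)[OF ne] b by simp
      qed
      then show "e (a + 1) \<le> nxt (e a)" using le[of "a + 1" b] b by simp
    qed
    then show ?thesis using ne e\<Delta>[OF a] a1 by (simp add: rho_def)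
  qed
  have pow: "(rho ^^ m) (e a) = e ((a + m) mod k)" if a: "a < k" for a m
  proof (induction m)
    case 0 then show ?case using a by simp
  next
    case (Suc m)
    have "(rho ^^ Suc m) (e a) = rho (e ((a + m) mod k))" by (simp add: Suc)
    also have "\<dots> = e (((a + m) mod k + 1) mod k)" by (rule step) (use k0 in simp)
    also have "\<dots> = e ((a + Suc m) mod k)" by (simp add: mod_Suc_eq)
    finally show ?case .
  qed
  have off: "(rho ^^ m) x = x" if "x \<notin> \<Delta>" for x m
    by (induction m) (use that in \<open>simp_all add: rho_def\<close>)
  fix m
  show "(rho ^^ m) = id \<longleftrightarrow> card \<Delta> dvd m"
  proof
    assume "(rho ^^ m) = id"
    then have "e (m mod k) = e 0" using pow[OF k0, of m] by simp
    moreover have "m mod k < k" using k0 by simp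
    ultimately have "m mod k = 0" using mono[of 0 "m mod k"] by (cases "m mod k = 0") auto
    then show "card \<Delta> dvd m" by (simp add: k_def dvd_eq_mod_eq_0)
  next
    assume "card \<Delta> dvd m"
    then have m: "m mod k = 0" by (simp add: k_def)
    show "(rho ^^ m) = id"
    proof
      fix x
      show "(rho ^^ m) x = id x"
      proof (cases "x \<in> \<Delta>")
        case True
        then obtain a where a: "a < k" "x = e a" using surj by blast
        have "(a + m) mod k = a" using m a(1) by (metis add_0_right mod_add_right_eq mod_less)
        then show ?thesis using pow[OF a(1)] a(2) by simp
      qed (simp add: off)
    qed
  qed
qed

end

lemma carrier_W: "(w :: 'n \<Rightarrow> 'n) \<in> carrier W \<longleftrightarrow> bij w"
  by (simp add: BijGroup_def Bij_def extensional_def)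

lemma mult_W: "bij u \<Longrightarrow> bij v \<Longrightarrow> (u :: 'n \<Rightarrow> 'n) \<otimes>\<^bsub>W\<^esub> v = u \<circ> v"
  by (simp add: BijGroup_def Bij_def extensional_def compose_def fun_eq_iff)

lemma one_W: "\<one>\<^bsub>W\<^esub> = (id :: 'n \<Rightarrow> 'n)"
  by (simp add: BijGroup_def fun_eq_iff)

lemma inv_W: "bij w \<Longrightarrow> inv\<^bsub>W\<^esub> w = perm_inv (w :: 'n \<Rightarrow> 'n)"
  using inv_BijGroup[of w UNIV] by (simp add: Bij_def extensional_def restrict_def)

lemma pow_W: "bij w \<Longrightarrow> w [^]\<^bsub>W\<^esub> (m::nat) = ((w :: 'n \<Rightarrow> 'n) ^^ m)"
proof (induction m)
  case 0 then show ?case by (simp add: one_W)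
next
  case (Suc m)
  interpret group "W :: ('n \<Rightarrow> 'n) monoid" by (rule group_BijGroup)
  have "bij (w ^^ m)" using Suc.prems by (rule bij_fn)
  then show ?case using Suc by (simp add: mult_W funpow_Suc_right del: funpow.simps)
qed

lemma (in orbit_data) ord_rho: "group.ord W (inv\<^bsub>W\<^esub> rho) = card \<Delta>"
proof -
  interpret group "W :: ('n \<Rightarrow> 'n) monoid" by (rule group_BijGroup)
  have rho: "rho \<in> carrier W" by (simp add: carrier_W bij_rho)
  have "inv\<^bsub>W\<^esub> rho [^]\<^bsub>W\<^esub> m = \<one>\<^bsub>W\<^esub> \<longleftrightarrow> rho [^]\<^bsub>W\<^esub> m = \<one>\<^bsub>W\<^esub>" for m :: nat
    using rho by (simp add: nat_pow_inv inv_eq_1_iff)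
  then show ?thesis
    using rho by (simp add: ord_unique pow_W[OF bij_rho] one_W rho_pow)
qed


section \<open>Normal forms of orbits\<close>

lemma mult_perm_mat_nth [simp]: "(A ** perm_mat p) $ i $ j = A $ i $ p j"
  by (simp add: mult_std_nth[symmetric] matrix_vector_mul_assoc[symmetric] del: mult_std_nth)

lemma perm_mat_mult_nth:
  assumes "bij p" shows "(perm_mat p ** A) $ i $ j = A $ perm_inv p i $ j"
proof -
  have "(i = p k) = (k = perm_inv p i)" for k
    using assms by (metis bij_inv_eq_iff)
  then show ?thesis
    by (simp add: matrix_matrix_mult_def perm_mat_def if_distrib[where f = "\<lambda>x. x * _"] cong: if_cong)
qed

lemma perm_mat_inverse:
  assumes "bij p"
  shows "perm_mat p ** perm_mat (perm_inv p) = mat 1" "perm_mat (perm_inv p) ** perm_mat p = mat 1"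
  by (simp_all add: perm_mat_comp[symmetric] perm_inv_comp[OF assms])

text \<open>Conjugation by \<open>perm_mat w\<close> turns the condition into upper triangularity in the usual sense.\<close>

lemma triangular_fixes_perm_flag:
  assumes w: "bij w" and up: "\<And>i j. perm_inv w j < perm_inv w i \<Longrightarrow> A $ i $ j = 0"
    and diag: "\<And>i. A $ i $ i \<noteq> 0"
  shows "A \<in> GL" "act A (act (perm_mat w) E_plus) = act (perm_mat w) E_plus"
proof -
  define b where "b = perm_mat (perm_inv w) ** A ** perm_mat w"
  have inv: "perm_inv (perm_inv w) = w" using w by (rule inv_inv_eq)
  have "bij (perm_inv w)" using w by (rule bij_imp_bij_inv)
  then have nth: "b $ i $ j = A $ w i $ w j" for i j
    unfolding b_def by (simp add: perm_mat_mult_nth inv)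
  have "perm_inv w (w i) = i" for i using w by (simp add: bij_is_inj)
  then have b: "b \<in> Borel" unfolding Borel_def by (simp add: nth up diag)
  have Ab: "A ** perm_mat w = perm_mat w ** b"
    by (simp add: b_def matrix_mul_assoc perm_mat_inverse[OF w])
  show "act A (act (perm_mat w) E_plus) = act (perm_mat w) E_plus"
    by (simp only: act_mult[symmetric] Ab) (simp only: act_mult Borel_act[OF b])
  have "A = A ** perm_mat w ** perm_mat (perm_inv w)"
    by (simp add: matrix_mul_assoc[symmetric] perm_mat_inverse[OF w])
  also have "\<dots> \<in> GL" unfolding Ab
    using b by (intro GL_mult perm_mat_GL w bij_imp_bij_inv) (simp add: Borel_iff)
  finally show "A \<in> GL" .
qed

lemma B_pred_iff:
  "h \<in> B_pred \<longleftrightarrow> h \<in> Borel \<and> h *v std (Max UNIV) = std (Max (UNIV :: 'n::{finite,wellorder} set))"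
proof -
  have col: "h *v std (Max UNIV) = std (Max UNIV) \<longleftrightarrow>
      h $ Max UNIV $ Max UNIV = 1 \<and> (\<forall>i. i \<noteq> Max UNIV \<longrightarrow> h $ i $ Max UNIV = 0)"
    by (auto simp: vec_eq_iff std_nth)
  have "h $ Max UNIV $ i = 0" if "\<forall>i j. j < i \<longrightarrow> h $ i $ j = 0" "i \<noteq> Max UNIV" for i
  proof -
    have "i \<le> Max UNIV" by simp
    then show ?thesis using that by (simp add: order_less_le)
  qed
  then show ?thesis unfolding col B_pred_def Borel_iff by blast
qed

lemma B_pred_mult: "g \<in> B_pred \<Longrightarrow> h \<in> B_pred \<Longrightarrow> g ** h \<in> B_pred"
  by (simp add: B_pred_iff Borel_mult matrix_vector_mul_assoc[symmetric] del: mult_std_nth)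

lemma mat_1_Borel: "mat 1 \<in> Borel"
  by (simp add: Borel_def mat_def)

lemma mat_1_B_pred: "mat 1 \<in> B_pred"
  by (simp add: B_pred_iff mat_1_Borel)

lemma Borel_inverse:
  assumes "b \<in> Borel" obtains c where "c \<in> Borel" "b ** c = mat 1" "c ** b = mat 1"
  using stabilizer_inverse[of b E_plus] assms unfolding stabilizer_E_plus by metis

lemma B_pred_inverse:
  assumes "h \<in> B_pred" obtains k where "k \<in> B_pred" "h ** k = mat 1" "k ** h = mat 1"
proof -
  obtain k where k: "k \<in> Borel" "h ** k = mat 1" "k ** h = mat 1"
    using Borel_inverse assms unfolding B_pred_iff by metis
  have "k *v std (Max UNIV) = k *v (h *v std (Max UNIV))"
    using assms by (simp add: B_pred_iff)
  then have "k \<in> B_pred" using k by (simp add: B_pred_iff matrix_vector_mul_assoc)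
  then show ?thesis using that k by blast
qed

lemma sweep_singleton: "sweep H {F} = (\<lambda>h. act h F) ` H"
  by (auto simp: sweep_def)

text \<open>The stabilizer of \<open>E\<close> absorbs both \<open>H\<close> and the translation by \<open>s\<close>.\<close>

lemma sweep_sweep_singleton:
  assumes "H \<subseteq> stabilizer E" "mat 1 \<in> H" "s \<in> stabilizer E"
  shows "sweep (stabilizer E) (sweep H {act s F}) = sweep (stabilizer E) {F}"
proof (intro equalityI subsetI)
  fix G assume "G \<in> sweep (stabilizer E) (sweep H {act s F})"
  then obtain g h where "g \<in> stabilizer E" "h \<in> H" "G = act g (act h (act s F))"
    by (auto simp: sweep_def)
  moreover from this have "g ** h ** s \<in> stabilizer E" using assms by (auto intro!: stabilizer_mult)
  ultimately show "G \<in> sweep (stabilizer E) {F}"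
    by (auto simp: sweep_singleton act_mult intro!: image_eqI[of _ _ "g ** h ** s"])
next
  fix G assume "G \<in> sweep (stabilizer E) {F}"
  then obtain g where g: "g \<in> stabilizer E" "G = act g F" by (auto simp: sweep_singleton)
  obtain t where t: "t \<in> stabilizer E" "t ** s = mat 1" using stabilizer_inverse[OF assms(3)] by metis
  have "act (g ** t) (act (mat 1) (act s F)) = act (g ** (t ** s)) F"
    by (simp add: act_mult)
  also have "\<dots> = G" by (simp add: t g)
  finally have "G = act (g ** t) (act (mat 1) (act s F))" by simp
  moreover have "g ** t \<in> stabilizer E" by (rule stabilizer_mult[OF g(1) t(1)])
  ultimately show "G \<in> sweep (stabilizer E) (sweep H {act s F})"
    unfolding sweep_def using assms(2) by blast
qed

context orbit_data
begin

definition antichain_vec :: "'n cvec" where "antichain_vec = (\<chi> i. if i \<in> \<Delta> then 1 else 0)"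

lemma mult_antichain_vec: "(A *v antichain_vec) $ i = (\<Sum>j\<in>\<Delta>. A $ i $ j)"
proof -
  have "(A *v antichain_vec) $ i = (\<Sum>j\<in>UNIV. if j \<in> \<Delta> then A $ i $ j else 0)"
    unfolding matrix_vector_mult_def antichain_vec_def by (simp, intro sum.cong) auto
  then show ?thesis by (simp add: sum.If_cases)
qed

text \<open>An upper triangular matrix that takes \<open>e_n\<close> to the vector \<open>antichain_vec\<close>. Conjugation by it turns
the condition of fixing \<open>e_n\<close> into that of fixing \<open>antichain_vec\<close>, so that the flag of the normal
form becomes \<open>w E_plus\<close>.\<close>

definition shear :: "'n cmat" where
  "shear = (\<chi> i j. if j = Max UNIV then antichain_vec $ i else if i = j then 1 else 0)"

lemma shear_Max: "shear *v std (Max UNIV) = antichain_vec"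
  by (simp add: vec_eq_iff shear_def)

lemma shear_other: "j \<noteq> Max UNIV \<Longrightarrow> shear *v std j = std j"
  by (simp add: vec_eq_iff shear_def std_nth)

lemma shear_Borel: "shear \<in> Borel"
proof -
  have "j \<noteq> Max UNIV" if "j < i" for i j :: 'n using that Max_ge_UNIV[of i] by auto
  then show ?thesis using Max_in_\<Delta> by (auto simp: Borel_def shear_def antichain_vec_def)
qed

definition shear_inv :: "'n cmat" where
  "shear_inv = (SOME h. h \<in> Borel \<and> shear ** h = mat 1 \<and> h ** shear = mat 1)"

lemma shear_inv: "shear_inv \<in> Borel" "shear ** shear_inv = mat 1" "shear_inv ** shear = mat 1"
proof -
  have "\<exists>h. h \<in> Borel \<and> shear ** h = mat 1 \<and> h ** shear = mat 1"
    using Borel_inverse[OF shear_Borel] by metis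
  from someI_ex[OF this] show "shear_inv \<in> Borel" "shear ** shear_inv = mat 1" "shear_inv ** shear = mat 1"
    unfolding shear_inv_def by blast+
qed

lemma shear_inv_GL: "shear_inv \<in> GL" using shear_inv(1) by (simp add: Borel_iff)

definition base_flag :: "'n flag" where
  "base_flag = act shear_inv (act (perm_mat w) E_plus)"

definition orbit :: "'n flag set" where
  "orbit = sweep B_pred {base_flag}"

text \<open>The conjugate of \<open>B_pred\<close> by \<open>shear\<close>.\<close>

definition fixing :: "'n cmat set" where
  "fixing = {h \<in> Borel. h *v antichain_vec = antichain_vec}"

lemma orbit_eq: "orbit = (\<lambda>h. act (shear_inv ** h ** perm_mat w) E_plus) ` fixing"
proof -
  have shear_undo: "shear ** (shear_inv ** A) = A" "shear_inv ** (shear ** A) = A" for A :: "'n cmat"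
    by (simp_all add: matrix_mul_assoc shear_inv)
  have shear_inv_vec: "shear_inv *v antichain_vec = std (Max UNIV)"
    unfolding shear_Max[symmetric] by (simp add: matrix_vector_mul_assoc shear_inv)
  show ?thesis
  proof (intro equalityI subsetI)
    fix F assume "F \<in> orbit"
    then obtain h where h: "h \<in> B_pred" "F = act h base_flag" by (auto simp: orbit_def sweep_singleton)
    have "shear ** h ** shear_inv \<in> Borel" using h shear_Borel shear_inv by (intro Borel_mult) (auto simp: B_pred_iff)
    moreover have "(shear ** h ** shear_inv) *v antichain_vec = antichain_vec"
      using h(1) by (simp only: matrix_vector_mul_assoc[symmetric] shear_inv_vec B_pred_iff shear_Max)
    moreover have "shear_inv ** (shear ** h ** shear_inv) ** perm_mat w = h ** shear_inv ** perm_mat w"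
      by (simp add: matrix_mul_assoc shear_inv)
    ultimately show "F \<in> (\<lambda>h. act (shear_inv ** h ** perm_mat w) E_plus) ` fixing"
      unfolding h(2) base_flag_def
      by (intro image_eqI[of _ _ "shear ** h ** shear_inv"]) (auto simp: fixing_def act_mult)
  next
    fix F assume "F \<in> (\<lambda>h. act (shear_inv ** h ** perm_mat w) E_plus) ` fixing"
    then obtain h where h: "h \<in> Borel" "h *v antichain_vec = antichain_vec" "F = act (shear_inv ** h ** perm_mat w) E_plus"
      by (auto simp: fixing_def)
    have "shear_inv ** h ** shear \<in> B_pred" unfolding B_pred_iff
      using Borel_mult[OF Borel_mult[OF shear_inv(1) h(1)] shear_Borel]
      by (simp only: matrix_vector_mul_assoc[symmetric] shear_Max h(2) shear_inv_vec)
    moreover have "(shear_inv ** h ** shear) ** (shear_inv ** perm_mat w) = shear_inv ** h ** perm_mat w"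
      by (simp only: matrix_mul_assoc[symmetric] shear_undo)
    then have "F = act (shear_inv ** h ** shear) base_flag"
      unfolding h(3) base_flag_def act_mult[symmetric] by (simp only:)
    ultimately show "F \<in> orbit" unfolding orbit_def sweep_singleton by blast
  qed
qed

lemma base_flag_flags: "base_flag \<in> flags"
  unfolding base_flag_def by (intro flags_act E_plus_flags perm_mat_GL bij_w shear_inv_GL)

text \<open>In a matrix that fixes \<open>antichain_vec\<close>, the entries of row \<open>i\<close> in the columns from \<open>\<Delta>\<close> have a
prescribed sum. The column \<open>mu i\<close> is the one whose entry is computed from the others. For
\<open>i \<in> cone\<close> it is chosen outside the inversions, so that no free entry is lost. Otherwise all
columns of \<open>\<Delta>\<close> above \<open>i\<close> are inversions, and the choice of \<open>nxt i\<close>, which has the largest position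
among them, matters in \<open>orbit_chain_exists\<close>: the dependent entry then vanishes as soon as the free
entries in the columns of smaller position do.\<close>

definition mu :: "'n \<Rightarrow> 'n" where
  "mu i = (if i \<in> cone then SOME j. j \<in> \<Delta> \<and> i \<le> j \<and> pos i \<le> pos j else nxt i)"

lemma mu_cone:
  assumes "i \<in> cone" shows "mu i \<in> \<Delta>" "i \<le> mu i" "pos i \<le> pos (mu i)"
proof -
  have "\<exists>j. j \<in> \<Delta> \<and> i \<le> j \<and> pos i \<le> pos j" using assms by (auto simp: cone_def)
  from someI_ex[OF this] show "mu i \<in> \<Delta>" "i \<le> mu i" "pos i \<le> pos (mu i)"
    using assms by (simp_all add: mu_def)
qed

lemma not_cone: assumes "i \<notin> cone" shows "i \<notin> \<Delta>" "i \<noteq> Max UNIV" "mu i = nxt i"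
  using assms \<Delta>_cone not_\<Delta>_not_Max by (auto simp: mu_def)

lemma mu_\<Delta>: "mu i \<in> \<Delta>"
  using mu_cone(1) not_cone(3) nxt(1)[OF not_cone(2)] by (cases "i \<in> cone") auto

lemma le_mu: "i \<le> mu i"
  using mu_cone(2) not_cone(3) nxt(2)[OF not_cone(2)] by (cases "i \<in> cone") (auto simp: order_less_imp_le)

text \<open>By incomparability within \<open>\<Delta>\<close> there is no other choice.\<close>

lemma mu_eq: assumes "i \<in> \<Delta>" shows "mu i = i"
proof (rule ccontr)
  assume "mu i \<noteq> i"
  then have "i < mu i" using le_mu[of i] by (simp add: order_less_le)
  then have "pos (mu i) < pos i" by (rule antichain[OF assms mu_\<Delta>])
  moreover have "i \<in> cone" using assms \<Delta>_cone by blast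
  ultimately show False using mu_cone(3)[of i] by simp
qed

definition free :: "('n \<times> 'n) set" where
  "free = {(i, j). i < j \<and> pos j < pos i \<and> j \<noteq> mu i}"

lemma free_eq: "free = inversions pos - (\<lambda>j. (j, nxt j)) ` (- cone)"
proof -
  have "(i, j) \<in> free \<longleftrightarrow> (i, j) \<in> inversions pos - (\<lambda>j. (j, nxt j)) ` (- cone)" for i j
    using mu_cone(3)[of i] not_cone(3)[of i] by (cases "i \<in> cone") (auto simp: free_def inversions_def)
  then show ?thesis by auto
qed

lemma card_free: "card free + card (- cone) = card (inversions pos)"
proof -
  have "card ((\<lambda>j. (j, nxt j)) ` (- cone)) = card (- cone)" by (intro card_image inj_onI) simp
  moreover have "card ((\<lambda>j. (j, nxt j)) ` (- cone)) \<le> card (inversions pos)"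
    by (intro card_mono missing_inversions) simp
  ultimately show ?thesis
    unfolding free_eq by (simp add: card_Diff_subset[OF _ missing_inversions])
qed

definition entry :: "('n \<times> 'n \<Rightarrow> complex) \<Rightarrow> 'n \<Rightarrow> 'n \<Rightarrow> complex" where
  "entry \<theta> i j = (if (i, j) \<in> free then \<theta> (i, j) else if i = j then 1 else 0)"

text \<open>Representatives for \<open>fixing\<close> modulo the stabilizer of \<open>w E_plus\<close>, parametrized by the free entries. The
correction in column \<open>mu i\<close> makes the matrix fix \<open>antichain_vec\<close>; it may destroy invertibility.\<close>

definition slice :: "('n \<times> 'n \<Rightarrow> complex) \<Rightarrow> 'n cmat" where
  "slice \<theta> = (\<chi> i j. if j = mu i then antichain_vec $ i - (\<Sum>k\<in>\<Delta> - {mu i}. entry \<theta> i k) else entry \<theta> i j)"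

lemma slice_upper: "j < i \<Longrightarrow> slice \<theta> $ i $ j = 0"
  using le_mu[of i] by (auto simp: slice_def entry_def free_def)

lemma slice_antichain_vec: "slice \<theta> *v antichain_vec = antichain_vec"
proof -
  have "(\<Sum>j\<in>\<Delta>. slice \<theta> $ i $ j) = antichain_vec $ i" for i
  proof -
    have "(\<Sum>j\<in>\<Delta>. slice \<theta> $ i $ j) = slice \<theta> $ i $ mu i + (\<Sum>j\<in>\<Delta> - {mu i}. slice \<theta> $ i $ j)"
      by (rule sum.remove) (auto simp: mu_\<Delta>)
    also have "(\<Sum>j\<in>\<Delta> - {mu i}. slice \<theta> $ i $ j) = (\<Sum>j\<in>\<Delta> - {mu i}. entry \<theta> i j)"
      by (rule sum.cong) (auto simp: slice_def)
    finally show ?thesis by (simp add: slice_def)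
  qed
  then show ?thesis by (simp add: vec_eq_iff mult_antichain_vec)
qed

lemma slice_diag:
  "slice \<theta> $ i $ i = (if i \<in> \<Delta> then 1 - (\<Sum>k\<in>\<Delta> - {i}. entry \<theta> i k) else 1)"
  using mu_\<Delta>[of i] mu_eq[of i] by (auto simp: slice_def antichain_vec_def entry_def free_def)

lemma line_slice: "line (slice \<theta>) (slice \<theta>') s = slice (\<lambda>p. \<theta> p + s * (\<theta>' p - \<theta> p))"
proof -
  have e: "entry (\<lambda>p. \<theta> p + s * (\<theta>' p - \<theta> p)) i j = entry \<theta> i j + s * (entry \<theta>' i j - entry \<theta> i j)" for i j
    by (simp add: entry_def)
  show ?thesis
    by (simp add: vec_eq_iff line_def slice_def e sum.distrib sum_subtractf flip: sum_distrib_left)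
      (simp add: algebra_simps)
qed

lemma slice_eqI:
  assumes up: "\<And>i j. j < i \<Longrightarrow> X $ i $ j = 0" and v: "X *v antichain_vec = antichain_vec"
    and M: "\<And>i j. i \<le> j \<Longrightarrow> pos i \<le> pos j \<Longrightarrow> j \<noteq> mu i \<Longrightarrow> X $ i $ j = (if i = j then 1 else 0)"
  shows "X = slice (\<lambda>(i, j). X $ i $ j)"
proof -
  have e: "entry (\<lambda>(i, j). X $ i $ j) i j = X $ i $ j" if "j \<noteq> mu i" for i j
  proof (cases "(i, j) \<in> free")
    case False
    then have "j < i \<or> i \<le> j \<and> pos i \<le> pos j" using that by (auto simp: free_def not_less)
    then show ?thesis using False up[of j i] M[of i j] that by (auto simp: entry_def)
  qed (simp add: entry_def)
  have "X $ i $ mu i = antichain_vec $ i - (\<Sum>k\<in>\<Delta> - {mu i}. X $ i $ k)" for i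
  proof -
    have "antichain_vec $ i = (\<Sum>k\<in>\<Delta>. X $ i $ k)" using arg_cong[OF v, of "\<lambda>x. x $ i"] by (simp add: mult_antichain_vec)
    also have "\<dots> = X $ i $ mu i + (\<Sum>k\<in>\<Delta> - {mu i}. X $ i $ k)" by (rule sum.remove) (auto simp: mu_\<Delta>)
    finally show ?thesis by simp
  qed
  then show ?thesis by (auto simp: vec_eq_iff slice_def e intro!: sum.cong)
qed

text \<open>The matrix \<open>s\<close> has to be triangular for both orders, to fix \<open>antichain_vec\<close>, and to make the entries
of \<open>h ** s\<close> at the comparable pairs outside the columns \<open>mu\<close> trivial. Row \<open>i\<close> of the last condition
involves the rows of \<open>s\<close> from \<open>i\<close> on, with the nonzero coefficient \<open>h $ i $ i\<close> at row \<open>i\<close>. So the rows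
can be found from the bottom upwards. That \<open>s\<close> is invertible is automatic: for \<open>i \<in> \<Delta>\<close> the diagonal
entry of row \<open>i\<close> is the only one in a column of \<open>\<Delta>\<close>, hence it is \<open>1\<close>; for other \<open>i\<close> the diagonal
entry is the inverse of \<open>h $ i $ i\<close>.\<close>

lemma fixing_to_slice:
  assumes h: "h \<in> fixing"
  obtains s \<theta> where "s \<in> Borel" "\<And>i j. pos j < pos i \<Longrightarrow> s $ i $ j = 0" "h ** s = slice \<theta>"
proof -
  have hB: "h \<in> Borel" and hv: "h *v antichain_vec = antichain_vec" using h by (auto simp: fixing_def)
  have up: "h $ i $ j = 0" if "j < i" for i j using hB that by (simp add: Borel_def)
  have diag: "h $ i $ i \<noteq> 0" for i using hB by (simp add: Borel_def)
  define P where "P f i r \<longleftrightarrow> (\<forall>j. \<not> (i \<le> j \<and> pos i \<le> pos j) \<longrightarrow> r j = 0) \<and> (\<Sum>j\<in>\<Delta>. r j) = antichain_vec $ i \<and>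
      (\<forall>j. i \<le> j \<longrightarrow> pos i \<le> pos j \<longrightarrow> j \<noteq> mu i \<longrightarrow>
        h $ i $ i * r j + (\<Sum>k\<in>{i<..}. h $ i $ k * f k j) = (if i = j then 1 else 0))"
    for f :: "'n \<Rightarrow> 'n \<Rightarrow> complex" and i r
  have wf: "wf {(z, x :: 'n). x < z}"
    by (rule wf_subset[OF wf_measure[of "\<lambda>x. card {x<..}"]]) (auto intro!: psubset_card_mono)
  have "\<exists>f. \<forall>i. P f i (f i)"
  proof (rule dependent_wf_choice[OF wf])
    fix f g :: "'n \<Rightarrow> 'n \<Rightarrow> complex" and i r
    assume "\<And>z. (z, i) \<in> {(z, x). x < z} \<Longrightarrow> f z = g z"
    then have "(\<Sum>k\<in>{i<..}. h $ i $ k * f k j) = (\<Sum>k\<in>{i<..}. h $ i $ k * g k j)" for j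
      by (intro sum.cong) auto
    then show "P f i r = P g i r" by (simp add: P_def)
  next
    fix i and f :: "'n \<Rightarrow> 'n \<Rightarrow> complex"
    define q where "q j = (if i \<le> j \<and> pos i \<le> pos j
      then ((if i = j then 1 else 0) - (\<Sum>k\<in>{i<..}. h $ i $ k * f k j)) / h $ i $ i else 0)" for j
    \<comment> \<open>The row \<open>q\<close> solves the conditions outside the column \<open>mu i\<close>. For \<open>i \<in> cone\<close> the entry at \<open>mu i\<close> then
      adjusts the row sum; otherwise row \<open>i\<close> of \<open>s\<close> has no entry in a column of \<open>\<Delta>\<close>.\<close>
    define r where "r = (if i \<in> cone then q(mu i := antichain_vec $ i - (\<Sum>j\<in>\<Delta> - {mu i}. q j)) else q)"
    have "(\<Sum>j\<in>\<Delta>. r j) = antichain_vec $ i"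
    proof (cases "i \<in> cone")
      case True
      have "(\<Sum>j\<in>\<Delta>. r j) = r (mu i) + (\<Sum>j\<in>\<Delta> - {mu i}. r j)" by (rule sum.remove) (auto simp: mu_\<Delta>)
      also have "(\<Sum>j\<in>\<Delta> - {mu i}. r j) = (\<Sum>j\<in>\<Delta> - {mu i}. q j)"
        using True by (intro sum.cong) (auto simp: r_def)
      finally show ?thesis using True by (simp add: r_def)
    next
      case False
      then have "r j = 0" if "j \<in> \<Delta>" for j using that by (auto simp: r_def q_def cone_def)
      then show ?thesis using not_cone(1)[OF False] by (simp add: antichain_vec_def)
    qed
    moreover have "r j = 0" if "\<not> (i \<le> j \<and> pos i \<le> pos j)" for j
      using that mu_cone(2,3)[of i] by (auto simp: r_def q_def)
    moreover have "h $ i $ i * r j + (\<Sum>k\<in>{i<..}. h $ i $ k * f k j) = (if i = j then 1 else 0)"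
      if "i \<le> j" "pos i \<le> pos j" "j \<noteq> mu i" for j
    proof -
      have "r j = q j" using that(3) by (simp add: r_def)
      also have "\<dots> = ((if i = j then 1 else 0) - (\<Sum>k\<in>{i<..}. h $ i $ k * f k j)) / h $ i $ i"
        using that by (simp add: q_def)
      finally show ?thesis using diag[of i] by (simp only: nonzero_mult_div_cancel_left times_divide_eq_right) simp
    qed
    ultimately have "P f i r" by (simp add: P_def)
    then show "\<exists>r. P f i r" by blast
  qed
  then obtain f where f: "\<And>i. P f i (f i)" by blast
  define s :: "'n cmat" where "s = (\<chi> i j. f i j)"
  have s0: "s $ i $ j = 0" if "\<not> (i \<le> j \<and> pos i \<le> pos j)" for i j
    using f[of i] that by (simp add: P_def s_def)
  have sv: "s *v antichain_vec = antichain_vec" using f by (simp add: vec_eq_iff mult_antichain_vec s_def P_def)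
  have hs: "(h ** s) $ i $ j = h $ i $ i * s $ i $ j + (\<Sum>k\<in>{i<..}. h $ i $ k * s $ k $ j)" for i j
  proof -
    have "(h ** s) $ i $ j = (\<Sum>k\<in>UNIV. h $ i $ k * s $ k $ j)" by (simp add: matrix_matrix_mult_def)
    also have "\<dots> = (\<Sum>k\<in>insert i {i<..}. h $ i $ k * s $ k $ j)"
      using up by (intro sum.mono_neutral_right) (auto simp: not_less order_less_le)
    finally show ?thesis by simp
  qed
  have M: "(h ** s) $ i $ j = (if i = j then 1 else 0)" if "i \<le> j" "pos i \<le> pos j" "j \<noteq> mu i" for i j
    using f[of i] that unfolding hs by (simp add: P_def s_def)
  have "s $ i $ i \<noteq> 0" for i
  proof (cases "i \<in> \<Delta>")
    case True
    have "1 = (\<Sum>j\<in>\<Delta>. s $ i $ j)" using arg_cong[OF sv, of "\<lambda>x. x $ i"] True by (simp add: mult_antichain_vec) (simp add: antichain_vec_def)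
    also have "\<dots> = (\<Sum>j\<in>{i}. s $ i $ j)"
    proof (rule sum.mono_neutral_right)
      show "\<forall>j\<in>\<Delta> - {i}. s $ i $ j = 0"
      proof
        fix j assume j: "j \<in> \<Delta> - {i}"
        have "\<not> (i \<le> j \<and> pos i \<le> pos j)"
          using antichain[OF True, of j] j by (auto simp: order_less_le)
        then show "s $ i $ j = 0" by (rule s0)
      qed
    qed (use True in auto)
    finally show ?thesis by auto
  next
    case False
    then have "i \<noteq> mu i" using mu_\<Delta>[of i] by auto
    then have "(h ** s) $ i $ i = 1" using M[of i i] by simp
    moreover have "(\<Sum>k\<in>{i<..}. h $ i $ k * s $ k $ i) = 0"
      using s0[of _ i] by (intro sum.neutral ballI) (simp add: not_le)
    ultimately show ?thesis unfolding hs by auto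
  qed
  moreover have "s $ i $ j = 0" if "j < i" for i j by (rule s0) (use that in auto)
  ultimately have sB: "s \<in> Borel" by (simp add: Borel_def)
  have "h ** s = slice (\<lambda>(i, j). (h ** s) $ i $ j)"
  proof (rule slice_eqI)
    show "(h ** s) $ i $ j = 0" if "j < i" for i j
      using Borel_mult[OF hB sB] that by (simp add: Borel_def)
    show "(h ** s) *v antichain_vec = antichain_vec" by (simp add: matrix_vector_mul_assoc[symmetric] hv sv)
  qed (rule M)
  moreover have "s $ i $ j = 0" if "pos j < pos i" for i j using that by (intro s0) auto
  ultimately show ?thesis using that sB by blast
qed

lemma orbit_parametrized:
  assumes g: "g \<in> GL" and Q: "act g E_plus \<in> orbit"
  obtains \<theta> b where "b \<in> Borel" "g = shear_inv ** slice \<theta> ** perm_mat w ** b"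
proof -
  obtain h where h: "h \<in> fixing" "act g E_plus = act (shear_inv ** h ** perm_mat w) E_plus"
    using Q unfolding orbit_eq by blast
  obtain s \<theta> where s: "s \<in> Borel" "\<And>i j. pos j < pos i \<Longrightarrow> s $ i $ j = 0" "h ** s = slice \<theta>"
    by (rule fixing_to_slice[OF h(1)]) blast
  have "act s (act (perm_mat w) E_plus) = act (perm_mat w) E_plus"
    using s(1) by (intro triangular_fixes_perm_flag(2)[OF bij_w s(2)]) (auto simp: Borel_def)
  then have "act (shear_inv ** slice \<theta> ** perm_mat w) E_plus = act (shear_inv ** h ** perm_mat w) E_plus"
    by (simp add: act_mult s(3)[symmetric])
  then have eq: "act g E_plus = act (shear_inv ** slice \<theta> ** perm_mat w) E_plus" using h(2) by simp
  have "slice \<theta> \<in> GL" unfolding s(3)[symmetric]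
    using h(1) s(1) by (intro GL_mult) (auto simp: fixing_def Borel_iff)
  then have "shear_inv ** slice \<theta> ** perm_mat w \<in> GL" by (intro GL_mult shear_inv_GL perm_mat_GL bij_w)
  then show ?thesis using eq act_E_plus_eq_iff[OF g] that by metis
qed

lemma slice_in_fixing: "slice \<theta> \<in> GL \<Longrightarrow> slice \<theta> \<in> fixing"
  by (simp add: fixing_def Borel_iff slice_upper slice_antichain_vec)

end

text \<open>After the Bruhat decomposition, \<open>\<Delta>\<close> consists of the maximal elements of the support of the vector
\<open>z\<close> that plays the role of \<open>e_n\<close>. A matrix \<open>m\<close> that is triangular for both orders takes the sum of
the \<open>e_i\<close>, \<open>i \<in> \<Delta>\<close>, to \<open>z\<close>: for each support element \<open>i\<close> it has the entry \<open>z $ i\<close> in the column of a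
maximal element \<open>\<delta> i\<close> above \<open>i\<close>.\<close>

lemma orbit_normal_form:
  fixes F :: "'n::{finite,wellorder} flag"
  assumes "F \<in> flags"
  obtains w \<Delta> where "orbit_data w \<Delta>" "sweep B_pred {F} = orbit_data.orbit w \<Delta>"
proof -
  obtain b w where b: "b \<in> Borel" and w: "bij w" and F: "F = act (b ** perm_mat w) E_plus"
    by (rule bruhat_exists[OF assms])
  let ?pos = "perm_inv w"
  obtain c where c: "c \<in> Borel" "b ** c = mat 1" by (rule Borel_inverse[OF b])
  define z where "z = c *v std (Max UNIV)"
  define supp where "supp = {i. z $ i \<noteq> 0}"
  define above where "above i = {j \<in> supp. i \<le> j \<and> ?pos i \<le> ?pos j}" for i
  define \<Delta> where "\<Delta> = {i \<in> supp. above i = {i}}"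
  define \<delta> where "\<delta> i = Max (above i)" for i
  have self: "i \<in> above i" if "i \<in> supp" for i using that by (simp add: above_def)
  have \<delta>: "\<delta> i \<in> above i" "j \<in> above i \<Longrightarrow> j \<le> \<delta> i" if "i \<in> supp" for i j
  proof -
    have "above i \<noteq> {}" using self[OF that] by blast
    then show "\<delta> i \<in> above i" unfolding \<delta>_def by (intro Max_in) simp_all
  qed (simp add: \<delta>_def)
  have \<delta>\<Delta>: "\<delta> i \<in> \<Delta>" if i: "i \<in> supp" for i
  proof -
    have d: "\<delta> i \<in> supp" using \<delta>(1)[OF i] by (simp add: above_def)
    moreover have "j = \<delta> i" if "j \<in> above (\<delta> i)" for j
    proof -
      have "j \<in> above i" using that \<delta>(1)[OF i] by (auto simp: above_def)
      then show ?thesis using \<delta>(2)[OF i, of j] that by (auto simp: above_def)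
    qed
    ultimately show ?thesis using self[OF d] by (auto simp: \<Delta>_def)
  qed
  have \<delta>_eq: "\<delta> i = i" if "i \<in> \<Delta>" for i using that by (simp add: \<Delta>_def \<delta>_def)
  have M: "Max UNIV \<in> \<Delta>"
  proof -
    have "z $ Max UNIV \<noteq> 0" using c(1) by (simp add: z_def Borel_def)
    then have "Max UNIV \<in> supp" by (simp add: supp_def)
    moreover have "j = Max UNIV" if "Max UNIV \<le> j" for j :: 'n using that by (simp add: antisym)
    ultimately show ?thesis using self unfolding \<Delta>_def above_def by blast
  qed
  interpret orbit_data w \<Delta>
  proof
    fix i j assume ij: "i \<in> \<Delta>" "j \<in> \<Delta>" "i < j"
    show "?pos j < ?pos i"
    proof (rule ccontr)
      assume "\<not> ?pos j < ?pos i"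
      then have "j \<in> above i" using ij by (auto simp: above_def \<Delta>_def)
      then show False using ij by (auto simp: \<Delta>_def)
    qed
  qed (rule w, rule M)
  define m :: "'n cmat" where
    "m = (\<chi> i j. if i \<in> supp \<and> j = \<delta> i then z $ i else if i = j then 1 else 0)"
  have diag: "m $ i $ i \<noteq> 0" for i by (simp add: m_def supp_def)
  have m0: "m $ i $ j = 0" if "\<not> (i \<le> j \<and> pos i \<le> pos j)" for i j
    using that \<delta>(1)[of i] by (auto simp: m_def above_def)
  have mpos: "m $ i $ j = 0" if "pos j < pos i" for i j by (rule m0) (use that in auto)
  have "m $ i $ j = 0" if "j < i" for i j by (rule m0) (use that in auto)
  then have mB: "m \<in> Borel" using diag by (simp add: Borel_def)
  have "m *v antichain_vec = z"
  proof -
    have "(\<Sum>j\<in>\<Delta>. m $ i $ j) = z $ i" for i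
    proof (cases "i \<in> supp")
      case True
      have "(\<Sum>j\<in>\<Delta>. m $ i $ j) = (\<Sum>j\<in>{\<delta> i}. m $ i $ j)"
        using True \<delta>\<Delta>[OF True] \<delta>_eq by (intro sum.mono_neutral_right) (auto simp: m_def)
      then show ?thesis using True by (simp add: m_def)
    next
      case False
      then have "i \<notin> \<Delta>" by (simp add: \<Delta>_def)
      then have "(\<Sum>j\<in>\<Delta>. m $ i $ j) = 0" using False by (intro sum.neutral) (auto simp: m_def)
      then show ?thesis using False by (simp add: supp_def)
    qed
    then show ?thesis by (simp add: vec_eq_iff mult_antichain_vec)
  qed
  define h where "h = b ** m ** shear"
  have "h *v std (Max UNIV) = std (Max UNIV)"
    unfolding h_def matrix_vector_mul_assoc[symmetric] shear_Max \<open>m *v antichain_vec = z\<close> z_def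
    by (simp only: matrix_vector_mul_assoc c matrix_vector_mul_lid)
  then have h: "h \<in> B_pred" unfolding B_pred_iff h_def using Borel_mult b mB shear_Borel by blast
  have "act h base_flag = act b (act m (act (perm_mat w) E_plus))"
    unfolding h_def base_flag_def act_mult[symmetric]
    by (simp add: matrix_mul_assoc[symmetric]) (simp add: matrix_mul_assoc shear_inv)
  also have "act m (act (perm_mat w) E_plus) = act (perm_mat w) E_plus"
    by (rule triangular_fixes_perm_flag(2)[OF w mpos diag])
  finally have hF: "act h base_flag = F" by (simp add: F act_mult)
  have "sweep B_pred {F} = orbit"
  proof (intro equalityI subsetI)
    fix G assume "G \<in> sweep B_pred {F}"
    then obtain g where "g \<in> B_pred" "G = act (g ** h) base_flag"
      by (auto simp: sweep_singleton hF[symmetric] act_mult)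
    then show "G \<in> orbit" unfolding orbit_def sweep_singleton using B_pred_mult[OF _ h] by blast
  next
    fix G assume "G \<in> orbit"
    then obtain g where g: "g \<in> B_pred" "G = act g base_flag" by (auto simp: orbit_def sweep_singleton)
    obtain k where k: "k \<in> B_pred" "k ** h = mat 1" by (rule B_pred_inverse[OF h])
    have "act (g ** k) F = act (g ** (k ** h)) base_flag" by (simp only: hF[symmetric] act_mult)
    then have "G = act (g ** k) F" by (simp add: k g)
    then show "G \<in> sweep B_pred {F}" unfolding sweep_singleton using B_pred_mult[OF g(1) k(1)] by blast
  qed
  then show ?thesis using that orbit_data_axioms by blast
qed


section \<open>The dimension of an orbit\<close>

lemma prime_on_image:
  assumes "prime_on X" and pull: "\<And>f. f \<in> poly_funs \<Longrightarrow> (\<lambda>x. f (\<phi> x)) \<in> poly_funs"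
  shows "prime_on (\<phi> ` X)"
  unfolding prime_on_def
proof (intro ballI impI)
  fix f g assume f: "f \<in> poly_funs" and g: "g \<in> poly_funs" and z: "\<forall>y\<in>\<phi> ` X. f y * g y = 0"
  have "(\<forall>x\<in>X. f (\<phi> x) = 0) \<or> (\<forall>x\<in>X. g (\<phi> x) = 0)"
    by (rule prime_onD[OF assms(1) pull[OF f] pull[OF g]]) (use z in blast)
  then show "(\<forall>y\<in>\<phi> ` X. f y = 0) \<or> (\<forall>y\<in>\<phi> ` X. g y = 0)" by blast
qed

lemma closed_separation:
  assumes "closedin (subtopology flag_variety Q) Z" "F \<in> Q" "F \<notin> Z" "x \<in> GL" "F = act x E_plus"
  shows "\<exists>f\<in>poly_funs. (\<forall>g\<in>GL. act g E_plus \<in> Z \<longrightarrow> f g = 0) \<and> f x \<noteq> 0"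
proof -
  obtain C where C: "closedin flag_variety C" "Z = C \<inter> Q"
    using assms(1) by (auto simp: closedin_subtopology)
  obtain P where P: "P \<subseteq> poly_funs" "\<forall>g\<in>GL. act g E_plus \<in> C \<longleftrightarrow> (\<forall>f\<in>P. f g = 0)"
    by (rule closed_flags_polynomials[OF C(1)])
  have "act x E_plus \<notin> C" using assms C(2) by auto
  then obtain f where "f \<in> P" "f x \<noteq> 0" using P(2) assms(4) by auto
  then show ?thesis using P C(2) by (intro bexI[of _ f]) auto
qed

text \<open>Free the entries of the upper triangular matrices one after the other, starting from the identity.
This chain prolongs the preimages of closed sets of flags downwards, by the dimension \<open>N\<close> of the
Borel group.\<close>

lemma Borel_coset_chain:
  fixes g :: "'n::{finite,wellorder} cmat"
  assumes g: "g \<in> GL"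
  defines "N \<equiv> card {(i, j). i \<le> (j :: 'n)}"
  obtains X where "X 0 \<noteq> {}" "\<And>t. t \<le> N \<Longrightarrow> prime_on (X t)" "\<And>t. t < N \<Longrightarrow> X t \<subseteq> X (Suc t)"
    "\<And>t. t < N \<Longrightarrow> \<exists>f\<in>poly_funs. (\<forall>x\<in>X t. f x = 0) \<and> (\<exists>x\<in>X (Suc t). f x \<noteq> 0)"
    "X N = (\<lambda>b. g ** b) ` Borel"
proof -
  obtain ps :: "('n \<times> 'n) list" where ps: "set ps = {(i, j). i \<le> j}" "distinct ps"
    using finite_distinct_list[of "{(i, j). i \<le> (j :: 'n)}"] by auto
  have len: "length ps = N" unfolding N_def ps(1)[symmetric] by (simp add: distinct_card ps(2))
  define L :: "nat \<Rightarrow> 'n cmat set" where "L t = {b. (\<forall>i j. j < i \<longrightarrow> b $ i $ j = 0) \<and>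
    (\<forall>(i, j)\<in>set (drop t ps). b $ i $ j = (if i = j then 1 else 0))}" for t
  define X where "X t = (\<lambda>b. g ** b) ` (L t \<inter> GL)" for t
  have mono: "L t \<subseteq> L (Suc t)" for t
    unfolding L_def using set_drop_subset_set_drop[of t "Suc t" ps] by auto
  have one: "mat 1 \<in> L t \<inter> GL" for t
    using mat_1_Borel by (auto simp: L_def Borel_iff mat_def)
  show ?thesis
  proof (rule that[of X])
    show "X 0 \<noteq> {}" using one by (auto simp: X_def)
    show "prime_on (X t)" for t
      unfolding X_def
    proof (intro prime_on_image prime_on_line_closed poly_funs_mult_left)
      show "line_closed (L t)" by (auto simp: line_closed_def L_def line_def case_prod_beta)
    qed
    show "X t \<subseteq> X (Suc t)" for t using mono by (auto simp: X_def)
    show "X N = (\<lambda>b. g ** b) ` Borel" unfolding X_def Borel_eq by (simp add: L_def len)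
    fix t assume t: "t < N"
    obtain i j where ij: "ps ! t = (i, j)" by fastforce
    obtain h where h: "h ** g = mat 1" using GL_inverse[OF g] by metis
    define f where "f x = (h ** x) $ i $ j + (if i = j then -1 else 0)" for x
    have f: "f (g ** b) = b $ i $ j + (if i = j then -1 else 0)" for b
      unfolding f_def by (simp add: matrix_mul_assoc h)
    have "(i, j) \<in> set (drop t ps)"
      using ij t len by (metis Cons_nth_drop_Suc list.set_intros(1))
    then have "\<forall>x\<in>X t. f x = 0" by (auto simp: X_def f L_def)
    moreover
    \<comment> \<open>Adding \<open>1\<close> to the identity matrix at \<open>(i, j)\<close> gives \<open>2\<close> if \<open>i = j\<close>, so \<open>b\<close> is invertible.\<close>
    define b :: "'n cmat" where "b = (\<chi> r c. (if r = c then 1 else 0) + (if (r, c) = (i, j) then 1 else 0))"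
    have "i \<le> j" using ij t len ps(1) nth_mem[of t ps] by auto
    then have up: "b $ r $ c = 0" if "c < r" for r c using that by (auto simp: b_def)
    have "b $ r $ r \<noteq> 0" for r by (simp add: b_def)
    then have "b \<in> Borel" using up by (simp add: Borel_def)
    then have "b \<in> GL" by (simp add: Borel_iff)
    moreover have "b \<in> L (Suc t)"
    proof -
      have "(i, j) \<notin> set (drop (Suc t) ps)"
        using ij t len ps(2) by (metis Cons_nth_drop_Suc distinct.simps(2) distinct_drop)
      then show ?thesis using up by (auto simp: L_def b_def)
    qed
    moreover have "f (g ** b) \<noteq> 0" by (simp add: f b_def)
    moreover have "f \<in> poly_funs"
    proof -
      have "(\<lambda>x. (h ** x) $ i $ j) \<in> poly_funs" by (rule poly_funs_mult_left[OF poly_funs.entry])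
      from poly_funs.add[OF this poly_funs.const] show ?thesis unfolding f_def[abs_def] .
    qed
    ultimately show "\<exists>f\<in>poly_funs. (\<forall>x\<in>X t. f x = 0) \<and> (\<exists>x\<in>X (Suc t). f x \<noteq> 0)"
      unfolding X_def by (intro bexI[of _ f]) blast+
  qed
qed

lemma span_monomials_matrix_mult:
  assumes "\<And>i j. (\<lambda>\<theta>. A \<theta> $ i $ j) \<in> function_space.span (monomials V d)"
    "\<And>i j. (\<lambda>\<theta>. B \<theta> $ i $ j) \<in> function_space.span (monomials V e)"
  shows "(\<lambda>\<theta>. (A \<theta> ** B \<theta>) $ i $ j) \<in> function_space.span (monomials V (d + e))"
  unfolding matrix_matrix_mult_def
  by (simp, intro span_monomials_sum span_monomials_mult assms)

context orbit_data
begin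

text \<open>The preimages of the chain in \<open>GL\<close>, prolonged downwards by \<open>N\<close> steps within a coset of the Borel
group, form a chain of prime sets. The preimage of the orbit is parametrized by the free entries
together with the \<open>N\<close> entries of an upper triangular matrix, whence \<open>N + k \<le> card free + N\<close>.\<close>

lemma chain_in_orbit_le:
  fixes Z :: "nat \<Rightarrow> 'n flag set"
  assumes cl: "\<And>i. i \<le> k \<Longrightarrow> closedin (subtopology flag_variety orbit) (Z i)"
    and irr: "\<And>i. i \<le> k \<Longrightarrow> irreducible_in (subtopology flag_variety orbit) (Z i)"
    and strict: "\<And>i. i < k \<Longrightarrow> Z i \<subset> Z (Suc i)"
  shows "k \<le> card free"
proof -
  have Zorb: "Z i \<subseteq> orbit" if "i \<le> k" for i
    using irr[OF that] by (auto simp: irreducible_in_def)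
  have flg: "orbit \<subseteq> flags"
    unfolding orbit_def sweep_singleton using flags_act[OF base_flag_flags] by (auto simp: B_pred_iff Borel_iff)
  define U where "U i = {g \<in> GL. act g E_plus \<in> Z i}" for i
  define N where "N = card {(i, j). i \<le> (j :: 'n)}"
  obtain F where F: "F \<in> Z 0" using irr[of 0] by (auto simp: irreducible_in_def)
  then have "F \<in> flags" using Zorb[of 0] flg by auto
  then obtain g where g: "g \<in> GL" "F = act g E_plus" by (rule flags_eq_GL_orbit)
  obtain X where X: "X 0 \<noteq> {}" "\<And>t. t \<le> N \<Longrightarrow> prime_on (X t)" "\<And>t. t < N \<Longrightarrow> X t \<subseteq> X (Suc t)"
    "\<And>t. t < N \<Longrightarrow> \<exists>f\<in>poly_funs. (\<forall>x\<in>X t. f x = 0) \<and> (\<exists>x\<in>X (Suc t). f x \<noteq> 0)"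
    "X N = (\<lambda>b. g ** b) ` Borel"
    by (rule Borel_coset_chain[OF g(1), folded N_def]) blast
  have XU: "X N \<subseteq> U 0"
    using F g unfolding X(5) U_def by (auto simp: act_mult Borel_act Borel_iff intro: GL_mult)
  \<comment> \<open>The set \<open>X N\<close>, a full coset, is replaced by \<open>U 0\<close>, which contains it.\<close>
  define C where "C t = (if t < N then X t else U (t - N))" for t
  have XC: "X (Suc t) \<subseteq> C (Suc t)" if "t < N" for t
    using XU that by (cases "Suc t = N") (auto simp: C_def)
  define V :: "(('n \<times> 'n) + ('n \<times> 'n)) set" where "V = Inl ` free \<union> Inr ` {(i, j). i \<le> j}"
  define \<psi> where "\<psi> \<theta> = shear_inv ** slice (\<lambda>p. \<theta> (Inl p)) ** perm_mat w **
      (\<chi> i j. if i \<le> j then \<theta> (Inr (i, j)) else 0)" for \<theta> :: "('n \<times> 'n) + ('n \<times> 'n) \<Rightarrow> complex"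
  have V: "finite V" "card V = card free + N"
  proof -
    have "card V = card (Inl ` free :: (('n \<times> 'n) + ('n \<times> 'n)) set) +
        card (Inr ` {(i, j). i \<le> j} :: (('n \<times> 'n) + ('n \<times> 'n)) set)"
      unfolding V_def by (intro card_Un_disjoint) auto
    then show "card V = card free + N" by (simp add: card_image N_def)
  qed (simp add: V_def)
  have "(\<lambda>\<theta>. slice (\<lambda>p. \<theta> (Inl p)) $ i $ j) \<in> function_space.span (monomials V 1)" for i j
  proof -
    have e: "(\<lambda>\<theta>. entry (\<lambda>p. \<theta> (Inl p)) i j) \<in> function_space.span (monomials V 1)" for i j
    proof (cases "(i, j) \<in> free")
      case True
      then have "Inl (i, j) \<in> V" by (simp add: V_def)
      from span_monomials_var[OF V(1) this] show ?thesis
        unfolding entry_def by (simp only: True if_True)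
    next
      case False
      then show ?thesis unfolding entry_def by (simp add: span_monomials_const)
    qed
    show ?thesis
    proof (cases "j = mu i")
      case True
      then have "(\<lambda>\<theta> :: ('n \<times> 'n) + ('n \<times> 'n) \<Rightarrow> complex. slice (\<lambda>p. \<theta> (Inl p)) $ i $ j) =
          (\<lambda>\<theta>. antichain_vec $ i - (\<Sum>k\<in>\<Delta> - {mu i}. entry (\<lambda>p. \<theta> (Inl p)) i k))"
        by (simp add: slice_def)
      then show ?thesis
        by (simp only:) (intro span_monomials_diff span_monomials_const span_monomials_sum e)
    next
      case False
      then have "(\<lambda>\<theta> :: ('n \<times> 'n) + ('n \<times> 'n) \<Rightarrow> complex. slice (\<lambda>p. \<theta> (Inl p)) $ i $ j) = (\<lambda>\<theta>. entry (\<lambda>p. \<theta> (Inl p)) i j)"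
        by (simp add: slice_def)
      then show ?thesis by (simp only: e)
    qed
  qed
  moreover have "(\<lambda>\<theta>. (\<chi> i j. if i \<le> j then \<theta> (Inr (i, j)) else 0) $ i $ j) \<in> function_space.span (monomials V 1)" for i j
  proof (cases "i \<le> j")
    case True
    then have "Inr (i, j) \<in> V" by (auto simp: V_def)
    from span_monomials_var[OF V(1) this] show ?thesis by (simp only: True if_True vec_lambda_beta)
  qed (simp add: span_monomials_const)
  ultimately have \<psi>: "(\<lambda>\<theta>. \<psi> \<theta> $ i $ j) \<in> function_space.span (monomials V (0 + 1 + 0 + 1))" for i j
    unfolding \<psi>_def by (intro span_monomials_matrix_mult span_monomials_const)
  have "N + k \<le> card V"
  proof (rule prime_chain_length_le[of C, OF _ _ _ _ V(1) \<psi>])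
    show "C 0 \<noteq> {}" using X(1) XU X(5) g F by (cases "N = 0") (auto simp: C_def U_def)
    show "prime_on (C t)" if "t \<le> N + k" for t
    proof (cases "t < N")
      case False
      then have "prime_on (U (t - N))" unfolding U_def using that by (intro prime_on_preimage[OF irr]) auto
      then show ?thesis using False by (simp add: C_def)
    qed (simp add: C_def X(2))
    show "C t \<subseteq> C (Suc t)" if "t < N + k" for t
    proof (cases "t < N")
      case True
      then show ?thesis using X(3)[OF True] XC[OF True] by (auto simp: C_def)
    next
      case False
      then have "t - N < k" using that by linarith
      from strict[OF this] have "Z (t - N) \<subseteq> Z (Suc (t - N))" by blast
      moreover have "C t = U (t - N)" "C (Suc t) = U (Suc (t - N))"
        using False by (auto simp: C_def Suc_diff_le)
      ultimately show ?thesis by (auto simp: U_def)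
    qed
    show "\<exists>f\<in>poly_funs. (\<forall>x\<in>C t. f x = 0) \<and> (\<exists>x\<in>C (Suc t). f x \<noteq> 0)" if "t < N + k" for t
    proof (cases "t < N")
      case True
      then have "C t = X t" by (simp add: C_def)
      then show ?thesis using X(4)[OF True] XC[OF True] by blast
    next
      case False
      define i where "i = t - N"
      have i: "i < k" "t = N + i" using that False by (auto simp: i_def)
      obtain G where G: "G \<in> Z (Suc i)" "G \<notin> Z i" using strict[OF i(1)] by blast
      then have "G \<in> orbit" using Zorb[of "Suc i"] i by auto
      then have "G \<in> flags" using flg by blast
      then obtain x where x: "x \<in> GL" "G = act x E_plus" by (rule flags_eq_GL_orbit)
      have "\<exists>f\<in>poly_funs. (\<forall>g\<in>GL. act g E_plus \<in> Z i \<longrightarrow> f g = 0) \<and> f x \<noteq> 0"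
        using closed_separation[OF cl \<open>G \<in> orbit\<close> G(2) x] i by simp
      moreover have "C t = U i" "C (Suc t) = U (Suc i)" by (auto simp: C_def i)
      moreover have "x \<in> U (Suc i)" using x G by (simp add: U_def)
      ultimately show ?thesis unfolding U_def by auto
    qed
    show "C (N + k) \<subseteq> range \<psi>"
    proof
      fix x assume "x \<in> C (N + k)"
      then have x: "x \<in> GL" "act x E_plus \<in> orbit" using Zorb[of k] by (auto simp: C_def U_def)
      obtain \<theta> b where b: "b \<in> Borel" "x = shear_inv ** slice \<theta> ** perm_mat w ** b"
        by (rule orbit_parametrized[OF x])
      define \<theta>' where "\<theta>' = case_sum \<theta> (\<lambda>(i, j). b $ i $ j)"
      have "(\<chi> i j. if i \<le> j then \<theta>' (Inr (i, j)) else 0) = b"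
        using b(1) by (auto simp: vec_eq_iff Borel_def \<theta>'_def)
      moreover have "(\<lambda>p. \<theta>' (Inl p)) = \<theta>" by (simp add: \<theta>'_def)
      ultimately have "x = \<psi> \<theta>'" by (simp only: \<psi>_def b(2))
      then show "x \<in> range \<psi>" by blast
    qed
  qed
  then show ?thesis using V(2) by simp
qed

text \<open>The free positions are sorted by the position of their column, and the free entries are switched on
from the last one backwards. While the entry at \<open>(i, c)\<close> and all earlier ones are switched off, row
\<open>i\<close> of the matrix vanishes in all columns of position at most \<open>pos c\<close>. So coordinate \<open>i\<close> vanishes on
the subspace number \<open>pos c\<close> of the (sheared) flag. This is a closed condition on flags, and it is
violated as soon as the entry at \<open>(i, c)\<close> is switched on.\<close>

lemma orbit_chain_exists:
  "enat (card free) \<le> krull_dim (subtopology flag_variety orbit)"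
proof -
  define d where "d = card free"
  obtain xs where xs: "set xs = free" "distinct xs" using finite_distinct_list[of free] by auto
  define ys where "ys = sort_key (\<lambda>p. pos (snd p)) xs"
  have ys: "set ys = free" "distinct ys" "length ys = d"
    using xs distinct_card[OF xs(2)] by (simp_all add: ys_def d_def)
  have sorted: "pos (snd (ys ! a)) \<le> pos (snd (ys ! b))" if "a \<le> b" "b < d" for a b
  proof -
    have "sorted (map (\<lambda>p. pos (snd p)) ys)" by (simp add: ys_def)
    then show ?thesis using sorted_nth_mono[of "map (\<lambda>p. pos (snd p)) ys" a b] that ys(3) by simp
  qed
  define L where "L t = {slice \<theta> |\<theta>. \<forall>p\<in>free - set (drop (d - t) ys). \<theta> p = 0}" for t
  define X where "X t = (\<lambda>x. shear_inv ** x ** perm_mat w) ` (L t \<inter> GL)" for t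
  define Z where "Z t = (\<lambda>g. act g E_plus) ` X t" for t
  have mono: "L t \<subseteq> L (Suc t)" for t
    unfolding L_def using set_drop_subset_set_drop[of "d - Suc t" "d - t" ys] by fastforce
  have Z_eq: "Z t = (\<lambda>x. act (shear_inv ** x ** perm_mat w) E_plus) ` (L t \<inter> GL)" for t
    by (simp add: Z_def X_def image_image)
  have GLI: "slice \<theta> \<in> GL" if "\<And>i. slice \<theta> $ i $ i \<noteq> 0" for \<theta>
  proof -
    have "slice \<theta> \<in> Borel" using that slice_upper by (simp add: Borel_def)
    then show ?thesis by (simp add: Borel_iff)
  qed
  have "enat d \<le> krull_dim (subtopology flag_variety orbit)"
  proof (rule krull_dim_ge_chain[of d _ Z])
    fix t
    show "irreducible_in flag_variety (Z t)"
      unfolding Z_def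
    proof (rule irreducible_in_flag_variety)
      have "line_closed (L t)"
        unfolding line_closed_def L_def by (auto simp: line_slice intro!: exI[of _ "\<lambda>p. _ p + _ * (_ p - _ p)"])
      then show "prime_on (X t)"
        unfolding X_def by (intro prime_on_image prime_on_line_closed poly_funs_mult_left poly_funs_mult_right)
          (simp_all add: poly_funs_mult_left[OF poly_funs_mult_right, unfolded matrix_mul_assoc])
      show "X t \<subseteq> GL" unfolding X_def by (auto intro!: GL_mult shear_inv_GL perm_mat_GL bij_w)
      have "entry (\<lambda>_. 0) i k = 0" if "k \<noteq> i" for i k using that by (simp add: entry_def)
      then have "slice (\<lambda>_. 0) \<in> GL" by (intro GLI) (simp add: slice_diag)
      then show "X t \<noteq> {}" by (auto simp: X_def L_def)
    qed
    show "Z t \<subseteq> Z (Suc t)" using mono by (auto simp: Z_def X_def)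
    show "Z t \<subseteq> orbit"
      unfolding Z_eq orbit_eq using slice_in_fixing by (auto simp: L_def)
    assume t: "t < d"
    define m where "m = d - Suc t"
    have m: "m < d" "d - t = Suc m" using t by (auto simp: m_def)
    obtain i c where ic: "ys ! m = (i, c)" by fastforce
    have drop: "drop m ys = (i, c) # drop (Suc m) ys" using m(1) ys(3) ic by (metis Cons_nth_drop_Suc)
    have "(i, c) \<in> free" using ic m(1) ys nth_mem[of m ys] by auto
    then have free: "i < c" "pos c < pos i" "c \<noteq> mu i" by (auto simp: free_def)
    have later: "\<theta> (i, c') = 0" if \<theta>: "\<forall>p\<in>free - set (drop (Suc m) ys). \<theta> p = 0"
      and c': "(i, c') \<in> free" "pos c' \<le> pos c" for \<theta> :: "'n \<times> 'n \<Rightarrow> complex" and c'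
    proof -
      have "(i, c') \<notin> set (drop (Suc m) ys)"
      proof
        assume mem: "(i, c') \<in> set (drop (Suc m) ys)"
        then obtain a where a: "a < length (drop (Suc m) ys)" "drop (Suc m) ys ! a = (i, c')"
          by (auto simp: in_set_conv_nth)
        then have "ys ! (Suc m + a) = (i, c')" "Suc m + a < d" using ys(3) by auto
        then have "pos c \<le> pos c'" using sorted[of m "Suc m + a"] ic by simp
        then have "c' = c" using c'(2) inj_pos[of c' c] by simp
        then show False using mem ys(2) drop by (metis distinct.simps(2) distinct_drop)
      qed
      then show ?thesis using \<theta> c'(1) by blast
    qed
    have zero: "slice \<theta> $ i $ c' = 0" if \<theta>: "\<forall>p\<in>free - set (drop (Suc m) ys). \<theta> p = 0"
      and c': "pos c' \<le> pos c" for \<theta> c'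
    proof -
      have ne: "i \<noteq> c'" using c' free(2) by auto
      show ?thesis
      proof (cases "c' = mu i")
        case False
        then show ?thesis using later[OF \<theta> _ c'] ne by (simp add: slice_def entry_def)
      next
        case True
        have nc: "i \<notin> cone" using mu_cone(3)[of i] c' free(2) unfolding True by (meson leD le_less_trans)
        note nc' = not_cone[OF nc]
        have "entry \<theta> i k = 0" if k: "k \<in> \<Delta> - {mu i}" for k
        proof (cases "(i, k) \<in> free")
          case True
          then have "i < k" by (simp add: free_def)
          then have "nxt i \<le> k" "nxt i \<noteq> k" using nxt(3)[OF nc'(2)] k nc'(3) by auto
          then have "pos k < pos (nxt i)" using antichain[OF nxt(1)[OF nc'(2)]] k by (simp add: order_less_le)
          then have "pos k \<le> pos c" using c' \<open>c' = mu i\<close> nc'(3) by simp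
          then show ?thesis using later[OF \<theta> True] True by (simp add: entry_def)
        next
          case False
          then show ?thesis using k nc'(1) by (auto simp: entry_def)
        qed
        then show ?thesis using True nc'(1) by (simp add: slice_def antichain_vec_def)
      qed
    qed
    define C where "C = {F \<in> flags. \<forall>x\<in>F (pos c). (shear *v x) $ i = 0}"
    have shear_cancel: "shear *v (shear_inv *v v) = v" for v by (simp add: matrix_vector_mul_assoc shear_inv)
    have memC: "act g E_plus \<in> C \<longleftrightarrow> (\<forall>j\<le>pos c. (shear *v (g *v std j)) $ i = 0)" if "g \<in> GL" for g
    proof -
      let ?H = "{x. (shear *v x) $ i = 0}" and ?B = "(\<lambda>j. g *v std j) ` {..pos c}"
      have H: "vec.subspace ?H"
        by (auto simp: vec.subspace_def matrix_vector_right_distrib vector_scalar_commute)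
      have "act g E_plus \<in> C \<longleftrightarrow> act g E_plus (pos c) \<subseteq> ?H"
        using act_E_plus_flags[OF that] by (auto simp: C_def)
      also have "\<dots> \<longleftrightarrow> vec.span ?B \<subseteq> ?H" by (simp only: act_E_plus span_flag_def)
      also have "\<dots> \<longleftrightarrow> ?B \<subseteq> ?H"
        using vec.span_minimal[OF _ H, of ?B] vec.span_superset[of ?B] by (meson order_trans)
      also have "\<dots> \<longleftrightarrow> (\<forall>j\<le>pos c. (shear *v (g *v std j)) $ i = 0)" by auto
      finally show ?thesis .
    qed
    have "closedin flag_variety C"
      unfolding closedin_flag_variety
    proof (intro conjI exI[of _ "(\<lambda>j g. (shear ** g) $ i $ j) ` {..pos c}"] ballI)
      show "C \<subseteq> flags" by (auto simp: C_def)
      show "(\<lambda>j g. (shear ** g) $ i $ j) ` {..pos c} \<subseteq> poly_funs"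
        using poly_funs_mult_left[OF poly_funs.entry] by blast
      fix g assume "g \<in> (GL :: 'n cmat set)"
      then show "act g E_plus \<in> C \<longleftrightarrow> (\<forall>f\<in>(\<lambda>j g. (shear ** g) $ i $ j) ` {..pos c}. f g = 0)"
        by (simp add: memC matrix_vector_mul_assoc del: mult_std_nth) auto
    qed
    moreover have tr: "(shear *v (shear_inv ** x ** perm_mat w *v std j)) $ i = x $ i $ w j" for x j
      by (simp only: matrix_vector_mul_assoc[symmetric] shear_cancel perm_mat_std mult_std_nth)
    have inGL: "shear_inv ** x ** perm_mat w \<in> GL" if "x \<in> GL" for x
      using that by (intro GL_mult shear_inv_GL perm_mat_GL bij_w)
    have "Z t \<subseteq> C"
    proof
      fix F assume "F \<in> Z t"
      then obtain \<theta> where \<theta>: "slice \<theta> \<in> GL" "\<forall>p\<in>free - set (drop (Suc m) ys). \<theta> p = 0"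
        "F = act (shear_inv ** slice \<theta> ** perm_mat w) E_plus" unfolding Z_eq L_def m(2) by auto
      show "F \<in> C" unfolding \<theta>(3) memC[OF inGL[OF \<theta>(1)]] tr using zero[OF \<theta>(2)] by simp
    qed
    moreover have "\<not> Z (Suc t) \<subseteq> C"
    proof
      assume sub: "Z (Suc t) \<subseteq> C"
      \<comment> \<open>The value \<open>-1\<close> keeps the matrix invertible: its diagonal entries are \<open>1\<close> or \<open>2\<close>.\<close>
      define \<theta> :: "'n \<times> 'n \<Rightarrow> complex" where "\<theta> p = (if p = (i, c) then -1 else 0)" for p
      have "slice \<theta> $ r $ r \<noteq> 0" for r
      proof -
        have "(\<Sum>k\<in>\<Delta> - {r}. entry \<theta> r k) = (\<Sum>k\<in>\<Delta> - {r}. if k = c then if r = i then -1 else 0 else 0)"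
          using \<open>(i, c) \<in> free\<close> by (intro sum.cong) (auto simp: entry_def \<theta>_def)
        also have "\<dots> = (if c \<in> \<Delta> - {r} then if r = i then -1 else 0 else 0)" by (simp add: sum.delta)
        finally show ?thesis by (simp add: slice_diag)
      qed
      then have GL: "slice \<theta> \<in> GL" by (rule GLI)
      have "\<forall>p\<in>free - set (drop (d - Suc t) ys). \<theta> p = 0"
        using drop by (auto simp: \<theta>_def m_def)
      then have "act (shear_inv ** slice \<theta> ** perm_mat w) E_plus \<in> Z (Suc t)"
        unfolding Z_eq L_def using GL by blast
      then have "slice \<theta> $ i $ c = 0" using sub memC[OF inGL[OF GL]] unfolding tr by force
      moreover have "slice \<theta> $ i $ c = -1"
        using free(3) \<open>(i, c) \<in> free\<close> by (simp add: slice_def entry_def \<theta>_def)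
      ultimately show False by simp
    qed
    ultimately show "\<exists>C. closedin flag_variety C \<and> Z t \<subseteq> C \<and> \<not> Z (Suc t) \<subseteq> C" by blast
  qed
  then show ?thesis by (simp add: d_def)
qed

lemma krull_dim_orbit: "krull_dim (subtopology flag_variety orbit) = enat (card free)"
proof (rule antisym)
  show "krull_dim (subtopology flag_variety orbit) \<le> enat (card free)"
    unfolding krull_dim_def
  proof (rule Sup_least)
    fix x assume "x \<in> {enat k |k. \<exists>Z :: nat \<Rightarrow> 'n flag set.
      (\<forall>i\<le>k. closedin (subtopology flag_variety orbit) (Z i) \<and>
        irreducible_in (subtopology flag_variety orbit) (Z i)) \<and> (\<forall>i<k. Z i \<subset> Z (Suc i))}"
    then obtain k and Z :: "nat \<Rightarrow> 'n flag set" where "x = enat k"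
      "\<And>i. i \<le> k \<Longrightarrow> closedin (subtopology flag_variety orbit) (Z i)"
      "\<And>i. i \<le> k \<Longrightarrow> irreducible_in (subtopology flag_variety orbit) (Z i)"
      "\<And>i. i < k \<Longrightarrow> Z i \<subset> Z (Suc i)" by blast
    then show "x \<le> enat (card free)" using chain_in_orbit_le[of k Z] by simp
  qed
qed (rule orbit_chain_exists)

end


section \<open>The shape of an orbit\<close>

text \<open>Uniqueness in the Bruhat decomposition, conjugated by \<open>p\<close>.\<close>

lemma perm_flag_cells_distinct:
  fixes p :: "'n::{finite,wellorder} \<Rightarrow> 'n"
  assumes p: "bij p" and w: "bij w" and w': "bij w'" and E: "E = act (perm_mat p) E_plus"
    and eq: "sweep (stabilizer E) {act (perm_mat w) E} = sweep (stabilizer E) {act (perm_mat w') E}"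
  shows "w = w'"
proof -
  let ?q = "perm_inv p"
  have q: "bij ?q" using p by (rule bij_imp_bij_inv)
  have "mat 1 \<in> stabilizer E"
    by (auto simp: stabilizer_def GL_def invertible_def intro!: exI[of _ "mat 1"])
  then have "act (mat 1) (act (perm_mat w) E) \<in> sweep (stabilizer E) {act (perm_mat w) E}"
    unfolding sweep_singleton by blast
  then obtain s where s: "s \<in> stabilizer E" "act (perm_mat w) E = act s (act (perm_mat w') E)"
    unfolding eq unfolding sweep_singleton by auto
  have sGL: "s \<in> GL" and sE: "act s E = E" using s(1) by (auto simp: stabilizer_def)
  note PGL = perm_mat_GL[OF p] perm_mat_GL[OF w] perm_mat_GL[OF w']
  have "act (perm_mat w ** perm_mat p) E_plus = act (s ** perm_mat w' ** perm_mat p) E_plus"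
    using s(2) by (simp add: E act_mult)
  then obtain b where b: "b \<in> Borel" "perm_mat w ** perm_mat p = s ** perm_mat w' ** perm_mat p ** b"
    using act_E_plus_eq_iff[of "perm_mat w ** perm_mat p" "s ** perm_mat w' ** perm_mat p"] PGL sGL
    by (auto intro: GL_mult)
  have "act (s ** perm_mat p) E_plus = act (perm_mat p) E_plus" using sE by (simp add: E act_mult)
  then obtain c where c: "c \<in> Borel" "s ** perm_mat p = perm_mat p ** c"
    using act_E_plus_eq_iff[of "s ** perm_mat p" "perm_mat p"] PGL sGL by (auto intro: GL_mult)
  have "s = s ** perm_mat p ** perm_mat ?q"
    by (simp add: matrix_mul_assoc[symmetric] perm_mat_inverse[OF p])
  then have s_eq: "s = perm_mat p ** c ** perm_mat ?q" by (simp add: c)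
  obtain e where e: "e \<in> Borel" "e ** c = mat 1" using Borel_inverse[OF c(1)] by metis
  have "e ** perm_mat (?q \<circ> w \<circ> p) = e ** (perm_mat ?q ** (perm_mat w ** perm_mat p))"
    by (simp add: perm_mat_comp matrix_mul_assoc)
  also have "\<dots> = e ** (perm_mat ?q ** perm_mat p) ** c ** (perm_mat ?q ** perm_mat w' ** perm_mat p) ** b"
    unfolding b(2) s_eq by (simp add: matrix_mul_assoc)
  also have "\<dots> = (e ** c) ** (perm_mat ?q ** perm_mat w' ** perm_mat p) ** b"
    by (simp add: perm_mat_inverse[OF p])
  also have "\<dots> = perm_mat (?q \<circ> w' \<circ> p) ** b"
    by (simp add: e perm_mat_comp matrix_mul_assoc)
  finally have "?q \<circ> w \<circ> p = ?q \<circ> w' \<circ> p"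
    by (intro bruhat_unique[OF _ _ e(1) b(1)] bij_comp p w w' q)
  then have "p \<circ> (?q \<circ> w \<circ> p) \<circ> ?q = p \<circ> (?q \<circ> w' \<circ> p) \<circ> ?q" by (rule arg_cong)
  moreover have "p \<circ> (?q \<circ> v \<circ> p) \<circ> ?q = v" for v
    using p by (simp add: fun_eq_iff bij_is_surj surj_f_inv_f)
  ultimately show ?thesis by simp
qed

lemma E_star_eq: "E_star = act (perm_mat sigma) E_plus"
  by (simp add: E_star_def act_perm_E_plus)

lemma E_star_flags: "E_star \<in> flags"
  unfolding E_star_eq by (intro flags_act E_plus_flags perm_mat_GL bij_sigma)

lemma sigma_image_before:
  fixes k :: "'n::{finite,wellorder}"
  assumes "k = sigma j \<or> before k (sigma j)" "j \<le> i"
  shows "k \<in> sigma ` {..i}"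
proof -
  obtain j' where j': "k = sigma j'" using bij_is_surj[OF bij_sigma] by (metis surjD)
  have "j' \<le> j"
    using assms(1) unfolding j' sigma_before_iff inj_eq[OF bij_is_inj[OF bij_sigma]] by auto
  then show ?thesis using assms(2) j' by auto
qed

text \<open>The matrices in \<open>B_pred\<close> are triangular also for the order \<open>before\<close>, because the column and the row
of \<open>n\<close> are trivial off the diagonal.\<close>

lemma B_pred_stabilizes_E_star: "B_pred \<subseteq> (stabilizer E_star :: 'n::{finite,wellorder} cmat set)"
proof
  fix h :: "'n cmat" assume h: "h \<in> B_pred"
  then have GL: "h \<in> GL" and up: "\<And>i j. j < i \<Longrightarrow> h $ i $ j = 0"
    and col: "h *v std (Max UNIV) = std (Max UNIV)"
    by (auto simp: B_pred_iff Borel_iff)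
  have "act h E_star i \<subseteq> E_star i" for i
  proof -
    have "h *v std (sigma j) \<in> E_star i" if j: "j \<le> i" for j
    proof -
      have "k \<in> sigma ` {..i}" if k: "h $ k $ sigma j \<noteq> 0" for k
      proof (rule sigma_image_before[OF _ j])
        show "k = sigma j \<or> before k (sigma j)"
        proof (cases "sigma j = Max UNIV")
          case True
          then have "h $ k $ sigma j = std (Max UNIV) $ k" using col by (metis mult_std_nth)
          then show ?thesis using k True by (simp add: std_nth split: if_splits)
        next
          case False
          have "k \<le> sigma j" using up k by (meson not_le)
          then show ?thesis using False by (auto simp: before_def)
        qed
      qed
      then have "\<forall>k. k \<notin> sigma ` {..i} \<longrightarrow> (h *v std (sigma j)) $ k = 0" by auto
      then show ?thesis unfolding E_star_def span_flag_def image_image[of std sigma, symmetric] span_std by simp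
    qed
    then show ?thesis
      unfolding E_star_def act_span_flag by (subst span_flag_def, intro vec.span_minimal)
        (auto simp: span_flag_def)
  qed
  then have "act h E_star = E_star" by (rule flags_eqI[OF flags_act[OF E_star_flags GL] E_star_flags])
  then show "h \<in> stabilizer E_star" using GL by (simp add: stabilizer_def)
qed

context orbit_data
begin

definition u_star :: "'n \<Rightarrow> 'n" where "u_star = perm_inv rho \<circ> w \<circ> perm_inv sigma"

lemma bij_u_star: "bij u_star"
  unfolding u_star_def by (intro bij_comp bij_w bij_imp_bij_inv bij_rho bij_sigma)

text \<open>Replaces \<open>e_j\<close>, for \<open>j \<in> \<Delta>\<close>, by the sum of the \<open>e_i\<close> with \<open>j \<le> i \<in> \<Delta>\<close>. As \<open>pos\<close> decreases on \<open>\<Delta>\<close>, the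
added vectors precede \<open>e_j\<close> in the flag \<open>w E_plus\<close>, which is therefore preserved.\<close>

definition tail_mat :: "'n cmat" where
  "tail_mat = (\<chi> i j. if j \<in> \<Delta> then if i \<in> \<Delta> \<and> j \<le> i then 1 else 0 else if i = j then 1 else 0)"

lemma tail_mat:
  "tail_mat \<in> GL" "act tail_mat (act (perm_mat w) E_plus) = act (perm_mat w) E_plus"
proof -
  have "tail_mat $ i $ j = 0" if "pos j < pos i" for i j
    using antichain[of j i] that by (auto simp: tail_mat_def order_less_le)
  moreover have "tail_mat $ i $ i \<noteq> 0" for i by (simp add: tail_mat_def)
  ultimately show "tail_mat \<in> GL" "act tail_mat (act (perm_mat w) E_plus) = act (perm_mat w) E_plus"
    using triangular_fixes_perm_flag[OF bij_w, of tail_mat] by auto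
qed

text \<open>Both flags begin with \<open>antichain_vec\<close>. When \<open>e_c\<close> with \<open>c \<in> \<Delta>\<close> joins the span on the right, the sum
over the elements of \<open>\<Delta>\<close> up to \<open>c\<close> becomes available, hence so does the complementary sum over those
from \<open>nxt c = rho c\<close> on, which is the new vector on the left.\<close>

lemma tail_mat_rho_E_star: "act (tail_mat ** perm_mat rho) E_star = act shear E_star"
proof (rule flags_eqI)
  have shear_GL: "shear \<in> GL" using shear_Borel by (simp add: Borel_iff)
  show "act (tail_mat ** perm_mat rho) E_star \<in> flags" "act shear E_star \<in> flags"
    by (intro flags_act E_star_flags GL_mult tail_mat perm_mat_GL bij_rho shear_GL)+
  fix i
  define V where "V = vec.span ((\<lambda>j. shear *v std (sigma j)) ` {..i})"
  have V: "shear *v std c \<in> V" if "c = sigma j \<or> before c (sigma j)" "j \<le> i" for c j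
    using sigma_image_before[OF that] unfolding V_def by (intro vec.span_base) auto
  have "tail_mat *v std (rho (sigma j)) \<in> V" if j: "j \<le> i" for j
  proof -
    let ?c = "sigma j"
    consider "?c = Max UNIV" | "?c \<noteq> Max UNIV" "?c \<notin> \<Delta>" | "?c \<noteq> Max UNIV" "?c \<in> \<Delta>" by blast
    then show ?thesis
    proof cases
      case 1
      then have "rho ?c = Min \<Delta>" using Max_in_\<Delta> by (simp add: rho_def)
      then have "tail_mat *v std (rho ?c) = shear *v std ?c"
        unfolding 1 shear_Max using Min_\<Delta> by (auto simp: vec_eq_iff tail_mat_def antichain_vec_def)
      then show ?thesis using V[of ?c j] j by simp
    next
      case 2
      then have "tail_mat *v std (rho ?c) = shear *v std ?c"
        unfolding shear_other[OF 2(1)] by (auto simp: vec_eq_iff tail_mat_def rho_def std_nth)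
      then show ?thesis using V[of ?c j] j by simp
    next
      case 3
      have "tail_mat *v std (rho ?c) = antichain_vec - (\<Sum>b\<in>{b \<in> \<Delta>. b \<le> ?c}. std b)"
      proof -
        have "rho ?c = nxt ?c" using 3 by (simp add: rho_def)
        moreover have "(\<Sum>b\<in>{b \<in> \<Delta>. b \<le> ?c}. std b) $ k = (if k \<in> \<Delta> \<and> k \<le> ?c then 1 else 0)" for k
          by (simp add: std_nth)
        moreover have "nxt ?c \<le> k \<longleftrightarrow> \<not> k \<le> ?c" if "k \<in> \<Delta>" for k
          using less_nxt_iff[OF 3(1) that] by (auto simp: not_le[symmetric])
        ultimately show ?thesis using nxt(1)[OF 3(1)] by (auto simp: vec_eq_iff tail_mat_def antichain_vec_def)
      qed
      moreover have "antichain_vec \<in> V"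
        unfolding shear_Max[symmetric] using V[of "Max UNIV" j] 3(1) j by (simp add: before_def)
      moreover have "std b \<in> V" if "b \<in> \<Delta>" "b \<le> ?c" for b
      proof -
        have "?c < Max UNIV" using 3(1) by (simp add: order_less_le)
        then have b: "b \<noteq> Max UNIV" using that(2) by auto
        have "b = ?c \<or> before b ?c" using that(2) 3(1) by (auto simp: before_def)
        then show ?thesis using V[of b j] j shear_other[OF b] by simp
      qed
      then have "(\<Sum>b\<in>{b \<in> \<Delta>. b \<le> ?c}. std b) \<in> V"
        unfolding V_def by (intro vec.span_sum) auto
      ultimately show ?thesis unfolding V_def by (simp add: vec.span_diff)
    qed
  qed
  then have "vec.span ((\<lambda>j. tail_mat *v std (rho (sigma j))) ` {..i}) \<subseteq> V"
    unfolding V_def by (intro vec.span_minimal) auto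
  then show "act (tail_mat ** perm_mat rho) E_star i \<subseteq> act shear E_star i"
    by (simp add: E_star_def act_span_flag span_flag_def V_def matrix_vector_mul_assoc[symmetric])
qed

lemma sweep_E_plus_orbit:
  "sweep (stabilizer E_plus) orbit = sweep (stabilizer E_plus) {act (perm_mat w) E_plus}"
  unfolding orbit_def base_flag_def
  by (rule sweep_sweep_singleton) (auto simp: stabilizer_E_plus B_pred_iff mat_1_Borel shear_inv)

text \<open>The matrix \<open>s\<close> stabilizes \<open>E_star\<close> by \<open>tail_mat_rho_E_star\<close>, and it takes the flag of \<open>u_star\<close> to the
base flag, because \<open>tail_mat\<close> fixes \<open>w E_plus\<close>.\<close>

lemma sweep_E_star_orbit:
  "sweep (stabilizer E_star) orbit = sweep (stabilizer E_star) {act (perm_mat u_star) E_star}"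
proof -
  define s where "s = shear_inv ** tail_mat ** perm_mat rho"
  have "act s E_star = act shear_inv (act (tail_mat ** perm_mat rho) E_star)"
    by (simp add: s_def act_mult)
  also have "\<dots> = act (shear_inv ** shear) E_star" by (simp only: tail_mat_rho_E_star) (simp only: act_mult)
  finally have "act s E_star = E_star" by (simp add: shear_inv)
  moreover have "s \<in> GL" unfolding s_def by (intro GL_mult shear_inv_GL tail_mat perm_mat_GL bij_rho)
  ultimately have s: "s \<in> stabilizer E_star" by (simp add: stabilizer_def)
  have "rho \<circ> u_star \<circ> sigma = w"
    unfolding u_star_def
    by (simp add: fun_eq_iff bij_is_surj surj_f_inv_f bij_is_inj bij_rho bij_sigma)
  then have "perm_mat rho ** perm_mat u_star ** perm_mat sigma = perm_mat w"
    by (simp add: perm_mat_comp[symmetric])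
  then have "act s (act (perm_mat u_star) E_star) = act shear_inv (act tail_mat (act (perm_mat w) E_plus))"
    unfolding s_def E_star_eq act_mult[symmetric] by (simp add: matrix_mul_assoc[symmetric])
  also have "\<dots> = base_flag" by (simp add: tail_mat base_flag_def)
  finally have "base_flag = act s (act (perm_mat u_star) E_star)" ..
  then show ?thesis unfolding orbit_def
    using sweep_sweep_singleton[OF B_pred_stabilizes_E_star mat_1_B_pred s] by simp
qed

lemma Sh_orbit: "Sh orbit = (w, u_star)"
proof -
  have id: "E_plus = act (perm_mat id) (E_plus :: 'n flag)" by simp
  have "(THE w'. w' \<in> carrier W \<and> sweep (stabilizer E_plus) orbit =
      sweep (stabilizer E_plus) {act (perm_mat w') E_plus}) = w"
    unfolding sweep_E_plus_orbit carrier_W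
    by (rule the_equality) (use bij_w perm_flag_cells_distinct[OF bij_id _ _ id] in auto)
  moreover have "(THE u. u \<in> carrier W \<and> sweep (stabilizer E_star) orbit =
      sweep (stabilizer E_star) {act (perm_mat u) E_star}) = u_star"
    unfolding sweep_E_star_orbit carrier_W
    by (rule the_equality) (use bij_u_star perm_flag_cells_distinct[OF bij_sigma _ _ E_star_eq] in auto)
  ultimately show ?thesis by (simp add: Sh_def)
qed

lemma perm_inv_conj_u_star: "perm_inv (perm_inv sigma \<circ> u_star \<circ> sigma) = pos \<circ> rho \<circ> sigma"
proof (rule inv_unique_comp)
  show "(perm_inv sigma \<circ> u_star \<circ> sigma) \<circ> (pos \<circ> rho \<circ> sigma) = id"
    "(pos \<circ> rho \<circ> sigma) \<circ> (perm_inv sigma \<circ> u_star \<circ> sigma) = id"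
    unfolding u_star_def
    by (simp_all add: fun_eq_iff bij_is_surj surj_f_inv_f bij_is_inj bij_rho bij_sigma)
qed

lemma u_sigma_w: "u_star \<otimes>\<^bsub>W\<^esub> sigma \<otimes>\<^bsub>W\<^esub> inv\<^bsub>W\<^esub> w = inv\<^bsub>W\<^esub> rho"
proof -
  have "u_star \<otimes>\<^bsub>W\<^esub> sigma \<otimes>\<^bsub>W\<^esub> inv\<^bsub>W\<^esub> w = u_star \<circ> sigma \<circ> pos"
    by (simp add: inv_W mult_W bij_u_star bij_sigma bij_w bij_comp bij_imp_bij_inv)
  also have "\<dots> = perm_inv rho"
    unfolding u_star_def by (simp add: fun_eq_iff bij_is_inj bij_sigma)
  finally show ?thesis by (simp add: inv_W bij_rho)
qed

lemma dimension_count: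
  assumes "CARD('n) \<ge> 2"
  shows "2 * real (card free) = real (word_length S w) + real (word_length S_star u_star)
      + real (card \<Delta>) - real CARD('n)"
proof -
  have "card cone + card (- cone) = CARD('n)"
    using card_Un_disjoint[of cone "- cone"] by (simp add: Compl_partition)
  moreover have "card (cone - \<Delta>) + card \<Delta> = card cone"
    using \<Delta>_cone by (simp add: card_Diff_subset card_mono)
  moreover have "word_length S w = card (inversions pos)" by (rule word_length_eq_inversions[OF bij_w])
  moreover have "word_length S_star u_star = card moved_inversions"
    unfolding word_length_S_star[OF assms bij_u_star] perm_inv_conj_u_star by (rule card_inversions_rho)
  ultimately show ?thesis using card_free card_moved_inversions by linarith
qed

end

theorem theorem1p4:
  fixes Q :: "'n::{finite,wellorder} flag set"
    and w u :: "'n \<Rightarrow> 'n"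
  assumes "CARD('n) \<ge> 2"
    and "Q \<in> B_pred_orbits"
    and "Sh Q = (w, u)"
  shows "ereal_of_enat (krull_dim (subtopology flag_variety Q)) =
    ereal ((real (word_length S w) + real (word_length S_star u)
      + real (group.ord W (u \<otimes>\<^bsub>W\<^esub> sigma \<otimes>\<^bsub>W\<^esub> inv\<^bsub>W\<^esub> w)) - real CARD('n)) / 2)"
proof -
  obtain F where F: "F \<in> flags" "Q = sweep B_pred {F}"
    using assms(2) by (auto simp: B_pred_orbits_def)
  obtain v \<Delta> where v: "orbit_data v \<Delta>" and Q: "Q = orbit_data.orbit v \<Delta>"
    using orbit_normal_form[OF F(1)] unfolding F(2) by metis
  interpret orbit_data v \<Delta> by (rule v)
  have "Sh Q = (v, u_star)" unfolding Q by (rule Sh_orbit)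
  then have "w = v" "u = u_star" using assms(3) by auto
  then show ?thesis
    using dimension_count[OF assms(1)] by (simp add: Q krull_dim_orbit u_sigma_w ord_rho)
qed

end
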